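(* Let $\mathbf{u}\in C^1((0,T)\times D)\cap C([0,T]\times\bar D)$ (with pressure $p$) be the classical solution of the incompressible Euler equations $$\mathbf{u}_t+(\mathbf{u}\cdot\nabla)\mathbf{u}+\nabla p=\mathbf{f},\quad\operatorname{div}(\mathbf{u})=0\ \text{ in }D\times(0,T),\qquad\mathbf{u}\cdot\mathbf{n}=0\ \text{ on }\partial D\times(0,T),\qquad\mathbf{u}(x,0)=\bar{\mathbf{u}}(x)\ \ (x\in D).$$ Let $\mathbf{u}^{\ast}=\mathbf{u}_{\theta^{\ast}}$, $p^{\ast}=p_{\theta^{\ast}}$ be the PINN generated by the PINN algorithm with the loss function given in the context. Then the generalization error $\mathcal{E}_G=\big(\int_0^T\int_D\|\mathbf{u}(x,t)-\mathbf{u}^{\ast}(x,t)\|^2dx\,dt\big)^{1/2}$ is bounded as $$\begin{aligned}\mathcal{E}_G^2\le{}&\big(T+C_\infty T^2e^{C_\infty T}\big)\Big[(\mathcal{E}_T^{tb})^2+(\mathcal{E}_T^{\mathbf{u}})^2+C_0T^{\frac12}\big(\mathcal{E}_T^{div}+\mathcal{E}_T^{sb}\big)\Big]\\&+\big(T+C_\infty T^2e^{C_\infty T}\big)\Big[C_{quad}^{tb}N_{tb}^{-\alpha_{tb}}+C_{quad}^{int,\mathbf{u}}N_{int}^{-\alpha_{int}}+(C_{quad}^{int,div})^{\frac12}N_{int}^{-\frac{\alpha_{int}}2}+(C_{quad}^{sb})^{\frac12}N_{sb}^{-\frac{\alpha_{sb}}2}\Big].\end{aligned}$$ Here the constants are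 given by $$C_0=C\big(\|\mathbf{u}\|_{C^0([0,T]\times\bar D)},\|\mathbf{u}^{\ast}\|_{C^0([0,T]\times\bar D)},\|p\|_{C^0([0,T]\times\bar D)},\|p^{\ast}\|_{C^0([0,T]\times\bar D)}\big),$$ a constant depending on the indicated norms, and $C_\infty=1+2C_d\|\nabla\mathbf{u}\|_{L^\infty(D\times(0,T))}$ with $C_d$ depending only on the dimension $d$; and $C_{quad}^{tb}=C_{quad}^{tb}(\|\mathcal{R}_{tb,\theta^{\ast}}^2\|_{C^k})$, $C_{quad}^{int,\mathbf{u}}=C_{quad}^{int}(\|\mathcal{R}_{\mathbf{u},\theta^{\ast}}^2\|_{C^{k-1}})$, $C_{quad}^{int,div}=C_{quad}^{int}(\|\mathcal{R}_{div,\theta^{\ast}}^2\|_{C^{k-1}})$, $C_{quad}^{sb}=C_{quad}^{sb}(\|\mathcal{R}_{sb,\theta^{\ast}}^2\|_{C^k})$ are the constants of the quadrature error bounds in the context.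
   Context: $D\subset\mathbb{R}^d$, $d\in\{2,3\}$, is an open, bounded, connected set with smooth $C^1$ boundary $\partial D$ and unit outward normal $\mathbf{n}$; $T>0$; $\mathbf{u}:D\times(0,T)\to\mathbb{R}^d$ is the velocity, $p:D\times(0,T)\to\mathbb{R}$ the pressure, $\mathbf{f}\in C^1(D\times(0,T);\mathbb{R}^d)$ a forcing term, $\bar{\mathbf{u}}$ the initial velocity; $\|\cdot\|$ is the Euclidean norm on $\mathbb{R}^d$. PINN stands for physics informed neural network. Neural networks $(x,t)\mapsto(\mathbf{u}_\theta(x,t),p_\theta(x,t))\in C^k((0,T)\times D)\cap C([0,T]\times\bar D)$, $k\ge1$, with tuning parameters $\theta\in\Theta\subset\mathbb{R}^M$, are compositions of affine maps and a smooth componentwise scalar activation function; they have the regularity required for the residuals below to be well defined. Residuals: $\mathcal{R}_{\mathbf{u},\theta}=(\mathbf{u}_\theta)_t+(\mathbf{u}_\theta\cdot\nabla)\mathbf{u}_\theta+\nabla p_\theta-\mathbf{f}$ and $\mathcal{R}_{div,\theta}=\operatorname{div}(\mathbf{u}_\theta)$ on $D\times(0,T)$; $\mathcal{R}_{sb,\theta}=\mathbf{u}_\theta\cdot\mathbf{n}$ on $\partial D\times(0,T]$; $\mathcal{R}_{tb,\theta}(x)=\mathbf{u}_\theta(x,0)-\bar{\mathbf{u}}(x)$ on $D$. For vector-valued residuals $\mathcal{R}^2$ means $|\mathcal{R}|^2$. Training points and positive quadrature weights: $N_{int}$ points $(x_n,t_n)\in D\times(0,T)$, weights $w_n^{int}$;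 $N_{sb}$ points $(x_n,t_n)$ with $x_n\in\partial D$, weights $w_n^{sb}$; $N_{tb}$ points $x_n\in D$, weights $w_n^{tb}$. Assumed quadrature bounds, with $\alpha_{tb},\alpha_{sb},\alpha_{int}>0$: $$\Big|\int_Dg\,dx-\sum_{n=1}^{N_{tb}}w_n^{tb}g(x_n)\Big|\le C_{quad}^{tb}(\|g\|_{C^k})N_{tb}^{-\alpha_{tb}},\quad g\in C^k(D),$$ $$\Big|\int_0^T\!\!\int_{\partial D}g\,ds(x)dt-\sum_{n=1}^{N_{sb}}w_n^{sb}g(x_n,t_n)\Big|\le C_{quad}^{sb}(\|g\|_{C^k})N_{sb}^{-\alpha_{sb}},\quad g\in C^k(\partial D\times[0,T]),$$ $$\Big|\int_0^T\!\!\int_Dg\,dx\,dt-\sum_{n=1}^{N_{int}}w_n^{int}g(x_n,t_n)\Big|\le C_{quad}^{int}(\|g\|_{C^{\ell}})N_{int}^{-\alpha_{int}},\quad g\in C^{\ell}(D\times[0,T]),$$ the last one being used with $\ell=k-1$. Training errors: $(\mathcal{E}_T^{tb})^2=\sum_{n=1}^{N_{tb}}w_n^{tb}|\mathcal{R}_{tb,\theta^{\ast}}(x_n)|^2$, $(\mathcal{E}_T^{sb})^2=\sum_{n=1}^{N_{sb}}w_n^{sb}|\mathcal{R}_{sb,\theta^{\ast}}(x_n,t_n)|^2$, $(\mathcal{E}_T^{\mathbf{u}})^2=\sum_{n=1}^{N_{int}}w_n^{int}|\mathcal{R}_{\mathbf{u},\theta^{\ast}}(x_n,t_n)|^2$,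 $(\mathcal{E}_T^{div})^2=\sum_{n=1}^{N_{int}}w_n^{int}|\mathcal{R}_{div,\theta^{\ast}}(x_n,t_n)|^2$. PINN algorithm: return $\theta^{\ast}\in\Theta$, an (approximate, local) minimizer of $J(\theta)+\lambda_{reg}J_{reg}(\theta)$, where $$J(\theta)=\sum_{n=1}^{N_{tb}}w_n^{tb}|\mathcal{R}_{tb,\theta}(x_n)|^2+\sum_{n=1}^{N_{sb}}w_n^{sb}|\mathcal{R}_{sb,\theta}(x_n,t_n)|^2+\lambda\sum_{n=1}^{N_{int}}w_n^{int}\big(|\mathcal{R}_{\mathbf{u},\theta}(x_n,t_n)|^2+|\mathcal{R}_{div,\theta}(x_n,t_n)|^2\big),$$ $\lambda$ is a hyperparameter balancing the residuals, $J_{reg}:\Theta\to\mathbb{R}$ a regularization term, $0\le\lambda_{reg}\ll1$. The PINN is $(\mathbf{u}^{\ast},p^{\ast})=(\mathbf{u}_{\theta^{\ast}},p_{\theta^{\ast}})$.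
   Formalization: In the second bracket the two square-root quadrature terms (for the divergence and boundary residuals) carry the extra factor C_0 T^{1/2}; without it the printed bound is false, e.g. for u=0 on the unit disc with a large gradient network velocity whose training errors all vanish. *)

theory Defs
  imports "HOL-Analysis.Analysis" "HOL-Probability.Essential_Supremum"
begin

section \<open>Functions of class \<open>C^k\<close>\<close>

text \<open>Iterated partial derivatives; the list consists of basis vectors, so a multi-index of order
  \<open>m\<close> is a list of length \<open>m\<close>.\<close>

primrec iter_partial ::
  "'a list \<Rightarrow> ('a::euclidean_space \<Rightarrow> 'b::real_normed_vector) \<Rightarrow> 'a \<Rightarrow> 'b" where
  "iter_partial [] g = g"
| "iter_partial (b # bs) g = (\<lambda>x. frechet_derivative (iter_partial bs g) (at x) b)"

definition multi_indices :: "nat \<Rightarrow> 'a::euclidean_space list set" where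
  "multi_indices k = {bs. set bs \<subseteq> Basis \<and> length bs \<le> k}"

text \<open>\<open>g \<in> C^k(U)\<close> for an open set \<open>U\<close>.\<close>

definition Ck_on :: "nat \<Rightarrow> ('a::euclidean_space \<Rightarrow> 'b::real_normed_vector) \<Rightarrow> 'a set \<Rightarrow> bool" where
  "Ck_on k g U \<longleftrightarrow> (\<forall>bs\<in>multi_indices k.
     continuous_on U (iter_partial bs g) \<and>
     (length bs < k \<longrightarrow> (\<forall>x\<in>U. iter_partial bs g differentiable (at x))))"

definition Ck_norm :: "nat \<Rightarrow> ('a::euclidean_space \<Rightarrow> 'b::real_normed_vector) \<Rightarrow> 'a set \<Rightarrow> real" where
  "Ck_norm k g U = Sup {norm (iter_partial bs g x) |bs x. bs \<in> multi_indices k \<and> x \<in> U}"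

text \<open>\<open>g \<in> C^k(S)\<close> with finite norm, where the open set \<open>U\<close> is the interior of \<open>S\<close>: the derivatives,
  taken in \<open>U\<close>, are bounded and extend continuously to \<open>S\<close>.  It is used with
  \<open>U = S = D\<close>, and with \<open>U = D \<times> (0,T)\<close>, \<open>S = D \<times> [0,T]\<close>.\<close>

definition Ck_upto ::
  "nat \<Rightarrow> ('a::euclidean_space \<Rightarrow> 'b::real_normed_vector) \<Rightarrow> 'a set \<Rightarrow> 'a set \<Rightarrow> bool" where
  "Ck_upto k g U S \<longleftrightarrow> Ck_on k g U \<and>
     (\<forall>bs\<in>multi_indices k. bounded (iter_partial bs g ` U) \<and>
        (\<exists>h. continuous_on S h \<and> (\<forall>x\<in>U. h x = iter_partial bs g x)))"

text \<open>\<open>C^k(K)\<close> for a compact set \<open>K\<close> without interior (here \<open>\<partial>D \<times> [0,T]\<close>): restrictions of \<open>C^k\<close>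
  functions on the whole space, with the quotient norm.  This makes sense for every \<open>k\<close>, although
  the manifold \<open>\<partial>D\<close> itself is only of class \<open>C^1\<close>.\<close>

definition Ck_restr :: "nat \<Rightarrow> ('a::euclidean_space \<Rightarrow> 'b::real_normed_vector) \<Rightarrow> 'a set \<Rightarrow> bool" where
  "Ck_restr k g K \<longleftrightarrow> (\<exists>G. Ck_upto k G UNIV UNIV \<and> (\<forall>z\<in>K. G z = g z))"

definition Ck_restr_norm ::
  "nat \<Rightarrow> ('a::euclidean_space \<Rightarrow> 'b::real_normed_vector) \<Rightarrow> 'a set \<Rightarrow> real" where
  "Ck_restr_norm k g K = Inf {Ck_norm k G UNIV |G. Ck_upto k G UNIV UNIV \<and> (\<forall>z\<in>K. G z = g z)}"

definition sup_norm :: "'a set \<Rightarrow> ('a \<Rightarrow> 'b::real_normed_vector) \<Rightarrow> real" where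
  "sup_norm S g = (SUP z\<in>S. norm (g z))"

definition Linf_norm :: "'a::euclidean_space set \<Rightarrow> ('a \<Rightarrow> 'b::real_normed_vector) \<Rightarrow> ereal" where
  "Linf_norm S g = esssup (restrict_space lborel S) (\<lambda>z. ereal (norm (g z)))"


section \<open>Differential operators on space-time fields\<close>

text \<open>A space-time point is a pair \<open>(x, t)\<close>.\<close>

definition grad :: "(real^'d \<Rightarrow> real) \<Rightarrow> real^'d \<Rightarrow> real^'d" where
  "grad g x = (\<chi> i. frechet_derivative g (at x) (axis i 1))"

definition time_deriv :: "((real^'d) \<times> real \<Rightarrow> real^'d) \<Rightarrow> (real^'d) \<times> real \<Rightarrow> real^'d" where
  "time_deriv u z = vector_derivative (\<lambda>s. u (fst z, s)) (at (snd z))"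

definition space_jacobian :: "((real^'d) \<times> real \<Rightarrow> real^'d) \<Rightarrow> (real^'d) \<times> real \<Rightarrow> real^'d^'d" where
  "space_jacobian u z = jacobian (\<lambda>y. u (y, snd z)) (at (fst z))"

text \<open>\<open>(u \<cdot> \<nabla>) u\<close> has the \<open>i\<close>-th component \<open>\<Sum>j. u_j \<partial>_j u_i\<close>.\<close>

definition convection :: "((real^'d) \<times> real \<Rightarrow> real^'d) \<Rightarrow> (real^'d) \<times> real \<Rightarrow> real^'d" where
  "convection u z = space_jacobian u z *v u z"

definition space_grad :: "((real^'d) \<times> real \<Rightarrow> real) \<Rightarrow> (real^'d) \<times> real \<Rightarrow> real^'d" where
  "space_grad p z = grad (\<lambda>y. p (y, snd z)) (fst z)"

definition space_div :: "((real^'d) \<times> real \<Rightarrow> real^'d) \<Rightarrow> (real^'d) \<times> real \<Rightarrow> real" where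
  "space_div u z = (\<Sum>i\<in>UNIV. space_jacobian u z $ i $ i)"


section \<open>Domains with \<open>C^1\<close> boundary, outward normal, surface measure\<close>

text \<open>Near \<open>x0\<close> the set \<open>D\<close> lies strictly on the \<open>e\<close>-side of the graph of a \<open>C^1\<close> function \<open>\<gamma>\<close> of the
  coordinates other than the one along \<open>e\<close>, where \<open>e\<close> is a coordinate direction up to sign.  Instead
  of a function of \<open>d - 1\<close> variables, \<open>\<gamma>\<close> is a function on the whole space that does not
  depend on the coordinate along \<open>e\<close>.\<close>

definition graph_chart ::
  "(real^'d) set \<Rightarrow> real^'d \<Rightarrow> real \<Rightarrow> real^'d \<Rightarrow> (real^'d \<Rightarrow> real) \<Rightarrow> bool" where
  "graph_chart D x0 r e \<gamma> \<longleftrightarrow>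
     0 < r \<and> (e \<in> Basis \<or> - e \<in> Basis) \<and> Ck_on 1 \<gamma> UNIV \<and>
     (\<forall>x s. \<gamma> (x + s *\<^sub>R e) = \<gamma> x) \<and>
     D \<inter> ball x0 r = {x \<in> ball x0 r. \<gamma> x < x \<bullet> e}"

definition C1_boundary :: "(real^'d) set \<Rightarrow> bool" where
  "C1_boundary D \<longleftrightarrow> (\<forall>x0\<in>frontier D. \<exists>r e \<gamma>. graph_chart D x0 r e \<gamma>)"

text \<open>The unit vector orthogonal to the tangent plane of \<open>\<partial>D\<close> at \<open>x\<close> that points out of \<open>D\<close>.\<close>

definition is_outward_normal :: "(real^'d) set \<Rightarrow> real^'d \<Rightarrow> real^'d \<Rightarrow> bool" where
  "is_outward_normal D x \<nu> \<longleftrightarrow>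
     norm \<nu> = 1 \<and>
     ((\<lambda>y. ((y - x) \<bullet> \<nu>) / norm (y - x)) \<longlongrightarrow> 0) (at x within frontier D) \<and>
     (\<forall>\<^sub>F s in at_right 0. x - s *\<^sub>R \<nu> \<in> D \<and> x + s *\<^sub>R \<nu> \<notin> D)"

definition outward_normal :: "(real^'d) set \<Rightarrow> real^'d \<Rightarrow> real^'d" where
  "outward_normal D x = (THE \<nu>. is_outward_normal D x \<nu>)"

text \<open>The surface measure \<open>ds\<close> on \<open>\<partial>D\<close> is the measure given in every local graph representation by
  \<open>ds = sqrt (1 + |\<nabla>\<gamma>|^2) dx'\<close>.  The \<open>(d-1)\<close>-dimensional integral over \<open>x'\<close> is
  written as a \<open>d\<close>-dimensional one over the cylinder \<open>0 < y \<bullet> e < 1\<close> of height 1, on which the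
  integrand does not depend on the coordinate along \<open>e\<close>; the point of the graph above or below
  \<open>y\<close> is \<open>y + (\<gamma> y - y \<bullet> e) e\<close>.  These conditions determine \<open>\<sigma>\<close> uniquely on \<open>\<partial>D\<close> when \<open>\<partial>D\<close> is of
  class \<open>C^1\<close>; outside \<open>\<partial>D\<close> the measure \<open>\<sigma>\<close> is never used.\<close>

definition is_surface_measure :: "(real^'d) set \<Rightarrow> (real^'d) measure \<Rightarrow> bool" where
  "is_surface_measure D \<sigma> \<longleftrightarrow> sets \<sigma> = sets borel \<and>
     (\<forall>x0 r e \<gamma>. graph_chart D x0 r e \<gamma> \<longrightarrow>
        (\<forall>A\<in>sets borel. A \<subseteq> frontier D \<inter> ball x0 r \<longrightarrow>
           emeasure \<sigma> A =
             (\<integral>\<^sup>+ y. indicator {y. 0 < y \<bullet> e \<and> y \<bullet> e < 1 \<and> y + (\<gamma> y - y \<bullet> e) *\<^sub>R e \<in> A} y *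
                    ennreal (sqrt (1 + (norm (grad \<gamma> y))\<^sup>2)) \<partial>lborel)))"


section \<open>The incompressible Euler equations\<close>

text \<open>No regularity of \<open>p\<close> in time beyond continuity is asked for; the continuity of \<open>\<nabla>p\<close> in
  \<open>D \<times> (0,T)\<close> follows from the momentum equation.\<close>

definition classical_euler_solution ::
  "(real^'d) set \<Rightarrow> real \<Rightarrow> ((real^'d) \<times> real \<Rightarrow> real^'d) \<Rightarrow> (real^'d \<Rightarrow> real^'d) \<Rightarrow>
   ((real^'d) \<times> real \<Rightarrow> real^'d) \<Rightarrow> ((real^'d) \<times> real \<Rightarrow> real) \<Rightarrow> bool" where
  "classical_euler_solution D T f ubar u p \<longleftrightarrow>
     Ck_on 1 u (D \<times> {0<..<T}) \<and> continuous_on (closure D \<times> {0..T}) u \<and>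
     (\<forall>x\<in>D. \<forall>t\<in>{0<..<T}. (\<lambda>y. p (y, t)) differentiable (at x)) \<and>
     continuous_on (closure D \<times> {0..T}) p \<and>
     (\<forall>z\<in>D \<times> {0<..<T}. time_deriv u z + convection u z + space_grad p z = f z) \<and>
     (\<forall>z\<in>D \<times> {0<..<T}. space_div u z = 0) \<and>
     (\<forall>x\<in>frontier D. \<forall>t\<in>{0<..<T}. u (x, t) \<bullet> outward_normal D x = 0) \<and>
     (\<forall>x\<in>D. u (x, 0) = ubar x)"


section \<open>Residuals\<close>

definition res_u ::
  "((real^'d) \<times> real \<Rightarrow> real^'d) \<Rightarrow> ((real^'d) \<times> real \<Rightarrow> real^'d) \<Rightarrow> ((real^'d) \<times> real \<Rightarrow> real) \<Rightarrow>
   (real^'d) \<times> real \<Rightarrow> real^'d" where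
  "res_u f u p z = time_deriv u z + convection u z + space_grad p z - f z"

definition res_div :: "((real^'d) \<times> real \<Rightarrow> real^'d) \<Rightarrow> (real^'d) \<times> real \<Rightarrow> real" where
  "res_div u z = space_div u z"

definition res_sb :: "(real^'d) set \<Rightarrow> ((real^'d) \<times> real \<Rightarrow> real^'d) \<Rightarrow> (real^'d) \<times> real \<Rightarrow> real" where
  "res_sb D u z = u z \<bullet> outward_normal D (fst z)"

definition res_tb :: "(real^'d \<Rightarrow> real^'d) \<Rightarrow> ((real^'d) \<times> real \<Rightarrow> real^'d) \<Rightarrow> real^'d \<Rightarrow> real^'d" where
  "res_tb ubar u x = u (x, 0) - ubar x"

definition sq :: "('a \<Rightarrow> 'b::real_normed_vector) \<Rightarrow> 'a \<Rightarrow> real" where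
  "sq R z = (norm (R z))\<^sup>2"


section \<open>Neural networks\<close>

text \<open>Networks of varying widths are maps between real lists.  A layer from \<open>m\<close> to \<open>n\<close> neurons
  uses \<open>n * (m + 1)\<close> consecutive parameters: for each output neuron its \<open>m\<close> weights, then its bias.\<close>

definition affine_layer :: "nat \<Rightarrow> nat \<Rightarrow> real list \<Rightarrow> real list \<Rightarrow> real list" where
  "affine_layer m n \<theta> x =
     map (\<lambda>i. (\<Sum>j<m. \<theta> ! (i * (m + 1) + j) * x ! j) + \<theta> ! (i * (m + 1) + m)) [0..<n]"

text \<open>\<open>mlp \<rho> [n0, \<dots>, nK] \<theta>\<close> is \<open>A_K \<circ> \<rho> \<circ> A_(K-1) \<circ> \<dots> \<circ> \<rho> \<circ> A_1\<close> with affine \<open>A_k\<close> from \<open>n(k-1)\<close>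
  to \<open>nk\<close> neurons; there is no activation after the last affine map.\<close>

fun mlp :: "(real \<Rightarrow> real) \<Rightarrow> nat list \<Rightarrow> real list \<Rightarrow> real list \<Rightarrow> real list" where
  "mlp \<rho> (m # n # ns) \<theta> x =
     (if ns = [] then affine_layer m n \<theta> x
      else mlp \<rho> (n # ns) (drop (n * (m + 1)) \<theta>) (map \<rho> (affine_layer m n \<theta> x)))"
| "mlp \<rho> _ \<theta> x = x"

fun mlp_size :: "nat list \<Rightarrow> nat" where
  "mlp_size (m # n # ns) = n * (m + 1) + mlp_size (n # ns)"
| "mlp_size _ = 0"

text \<open>The \<open>d\<close> coordinates of \<open>x\<close>, in a fixed enumeration of the index type, followed by \<open>t\<close>.
  Correspondingly the first \<open>d\<close> outputs form the velocity and the last one is the pressure.\<close>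

definition nn_input :: "(real^'d) \<times> real \<Rightarrow> real list" where
  "nn_input z = map (\<lambda>i. fst z $ from_nat_into (UNIV :: 'd set) i) [0..<CARD('d)] @ [snd z]"

definition nn_velocity ::
  "(real \<Rightarrow> real) \<Rightarrow> nat list \<Rightarrow> real list \<Rightarrow> (real^'d) \<times> real \<Rightarrow> real^'d" where
  "nn_velocity \<rho> ws \<theta> z = (\<chi> i. mlp \<rho> ws \<theta> (nn_input z) ! to_nat_on (UNIV :: 'd set) i)"

definition nn_pressure ::
  "(real \<Rightarrow> real) \<Rightarrow> nat list \<Rightarrow> real list \<Rightarrow> (real^'d) \<times> real \<Rightarrow> real" where
  "nn_pressure \<rho> ws \<theta> z = mlp \<rho> ws \<theta> (nn_input z) ! CARD('d)"

definition smooth_activation :: "(real \<Rightarrow> real) \<Rightarrow> bool" where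
  "smooth_activation \<rho> \<longleftrightarrow> (\<forall>n x. (deriv ^^ n) \<rho> differentiable (at x))"

text \<open>The parameter space \<open>\<Theta> \<subseteq> \<real>^M\<close> consists of lists of length \<open>M = mlp_size ws\<close>.\<close>

definition nn_family ::
  "(real^'d) set \<Rightarrow> real \<Rightarrow> nat \<Rightarrow> (real \<Rightarrow> real) \<Rightarrow> nat list \<Rightarrow> real list set \<Rightarrow> bool" where
  "nn_family D T k \<rho> ws \<Theta> \<longleftrightarrow>
     smooth_activation \<rho> \<and>
     2 \<le> length ws \<and> hd ws = CARD('d) + 1 \<and> last ws = CARD('d) + 1 \<and>
     (\<forall>\<theta>\<in>\<Theta>. length \<theta> = mlp_size ws \<and>
        Ck_on k (nn_velocity \<rho> ws \<theta> :: (real^'d) \<times> real \<Rightarrow> real^'d) (D \<times> {0<..<T}) \<and>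
        continuous_on (closure D \<times> {0..T}) (nn_velocity \<rho> ws \<theta> :: (real^'d) \<times> real \<Rightarrow> real^'d) \<and>
        Ck_on k (nn_pressure \<rho> ws \<theta> :: (real^'d) \<times> real \<Rightarrow> real) (D \<times> {0<..<T}) \<and>
        continuous_on (closure D \<times> {0..T}) (nn_pressure \<rho> ws \<theta> :: (real^'d) \<times> real \<Rightarrow> real))"


section \<open>Quadrature, loss function, training\<close>

text \<open>\<open>cls\<close> is the class of admissible integrands \<open>g\<close>, \<open>nrm\<close> their norm, \<open>I\<close> the exact integral.\<close>

definition quadrature_bound ::
  "(('a \<Rightarrow> real) \<Rightarrow> bool) \<Rightarrow> (('a \<Rightarrow> real) \<Rightarrow> real) \<Rightarrow> (('a \<Rightarrow> real) \<Rightarrow> real) \<Rightarrow>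
   nat \<Rightarrow> (nat \<Rightarrow> 'a) \<Rightarrow> (nat \<Rightarrow> real) \<Rightarrow> (real \<Rightarrow> real) \<Rightarrow> real \<Rightarrow> bool" where
  "quadrature_bound cls nrm I N z w C \<alpha> \<longleftrightarrow>
     (\<forall>g. cls g \<longrightarrow> \<bar>I g - (\<Sum>n<N. w n * g (z n))\<bar> \<le> C (nrm g) * real N powr (- \<alpha>))"

definition integral_tb :: "(real^'d) set \<Rightarrow> (real^'d \<Rightarrow> real) \<Rightarrow> real" where
  "integral_tb D g = (LINT x:D|lborel. g x)"

definition integral_sb ::
  "(real^'d) set \<Rightarrow> (real^'d) measure \<Rightarrow> real \<Rightarrow> ((real^'d) \<times> real \<Rightarrow> real) \<Rightarrow> real" where
  "integral_sb D \<sigma> T g = (LINT t:{0<..<T}|lborel. (LINT x:frontier D|\<sigma>. g (x, t)))"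

definition integral_int :: "(real^'d) set \<Rightarrow> real \<Rightarrow> ((real^'d) \<times> real \<Rightarrow> real) \<Rightarrow> real" where
  "integral_int D T g = (LINT t:{0<..<T}|lborel. (LINT x:D|lborel. g (x, t)))"

definition training_error ::
  "nat \<Rightarrow> (nat \<Rightarrow> 'a) \<Rightarrow> (nat \<Rightarrow> real) \<Rightarrow> ('a \<Rightarrow> 'b::real_normed_vector) \<Rightarrow> real" where
  "training_error N z w R = sqrt (\<Sum>n<N. w n * (norm (R (z n)))\<^sup>2)"

definition generalization_error ::
  "(real^'d) set \<Rightarrow> real \<Rightarrow> ((real^'d) \<times> real \<Rightarrow> real^'d) \<Rightarrow> ((real^'d) \<times> real \<Rightarrow> real^'d) \<Rightarrow> real" where
  "generalization_error D T u v = sqrt (integral_int D T (\<lambda>z. (norm (u z - v z))\<^sup>2))"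

definition pinn_loss ::
  "(real^'d) set \<Rightarrow> ((real^'d) \<times> real \<Rightarrow> real^'d) \<Rightarrow> (real^'d \<Rightarrow> real^'d) \<Rightarrow>
   nat \<Rightarrow> (nat \<Rightarrow> real^'d) \<Rightarrow> (nat \<Rightarrow> real) \<Rightarrow>
   nat \<Rightarrow> (nat \<Rightarrow> (real^'d) \<times> real) \<Rightarrow> (nat \<Rightarrow> real) \<Rightarrow>
   nat \<Rightarrow> (nat \<Rightarrow> (real^'d) \<times> real) \<Rightarrow> (nat \<Rightarrow> real) \<Rightarrow> real \<Rightarrow>
   ((real^'d) \<times> real \<Rightarrow> real^'d) \<Rightarrow> ((real^'d) \<times> real \<Rightarrow> real) \<Rightarrow> real" where
  "pinn_loss D f ubar Ntb xtb wtb Nsb zsb wsb Nint zint wint lam u p =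
     (\<Sum>n<Ntb. wtb n * (norm (res_tb ubar u (xtb n)))\<^sup>2) +
     (\<Sum>n<Nsb. wsb n * (norm (res_sb D u (zsb n)))\<^sup>2) +
     lam * (\<Sum>n<Nint. wint n * ((norm (res_u f u p (zint n)))\<^sup>2 + (norm (res_div u (zint n)))\<^sup>2))"

text \<open>\<open>\<theta>s\<close> minimizes \<open>L\<close> up to the tolerance \<open>\<epsilon>\<close> among the parameters in \<open>\<Theta>\<close> at distance less
  than \<open>\<delta>\<close>.\<close>

definition approx_local_minimizer ::
  "real list set \<Rightarrow> (real list \<Rightarrow> real) \<Rightarrow> real \<Rightarrow> real \<Rightarrow> real list \<Rightarrow> bool" where
  "approx_local_minimizer \<Theta> L \<epsilon> \<delta> \<theta>s \<longleftrightarrow> \<theta>s \<in> \<Theta> \<and>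
     (\<forall>\<theta>\<in>\<Theta>. L2_set (\<lambda>i. \<theta> ! i - \<theta>s ! i) {..<length \<theta>s} < \<delta> \<longrightarrow> L \<theta>s \<le> L \<theta> + \<epsilon>)"

end

theory Submission
  imports Defs
begin

text \<open>The difference \<open>w = v - u\<close> of the network velocity \<open>v\<close> and the solution \<open>u\<close> satisfies a local energy
  balance \<open>\<partial>\<^sub>t (|w|\<^sup>2 / 2) + div ((|w|\<^sup>2 / 2) v + \<pi> w) = \<Gamma>\<close>, where \<open>\<pi>\<close> is the pressure difference and \<open>\<Gamma>\<close>
  consists of the residuals and of \<open>- w \<bullet> (\<nabla>u) w\<close>.  Neither \<open>\<partial>\<^sub>t w\<close> nor \<open>\<nabla>\<pi>\<close> need be integrable up to the
  boundary, but \<open>\<Gamma>\<close> is bounded and the flux is continuous on the closed cylinder.  So the balance is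
  integrated over a compact time interval and tested with compactly supported functions; this exhibits the
  time-averaged flux as a continuous field with an integrable weak divergence, for which the divergence
  theorem holds on \<open>C\<^sup>1\<close> domains: in a chart one tests with functions that are cut off at height \<open>\<delta>\<close> above
  the graph, and lets \<open>\<delta>\<close> tend to \<open>0\<close>.  The boundary flux contains only the normal component of \<open>v\<close>, because
  \<open>u\<close> is tangential.  The Cauchy--Schwarz inequality turns the \<open>L\<^sup>1\<close> norms of the divergence and boundary
  residuals into \<open>L\<^sup>2\<close> norms, Gronwall's inequality closes the estimate, and the quadrature bounds replace the
  integrals of the squared residuals by training errors.\<close>

subsection \<open>Integrals of functions with bounded support\<close>

text \<open>Averaging in time is forced by the regularity: the solution is C^1 only inside the open
  cylinder, so at a fixed time the divergence \<open>\<Gamma> - Et\<close> of the flux may fail to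
  be integrable near the boundary. The time integral replaces \<open>Et\<close> by an increment of
  the energy density \<open>E\<close>, which is continuous up to the boundary, while
  \<open>\<Gamma>\<close> is bounded because \<nabla>u and the squared residuals are. At the initial
  time derivatives are missing as well; there one starts at s > 0 and lets s tend to 0. The flux is
  carried by v, not by u: then \<nabla>u is the only gradient paired with w twice, and Gronwall's
  rate is 1 + 2 L with L a bound of \<nabla>u alone. The constant C_0 is twice a sup bound of |E| +
  |\<pi>| times the sum of the square roots of the volume of D and of the area of its boundary; the
  roots come from Cauchy--Schwarz. The divergence and boundary residuals enter through L^1 norms, so
  their quadrature errors appear under a square root and carry the same factor C_0 T^(1/2) as the
  training errors.\<close>

lemma integrable_bounded_support:
  fixes f :: "'a::euclidean_space \<Rightarrow> 'b::{banach,second_countable_topology}"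
  assumes f: "f \<in> borel_measurable borel" and S: "bounded S"
    and supp: "\<And>x. x \<notin> S \<Longrightarrow> f x = 0" and B: "\<And>x. norm (f x) \<le> B"
  shows "integrable lborel f"
proof -
  obtain a where a: "S \<subseteq> cbox (-a) a"
    using bounded_subset_cbox_symmetric[OF S] by blast
  have "integrable lborel (\<lambda>x. indicator (cbox (-a) a) x *\<^sub>R B)"
    by (rule integrable_real_indicator[THEN integrable_scaleR_left]) (auto simp: emeasure_lborel_cbox_eq)
  then show ?thesis
  proof (rule Bochner_Integration.integrable_bound)
    show "f \<in> borel_measurable lborel" using f by simp
    show "AE x in lborel. norm (f x) \<le> norm (indicator (cbox (-a) a) x *\<^sub>R B)"
    proof (rule AE_I2)
      fix x show "norm (f x) \<le> norm (indicator (cbox (-a) a) x *\<^sub>R B)"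
        using a supp[of x] B[of x] by (cases "x \<in> cbox (-a) a") (auto simp: subset_iff)
    qed
  qed
qed

lemma integrable_indicator_bounded:
  fixes S :: "'a::euclidean_space set"
  assumes "S \<in> sets borel" "bounded S"
  shows "integrable lborel (indicator S :: 'a \<Rightarrow> real)"
  using assms by (intro integrable_real_indicator[OF _ emeasure_bounded_finite]) simp

lemma lborel_integral_translate:
  fixes f :: "'a::euclidean_space \<Rightarrow> 'b::{banach,second_countable_topology}"
  assumes "f \<in> borel_measurable borel"
  shows "(\<integral>x. f (x + c) \<partial>lborel) = (\<integral>x. f x \<partial>lborel)"
proof -
  have "(\<integral>x. f x \<partial>lborel) = (\<integral>x. f x \<partial>(distr lborel borel ((+) c)))"
    by (simp add: lborel_distr_plus)
  also have "\<dots> = (\<integral>x. f (c + x) \<partial>lborel)"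
    using assms by (subst integral_distr) auto
  finally show ?thesis by (simp add: add.commute)
qed

lemma compact_continuous_bound:
  fixes f :: "'a::topological_space \<Rightarrow> 'b::real_normed_vector"
  assumes "compact S" "continuous_on S f"
  obtains B where "0 \<le> B" "\<And>x. x \<in> S \<Longrightarrow> norm (f x) \<le> B"
proof -
  have "compact (f ` S)" using assms by (intro compact_continuous_image)
  then obtain B where "\<And>x. x \<in> S \<Longrightarrow> norm (f x) \<le> B"
    by (metis bounded_iff compact_imp_bounded image_eqI)
  then show ?thesis using that[of "max 0 B"] by (simp add: le_max_iff_disj)
qed

lemma continuous_compact_support_bounded:
  fixes f :: "'a::euclidean_space \<Rightarrow> 'b::real_normed_vector"
  assumes "continuous_on UNIV f" "bounded S" "\<And>x. x \<notin> S \<Longrightarrow> f x = 0"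
  obtains B where "0 \<le> B" "\<And>x. norm (f x) \<le> B"
proof -
  have "compact (closure S)" "continuous_on (closure S) f"
    using assms by (auto intro: continuous_on_subset)
  then obtain B where B: "0 \<le> B" "\<And>x. x \<in> closure S \<Longrightarrow> norm (f x) \<le> B"
    by (rule compact_continuous_bound) blast
  have "norm (f x) \<le> B" for x
    using B(1) B(2)[of x] assms(3)[of x] closure_subset[of S] by (cases "x \<in> S") auto
  with B(1) show ?thesis by (rule that)
qed

text \<open>By translation invariance the difference quotients of \<open>g\<close> along
  \<open>b\<close> integrate to zero. The mean value theorem bounds them by \<open>M\<close>, and
  dominated convergence passes to the limit.\<close>

lemma integral_directional_derivative_eq_0:
  fixes g :: "'a::euclidean_space \<Rightarrow> real"
  assumes der: "\<And>x. (g has_derivative g' x) (at x)"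
    and cont: "continuous_on UNIV (\<lambda>x. g' x b)"
    and K: "compact K" and supp: "\<And>x. x \<notin> K \<Longrightarrow> g x = 0"
  shows "(\<integral>x. g' x b \<partial>lborel) = 0"
proof -
  have contg: "continuous_on UNIV g"
    using der has_derivative_continuous by (fastforce simp: continuous_on_eq_continuous_within)
  have g'0: "g' x = (\<lambda>_. 0)" if "x \<notin> K" for x
  proof -
    have "((\<lambda>_. 0) has_derivative (\<lambda>_. 0)) (at x)" by simp
    then have "(g has_derivative (\<lambda>_. 0)) (at x)"
      by (rule has_derivative_transform_within_open[where s="-K"])
         (use that supp K compact_imp_closed in auto)
    with der[of x] show ?thesis by (rule has_derivative_unique)
  qed
  obtain M where M: "0 \<le> M" "\<And>x. norm (g' x b) \<le> M"
    using continuous_compact_support_bounded[OF cont compact_imp_bounded[OF K]] g'0 by metis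
  obtain N where N: "0 \<le> N" "\<And>x. norm (g x) \<le> N"
    using continuous_compact_support_bounded[OF contg compact_imp_bounded[OF K]] supp by metis
  obtain R where R: "\<And>x. x \<in> K \<Longrightarrow> norm x \<le> R"
    using K compact_imp_bounded bounded_iff by metis
  define h where "h n = inverse (real (Suc n))" for n
  have h: "0 < h n" "h n \<le> 1" for n by (auto simp: h_def field_simps)
  define q where "q n x = (g (x + h n *\<^sub>R b) - g x) / h n" for n x
  have line: "((\<lambda>s. g (x + s *\<^sub>R b)) has_real_derivative g' (x + s *\<^sub>R b) b) (at s)" for x s
  proof -
    have "((\<lambda>s. g (x + s *\<^sub>R b)) has_derivative (\<lambda>k. g' (x + s *\<^sub>R b) (k *\<^sub>R b))) (at s)"
      by (rule has_derivative_compose[OF _ der]) (auto intro!: derivative_eq_intros)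
    moreover have "g' (x + s *\<^sub>R b) (k *\<^sub>R b) = k * g' (x + s *\<^sub>R b) b" for k
      using linear_scale[OF has_derivative_linear[OF der]] by simp
    ultimately show ?thesis by (simp add: has_field_derivative_def mult.commute[of _ "g' _ b"])
  qed
  have qM: "norm (q n x) \<le> M" for n x
  proof -
    have "\<exists>s>0. s < h n \<and> g (x + h n *\<^sub>R b) - g (x + 0 *\<^sub>R b) = (h n - 0) * g' (x + s *\<^sub>R b) b"
      by (rule MVT2[OF h(1) line])
    then obtain s where "g (x + h n *\<^sub>R b) - g x = h n * g' (x + s *\<^sub>R b) b" by auto
    then show ?thesis using M(2)[of "x + s *\<^sub>R b"] h(1)[of n] by (simp add: q_def)
  qed
  \<comment> \<open>Steps of length at most 1 keep the supports of all quotients in one ball, which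
    carries the dominating function.\<close>
  have q0: "q n x = 0" if "norm x > R + norm b" for n x
  proof -
    have "x \<notin> K" using R[of x] that norm_ge_zero[of b] by linarith
    moreover have "norm x \<le> norm (x + h n *\<^sub>R b) + norm (h n *\<^sub>R b)"
      by (metis add_diff_cancel_right' norm_triangle_ineq4)
    then have "norm x \<le> norm (x + h n *\<^sub>R b) + norm b"
      using h[of n] mult_left_le_one_le[of "norm b" "h n"] by simp
    then have "x + h n *\<^sub>R b \<notin> K" using R that by force
    ultimately show ?thesis by (simp add: q_def supp)
  qed
  have lim: "(\<lambda>n. q n x) \<longlonglongrightarrow> g' x b" for x
  proof -
    have "((\<lambda>s. (g (x + (0 + s) *\<^sub>R b) - g (x + 0 *\<^sub>R b)) / s) \<longlongrightarrow> g' (x + 0 *\<^sub>R b) b) (at 0)"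
      using line[of x 0] unfolding DERIV_def by simp
    moreover have "filterlim h (at 0) sequentially"
      unfolding h_def filterlim_at using LIMSEQ_inverse_real_of_nat by (auto intro!: always_eventually)
    ultimately have "(\<lambda>n. (g (x + (0 + h n) *\<^sub>R b) - g (x + 0 *\<^sub>R b)) / h n) \<longlonglongrightarrow> g' (x + 0 *\<^sub>R b) b"
      by (rule filterlim_compose)
    then show ?thesis by (simp add: q_def)
  qed
  have gm: "g \<in> borel_measurable borel" using contg by (rule borel_measurable_continuous_onI)
  have ig: "integrable lborel g"
    by (rule integrable_bounded_support[OF gm compact_imp_bounded[OF K] supp N(2)])
  have ig': "integrable lborel (\<lambda>x. g (x + c))" for c
  proof (rule integrable_bounded_support[where S="(\<lambda>x. x - c) ` K" and B=N])
    show "(\<lambda>x. g (x + c)) \<in> borel_measurable borel" using gm by measurable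
    show "bounded ((\<lambda>x. x - c) ` K)"
      using bounded_translation_minus[OF compact_imp_bounded[OF K], of c] by simp
    show "g (x + c) = 0" if "x \<notin> (\<lambda>x. x - c) ` K" for x
      by (rule supp) (use that in \<open>force simp: image_iff\<close>)
  qed (use N in auto)
  have "(\<integral>x. q n x \<partial>lborel) = 0" for n
    unfolding q_def using ig ig' lborel_integral_translate[OF gm] by simp
  moreover have "(\<lambda>n. \<integral>x. q n x \<partial>lborel) \<longlonglongrightarrow> (\<integral>x. g' x b \<partial>lborel)"
  proof (rule integral_dominated_convergence[where s=q and f="\<lambda>x. g' x b" and M=lborel
        and w="\<lambda>x. indicator (cball 0 (R + norm b)) x * M"])
    show "(\<lambda>x. g' x b) \<in> borel_measurable lborel"
      unfolding measurable_lborel2 by (rule borel_measurable_continuous_onI[OF cont])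
    show "q n \<in> borel_measurable lborel" for n unfolding q_def using gm by measurable
    show "integrable lborel (\<lambda>x::'a. indicator (cball 0 (R + norm b)) x * M)"
      by (rule integrable_mult_left[OF integrable_indicator_bounded[OF borel_closed[OF closed_cball] bounded_cball]])
    show "AE x in lborel. (\<lambda>n. q n x) \<longlonglongrightarrow> g' x b" using lim by simp
    show "AE x in lborel. norm (q n x) \<le> indicator (cball 0 (R + norm b)) x * M" for n
    proof (rule AE_I2)
      fix x show "norm (q n x) \<le> indicator (cball 0 (R + norm b)) x * M"
        using qM[of n x] q0[of x n] by (cases "x \<in> cball 0 (R + norm b)") auto
    qed
  qed
  ultimately show ?thesis by (simp add: LIMSEQ_const_iff)
qed

subsection \<open>Slicing along a direction\<close>

text \<open>With x = \<open>y + s *\<^sub>R e\<close>, removing the component of x along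
  \<open>e\<close> costs at most |x|, and restoring that of \<open>y\<close> at most 1. Hence the
  part of the unit cylinder that lies over a bounded set is bounded.\<close>

lemma norm_le_shifted:
  fixes y e :: "'a::real_inner"
  assumes e: "norm e = 1" and y: "0 < y \<bullet> e" "y \<bullet> e < 1"
  shows "norm y \<le> 2 * norm (y + s *\<^sub>R e) + 1"
proof -
  let ?x = "y + s *\<^sub>R e"
  have "?x \<bullet> e = y \<bullet> e + s" using e by (simp add: inner_add_left dot_square_norm)
  then have "y = ?x - (?x \<bullet> e) *\<^sub>R e + (y \<bullet> e) *\<^sub>R e" by (simp add: algebra_simps)
  then have "norm y \<le> norm ?x + norm ((?x \<bullet> e) *\<^sub>R e) + norm ((y \<bullet> e) *\<^sub>R e)"
    by (metis norm_triangle_le norm_triangle_ineq4 add_mono_thms_linordered_semiring(3))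
  also have "\<dots> \<le> norm ?x + norm ?x + 1"
    using Cauchy_Schwarz_ineq2[of ?x e] y e by (intro add_mono) auto
  finally show ?thesis by simp
qed

text \<open>Fubini along \<open>e\<close> without a (d-1)-dimensional measure: the base is a
  cylinder of height 1. For a fixed point x = \<open>y + s *\<^sub>R e\<close> the admissible
  \<open>s\<close> form the interval from \<open>x \<bullet> e - 1\<close> to
  \<open>x \<bullet> e\<close>, of length 1, so every point is counted with weight one.\<close>

lemma integral_slices:
  fixes f :: "'a::euclidean_space \<Rightarrow> real" and e :: 'a
  assumes e: "norm e = 1" and f[measurable]: "f \<in> borel_measurable borel"
    and S: "bounded S" and supp: "\<And>x. x \<notin> S \<Longrightarrow> f x = 0" and B: "\<And>x. \<bar>f x\<bar> \<le> B"
  shows "(\<integral>x. f x \<partial>lborel) =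
    (\<integral>y. indicator {0<..<1} (y \<bullet> e) * (\<integral>s. f (y + s *\<^sub>R e) \<partial>lborel) \<partial>lborel)"
proof -
  obtain R where R: "\<And>x. x \<in> S \<Longrightarrow> norm x \<le> R" using S bounded_iff by metis
  have ee: "e \<bullet> e = 1" using e by (simp add: dot_square_norm)
  have B0: "0 \<le> B" using B[of 0] by linarith
  let ?F = "\<lambda>y s. indicator {0<..<1} (y \<bullet> e) * f (y + s *\<^sub>R e) :: real"
  \<comment> \<open>The integrand after translating \<open>y\<close> by
    \<open>s *\<^sub>R e\<close>. The integrals are interchanged once before and once after the
    translation, so both versions must be jointly integrable.\<close>
  let ?T = "\<lambda>x s. indicator {0<..<1} (x \<bullet> e - s) * f x :: real"
  have 1: "integrable (lborel \<Otimes>\<^sub>M lborel) (case_prod ?F)"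
    unfolding lborel_prod
  proof (rule integrable_bounded_support[where S="cball 0 (2 * R + 2) \<times> cball 0 (R + 1)" and B=B])
    show "(\<lambda>(y, s). ?F y s) \<in> borel_measurable borel"
      by (simp add: borel_prod[symmetric])
    show "norm (case z of (y, s) \<Rightarrow> ?F y s) \<le> B" for z
      using B B0 by (auto simp: indicator_def split: prod.split)
    show "(case z of (y, s) \<Rightarrow> ?F y s) = 0" if z: "z \<notin> cball 0 (2 * R + 2) \<times> cball 0 (R + 1)" for z
    proof (rule ccontr)
      assume *: "(case z of (y, s) \<Rightarrow> ?F y s) \<noteq> 0"
      obtain y s where ys: "z = (y, s)" by force
      have y: "0 < y \<bullet> e" "y \<bullet> e < 1" and "y + s *\<^sub>R e \<in> S"
        using * supp by (auto simp: ys indicator_def split: if_splits)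
      then have n: "norm (y + s *\<^sub>R e) \<le> R" by (simp add: R)
      have "\<bar>(y + s *\<^sub>R e) \<bullet> e\<bar> \<le> R"
        using Cauchy_Schwarz_ineq2[of "y + s *\<^sub>R e" e] n e by simp
      then have s: "\<bar>s\<bar> \<le> R + 1" using y by (simp add: inner_add_left ee)
      have "norm y \<le> 2 * R + 2" using n norm_le_shifted[OF e y, of s] by simp
      then show False using z s by (simp add: ys)
    qed
  qed (auto intro: bounded_Times)
  have 2: "integrable (lborel \<Otimes>\<^sub>M lborel) (case_prod ?T)"
    unfolding lborel_prod
  proof (rule integrable_bounded_support[where S="cball 0 R \<times> cball 0 (R + 1)" and B=B])
    show "(\<lambda>(y, s). ?T y s) \<in> borel_measurable borel"
      by (simp add: borel_prod[symmetric])
    show "norm (case z of (y, s) \<Rightarrow> ?T y s) \<le> B" for z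
      using B B0 by (auto simp: indicator_def split: prod.split)
    show "(case z of (y, s) \<Rightarrow> ?T y s) = 0" if z: "z \<notin> cball 0 R \<times> cball 0 (R + 1)" for z
    proof (rule ccontr)
      assume *: "(case z of (y, s) \<Rightarrow> ?T y s) \<noteq> 0"
      obtain y s where ys: "z = (y, s)" by force
      have y: "0 < y \<bullet> e - s" "y \<bullet> e - s < 1" and "y \<in> S"
        using * supp by (auto simp: ys indicator_def split: if_splits)
      then have n: "norm y \<le> R" by (simp add: R)
      have "\<bar>y \<bullet> e\<bar> \<le> R"
        using Cauchy_Schwarz_ineq2[of y e] n e by simp
      then have s: "\<bar>s\<bar> \<le> R + 1" using y by simp
      then show False using z n by (simp add: ys)
    qed
  qed (auto intro: bounded_Times)
  have "(\<integral>y. indicator {0<..<1} (y \<bullet> e) * (\<integral>s. f (y + s *\<^sub>R e) \<partial>lborel) \<partial>lborel)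
      = (\<integral>y. (\<integral>s. ?F y s \<partial>lborel) \<partial>lborel)"
    by simp
  also have "\<dots> = (\<integral>s. (\<integral>y. ?F y s \<partial>lborel) \<partial>lborel)"
    by (rule lborel_pair.Fubini_integral[OF 1, symmetric])
  also have "\<dots> = (\<integral>s. (\<integral>x. ?T x s \<partial>lborel) \<partial>lborel)"
  proof (rule Bochner_Integration.integral_cong[OF refl])
    fix s
    have "(\<integral>x. ?T x s \<partial>lborel) = (\<integral>y. ?T (y + s *\<^sub>R e) s \<partial>lborel)"
      by (rule lborel_integral_translate[symmetric]) measurable
    then show "(\<integral>y. ?F y s \<partial>lborel) = (\<integral>x. ?T x s \<partial>lborel)"
      by (simp add: inner_add_left ee)
  qed
  also have "\<dots> = (\<integral>x. (\<integral>s. ?T x s \<partial>lborel) \<partial>lborel)"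
    by (rule lborel_pair.Fubini_integral[OF 2])
  also have "\<dots> = (\<integral>x. f x \<partial>lborel)"
  proof (rule Bochner_Integration.integral_cong[OF refl])
    fix x
    have "(\<integral>s. ?T x s \<partial>lborel) = (\<integral>s. indicator {x \<bullet> e - 1 <..< x \<bullet> e} s * f x \<partial>lborel)"
      by (intro Bochner_Integration.integral_cong[OF refl]) (auto simp: indicator_def)
    also have "\<dots> = f x" by simp
    finally show "(\<integral>s. ?T x s \<partial>lborel) = f x" .
  qed
  finally show ?thesis by simp
qed

section \<open>A C^1 cutoff function on the real line\<close>

definition ramp_part :: "real \<Rightarrow> real" where "ramp_part s = (max 0 s)\<^sup>2"

lemma ramp_part_deriv: "(ramp_part has_real_derivative 2 * max 0 s) (at s)"
\<comment> \<open>Since \<open>ramp_part s\<close> is (s^2 + s |s|) / 2, only s |s| needs care at 0,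
  where its difference quotient is |h|.\<close>
proof -
  have abs: "((\<lambda>s. s * \<bar>s\<bar>) has_real_derivative 2 * \<bar>s\<bar>) (at s)"
  proof (cases "s = 0")
    case True
    have "(\<lambda>h. (h * \<bar>h\<bar>) / h) \<midarrow>0\<rightarrow> (0::real)"
    proof (rule Lim_transform_eventually)
      show "(\<lambda>h::real. \<bar>h\<bar>) \<midarrow>0\<rightarrow> 0" by (intro tendsto_eq_intros) auto
      show "\<forall>\<^sub>F h in at 0. \<bar>h\<bar> = h * \<bar>h\<bar> / (h::real)" by (auto simp: eventually_at_filter)
    qed
    then show ?thesis using True by (simp add: DERIV_def)
  next
    case False
    then consider "s > 0" | "s < 0" by linarith
    then show ?thesis
    proof cases
      case 1
      have "((\<lambda>s. s * s) has_real_derivative 2 * \<bar>s\<bar>) (at s)"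
        using 1 by (auto intro!: derivative_eq_intros)
      then show ?thesis
        by (rule has_field_derivative_transform_within_open[where S="{0<..}"]) (use 1 in auto)
    next
      case 2
      have "((\<lambda>s. - (s * s)) has_real_derivative 2 * \<bar>s\<bar>) (at s)"
        using 2 by (auto intro!: derivative_eq_intros)
      then show ?thesis
        by (rule has_field_derivative_transform_within_open[where S="{..<0}"]) (use 2 in auto)
    qed
  qed
  have "ramp_part = (\<lambda>s. (s\<^sup>2 + s * \<bar>s\<bar>) / 2)"
    by (auto simp: ramp_part_def max_def power2_eq_square abs_if)
  moreover have "((\<lambda>s. (s\<^sup>2 + s * \<bar>s\<bar>) / 2) has_real_derivative 2 * max 0 s) (at s)"
    by (rule DERIV_cong[OF DERIV_cdivide[OF DERIV_add[OF DERIV_power[OF DERIV_ident] abs]]]) (auto simp: max_def)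
  ultimately show ?thesis by simp
qed

text \<open>The rise takes place between 1 and 2 instead of starting at 0, so that
  \<open>ramp (k * height x)\<close> already vanishes for \<open>height x \<le> 1 / k\<close> and
  cuts test functions off away from the boundary. The squares in \<open>ramp_part\<close> make it
  C^1, as a test function must be.\<close>

definition ramp :: "real \<Rightarrow> real" where
  "ramp s = ramp_part (s - 1) / (ramp_part (s - 1) + ramp_part (2 - s))"

definition ramp' :: "real \<Rightarrow> real" where
  "ramp' s = (2 * max 0 (s - 1) * ramp_part (2 - s) + ramp_part (s - 1) * (2 * max 0 (2 - s))) /
    (ramp_part (s - 1) + ramp_part (2 - s))\<^sup>2"

lemma ramp_denominator: "0 < ramp_part (s - 1) + ramp_part (2 - s)"
proof (cases "1 < s")
  case True
  then have "0 < ramp_part (s - 1)" by (simp add: ramp_part_def)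
  then show ?thesis by (rule add_pos_nonneg) (simp add: ramp_part_def)
next
  case False
  then have "0 < ramp_part (2 - s)" by (simp add: ramp_part_def)
  then show ?thesis by (intro add_nonneg_pos) (simp add: ramp_part_def)
qed

lemma ramp_deriv: "(ramp has_real_derivative ramp' s) (at s)"
proof -
  have 1: "((\<lambda>s. ramp_part (s - 1)) has_real_derivative 2 * max 0 (s - 1)) (at s)"
    using DERIV_chain2[OF ramp_part_deriv DERIV_diff[OF DERIV_ident DERIV_const]] by simp
  have 2: "((\<lambda>s. ramp_part (2 - s)) has_real_derivative - (2 * max 0 (2 - s))) (at s)"
    using DERIV_chain2[OF ramp_part_deriv DERIV_diff[OF DERIV_const DERIV_ident]] by simp
  show ?thesis
    unfolding ramp_def[abs_def]
    by (rule DERIV_cong[OF DERIV_divide[OF 1 DERIV_add[OF 1 2]]])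
       (use ramp_denominator[of s] in \<open>auto simp: ramp'_def power2_eq_square algebra_simps\<close>)
qed

lemma ramp_bounds: "0 \<le> ramp s" "ramp s \<le> 1"
  using ramp_denominator[of s] by (auto simp: ramp_def ramp_part_def)

lemma ramp_eq_0: "s \<le> 1 \<Longrightarrow> ramp s = 0"
  by (simp add: ramp_def ramp_part_def)

lemma ramp_eq_1: "2 \<le> s \<Longrightarrow> ramp s = 1"
  using ramp_denominator[of s] by (simp add: ramp_def ramp_part_def)

lemma ramp'_nonneg: "0 \<le> ramp' s"
  unfolding ramp'_def ramp_part_def by (intro divide_nonneg_nonneg add_nonneg_nonneg mult_nonneg_nonneg) auto

lemma ramp'_eq_0: "s \<notin> {1<..<2} \<Longrightarrow> ramp' s = 0"
  by (auto simp: ramp'_def ramp_part_def)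

lemma continuous_ramp': "continuous_on UNIV ramp'"
proof -
  have "ramp_part (s - 1) + ramp_part (2 - s) \<noteq> 0" for s using ramp_denominator[of s] by simp
  then show ?thesis
    unfolding ramp'_def[abs_def] ramp_part_def[abs_def] by (intro continuous_intros) auto
qed

lemma ramp'_bounded: obtains B where "0 \<le> B" "\<And>s. norm (ramp' s) \<le> B"
proof (rule continuous_compact_support_bounded[OF continuous_ramp' bounded_Ioo[of 1 2]])
  show "ramp' x = 0" if "x \<notin> {1<..<2}" for x using that by (rule ramp'_eq_0)
next
  fix B :: real assume "0 \<le> B" "\<And>x. norm (ramp' x) \<le> B"
  then show thesis by (rule that)
qed

lemma integrable_ramp': "integrable lborel ramp'"
proof -
  obtain B where "0 \<le> B" "\<And>s. norm (ramp' s) \<le> B"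
    using ramp'_bounded by blast
  then show ?thesis
    using borel_measurable_continuous_onI[OF continuous_ramp'] ramp'_eq_0
    by (intro integrable_bounded_support[OF _ bounded_Ioo[of 1 2]]) blast+
qed

text \<open>Mass one: the functions k ramp'(k s) concentrate to a unit mass as k grows.\<close>

lemma integral_ramp': "(\<integral>s. ramp' s \<partial>lborel) = 1"
proof -
  have "(\<integral>s. ramp' s \<partial>lborel) = (\<integral>s. ramp' s * indicator {1..2} s \<partial>lborel)"
  proof (intro Bochner_Integration.integral_cong[OF refl])
    fix s :: real
    show "ramp' s = ramp' s * indicator {1..2} s"
      using ramp'_eq_0[of s] by (cases "s \<in> {1..2}") auto
  qed
  also have "\<dots> = ramp 2 - ramp 1"
    by (rule integral_FTC_Icc_real)
       (use ramp_deriv continuous_ramp' in \<open>auto simp: continuous_on_eq_continuous_at\<close>)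
  finally show ?thesis by (simp add: ramp_eq_0 ramp_eq_1)
qed

text \<open>The layer of thickness about \<open>1 / (n + 1)\<close> above the graph of \<open>\<gamma>\<close> collapses to the graph, which is
  parametrized over the cylinder used in the definition of the surface measure.\<close>

lemma layer_limit:
  fixes h :: "'a::euclidean_space \<Rightarrow> real" and e :: 'a
  assumes e: "norm e = 1" and h: "continuous_on UNIV h" and S: "bounded S"
    and supp: "\<And>x. x \<notin> S \<Longrightarrow> h x = 0"
    and \<gamma>: "continuous_on UNIV \<gamma>" and inv: "\<And>x s. \<gamma> (x + s *\<^sub>R e) = \<gamma> x"
  shows "(\<lambda>n. \<integral>x. h x * (real (Suc n) * ramp' (real (Suc n) * (x \<bullet> e - \<gamma> x))) \<partial>lborel)
    \<longlonglongrightarrow> (\<integral>y. indicator {0<..<1} (y \<bullet> e) * h (y + (\<gamma> y - y \<bullet> e) *\<^sub>R e) \<partial>lborel)"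
proof -
  have ee: "e \<bullet> e = 1" using e by (simp add: dot_square_norm)
  obtain M where M: "0 \<le> M" "\<And>x. norm (h x) \<le> M"
    using continuous_compact_support_bounded[OF h S] supp by metis
  obtain R where R: "\<And>x. x \<in> S \<Longrightarrow> norm x \<le> R" using S bounded_iff by metis
  obtain B where B: "0 \<le> B" "\<And>x. norm (ramp' x) \<le> B"
    using ramp'_bounded by blast
  have [measurable]: "h \<in> borel_measurable borel" "\<gamma> \<in> borel_measurable borel" "ramp' \<in> borel_measurable borel"
    using h \<gamma> continuous_ramp' by (auto intro: borel_measurable_continuous_onI)
  define k where "k n = real (Suc n)" for n
  have k: "1 \<le> k n" for n by (simp add: k_def)
  define G where "G y = y + (\<gamma> y - y \<bullet> e) *\<^sub>R e" for y
  have [measurable]: "G \<in> borel_measurable borel" unfolding G_def[abs_def] by measurable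
  have \<gamma>G: "\<gamma> (G y) = \<gamma> y" for y by (simp add: G_def inv)
  define I where "I n y = (\<integral>s. h (G y + (s / k n) *\<^sub>R e) * ramp' s \<partial>lborel)" for n y
  have [measurable]: "I n \<in> borel_measurable borel" for n
  proof -
    have "(\<lambda>(y, s). h (G y + (s / k n) *\<^sub>R e) * ramp' s) \<in> borel_measurable (borel \<Otimes>\<^sub>M lborel)"
      by measurable
    from lborel.borel_measurable_lebesgue_integral[OF this] show ?thesis unfolding I_def[abs_def] .
  qed
  \<comment> \<open>Slicing along \<open>e\<close>, then replacing the height \<open>s\<close> by
    \<open>\<gamma> y - y \<bullet> e + s / k n\<close>, moves the shrinking layer to the fixed
    range of \<open>ramp'\<close>. The Jacobian \<open>1 / k n\<close> cancels the factor
    \<open>k n\<close>.\<close>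
  have slice: "(\<integral>x. h x * (k n * ramp' (k n * (x \<bullet> e - \<gamma> x))) \<partial>lborel) =
      (\<integral>y. indicator {0<..<1} (y \<bullet> e) * I n y \<partial>lborel)" for n
  proof -
    let ?f = "\<lambda>x. h x * (k n * ramp' (k n * (x \<bullet> e - \<gamma> x)))"
    have "(\<integral>x. ?f x \<partial>lborel) =
        (\<integral>y. indicator {0<..<1} (y \<bullet> e) * (\<integral>s. ?f (y + s *\<^sub>R e) \<partial>lborel) \<partial>lborel)"
    proof (rule integral_slices[OF e _ S])
      show "?f \<in> borel_measurable borel" by measurable
      show "?f x = 0" if "x \<notin> S" for x using supp that by simp
      show "\<bar>?f x\<bar> \<le> M * (k n * B)" for x
        using M(2)[of x] B(2)[of "k n * (x \<bullet> e - \<gamma> x)"] k[of n] M(1) B(1)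
        by (auto simp: abs_mult intro!: mult_mono)
    qed
    moreover have "(\<integral>s. ?f (y + s *\<^sub>R e) \<partial>lborel) = I n y" for y
    proof -
      have "(\<integral>s. ?f (y + s *\<^sub>R e) \<partial>lborel) =
          \<bar>1 / k n\<bar> *\<^sub>R (\<integral>s. ?f (y + ((\<gamma> y - y \<bullet> e) + (1 / k n) * s) *\<^sub>R e) \<partial>lborel)"
        using k[of n] by (intro lborel_integral_real_affine) auto
      also have "\<dots> = (\<integral>s. (1 / k n) * ?f (y + ((\<gamma> y - y \<bullet> e) + (1 / k n) * s) *\<^sub>R e) \<partial>lborel)"
        using k[of n] by (subst integral_mult_right_zero) simp
      also have "\<dots> = I n y"
        unfolding I_def
      proof (rule Bochner_Integration.integral_cong[OF refl])
        fix s
        have "y + ((\<gamma> y - y \<bullet> e) + (1 / k n) * s) *\<^sub>R e = G y + (s / k n) *\<^sub>R e"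
          by (simp add: G_def scaleR_add_left)
        moreover have "k n * ((y + ((\<gamma> y - y \<bullet> e) + (1 / k n) * s) *\<^sub>R e) \<bullet> e - \<gamma> y) = s"
          using k[of n] by (simp add: inner_add_left ee)
        ultimately show "(1 / k n) * ?f (y + ((\<gamma> y - y \<bullet> e) + (1 / k n) * s) *\<^sub>R e) =
            h (G y + (s / k n) *\<^sub>R e) * ramp' s"
          using k[of n] by (simp add: inv \<gamma>G)
      qed
      finally show ?thesis .
    qed
    ultimately show ?thesis by (simp only:)
  qed
  have bnd: "\<bar>h (G y + (s / k n) *\<^sub>R e) * ramp' s\<bar> \<le> M * ramp' s" for n y s
    using M(2) ramp'_nonneg[of s] by (auto simp: abs_mult intro!: mult_right_mono)
  have limI: "(\<lambda>n. I n y) \<longlonglongrightarrow> h (G y)" for y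
  proof -
    have "(\<lambda>n. I n y) \<longlonglongrightarrow> (\<integral>s. h (G y) * ramp' s \<partial>lborel)"
      unfolding I_def
    proof (rule integral_dominated_convergence[where w="\<lambda>s. M * ramp' s"])
      show "integrable lborel (\<lambda>s. M * ramp' s)" using integrable_ramp' by simp
      show "AE s in lborel. (\<lambda>n. h (G y + (s / k n) *\<^sub>R e) * ramp' s) \<longlonglongrightarrow> h (G y) * ramp' s"
      proof (intro AE_I2 tendsto_mult tendsto_const)
        fix s
        have "(\<lambda>n. G y + (s * inverse (real (Suc n))) *\<^sub>R e) \<longlonglongrightarrow> G y + (s * 0) *\<^sub>R e"
          by (intro tendsto_intros LIMSEQ_inverse_real_of_nat)
        then have "(\<lambda>n. G y + (s / k n) *\<^sub>R e) \<longlonglongrightarrow> G y" by (simp add: k_def divide_inverse)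
        then show "(\<lambda>n. h (G y + (s / k n) *\<^sub>R e)) \<longlonglongrightarrow> h (G y)"
          using h by (intro isCont_tendsto_compose[of "G y" h]) (auto simp: continuous_on_eq_continuous_at)
      qed
    qed (use bnd in auto)
    then show ?thesis by (simp add: integral_ramp')
  qed
  have I_bound: "\<bar>I n y\<bar> \<le> M" for n y
  proof -
    let ?f = "\<lambda>s. h (G y + (s / k n) *\<^sub>R e) * ramp' s"
    have w: "integrable lborel (\<lambda>s. M * ramp' s)" using integrable_ramp' by simp
    have m: "?f \<in> borel_measurable lborel" by measurable
    have "integrable lborel ?f"
    proof (rule Bochner_Integration.integrable_bound[OF w m], rule AE_I2)
      show "norm (?f s) \<le> norm (M * ramp' s)" for s
        using order_trans[OF bnd abs_ge_self] by simp
    qed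
    then have "norm (I n y) \<le> (\<integral>s. M * ramp' s \<partial>lborel)"
      unfolding I_def using bnd 
      by (intro Bochner_Integration.integral_norm_bound_integral w) auto
    then show ?thesis by (simp add: integral_ramp')
  qed
  \<comment> \<open>A common bounded support in \<open>y\<close> for all n, required for domination.
    By \<open>norm_le_shifted\<close> the radius \<open>2 * R + 1\<close> is what counts; the rest
    is slack.\<close>
  have I0: "I n y = 0" if y: "norm y > 2 * R + 5" "0 < y \<bullet> e" "y \<bullet> e < 1" for n y
  proof -
    have "h (G y + (s / k n) *\<^sub>R e) * ramp' s = 0" for s
    proof (rule ccontr)
      let ?x = "G y + (s / k n) *\<^sub>R e"
      assume *: "h ?x * ramp' s \<noteq> 0"
      then have s: "1 < s" "s < 2" and x: "norm ?x \<le> R" using ramp'_eq_0[of s] supp R by force+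
      have "?x = y + (\<gamma> y - y \<bullet> e + s / k n) *\<^sub>R e" by (simp add: G_def scaleR_add_left)
      then have "norm y \<le> 2 * norm ?x + 1" using norm_le_shifted[OF e y(2,3)] by simp
      then show False using y(1) x norm_ge_zero[of ?x] by linarith
    qed
    then show ?thesis unfolding I_def by (simp only: Bochner_Integration.integral_zero)
  qed
  have "(\<lambda>n. \<integral>y. indicator {0<..<1} (y \<bullet> e) * I n y \<partial>lborel)
      \<longlonglongrightarrow> (\<integral>y. indicator {0<..<1} (y \<bullet> e) * h (G y) \<partial>lborel)"
  proof (rule integral_dominated_convergence[where w="\<lambda>y. indicator (cball 0 (2 * R + 5)) y * M"])
    show "integrable lborel (\<lambda>x::'a. indicator (cball 0 (2 * R + 5)) x * M)"
      by (rule integrable_mult_left[OF integrable_indicator_bounded[OF borel_closed[OF closed_cball] bounded_cball]])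
    show "AE y in lborel. (\<lambda>n. indicator {0<..<1} (y \<bullet> e) * I n y) \<longlonglongrightarrow> indicator {0<..<1} (y \<bullet> e) * h (G y)"
      using limI by (intro AE_I2 tendsto_mult tendsto_const) auto
    show "AE y in lborel. norm (indicator {0<..<1} (y \<bullet> e) * I n y) \<le> indicator (cball 0 (2 * R + 5)) y * M" for n
    proof (rule AE_I2)
      fix y show "norm (indicator {0<..<1} (y \<bullet> e) * I n y) \<le> indicator (cball 0 (2 * R + 5)) y * M"
        using I_bound[of n y] I0[of y n] M(1) by (auto simp: indicator_def not_le)
    qed
  qed measurable
  then show ?thesis unfolding slice[symmetric] unfolding G_def k_def .
qed

subsection \<open>Graph charts and the outward normal\<close>

lemma linear_eq_inner_axis:
  fixes f :: "real^'d \<Rightarrow> real"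
  assumes "linear f"
  shows "f h = (\<chi> i. f (axis i 1)) \<bullet> h"
proof -
  have "f h = f (\<Sum>i\<in>UNIV. h $ i *\<^sub>R axis i 1)"
    using basis_expansion[of h] by (simp add: scalar_mult_eq_scaleR)
  also have "\<dots> = (\<Sum>i\<in>UNIV. h $ i * f (axis i 1))"
    using assms by (simp add: linear_sum linear_scale)
  finally show ?thesis by (simp add: inner_vec_def mult.commute)
qed

locale boundary_chart =
  fixes D :: "(real^'d) set" and x0 :: "real^'d" and r :: real and e :: "real^'d" and \<gamma> :: "real^'d \<Rightarrow> real"
  assumes chart: "graph_chart D x0 r e \<gamma>" and open_D: "open D"
begin

definition height :: "real^'d \<Rightarrow> real" where "height x = x \<bullet> e - \<gamma> x"

text \<open>The gradient of \<open>height\<close>. It points into \<open>D\<close>, and its length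
  is the area density of the graph; so the density of the surface measure and the normalization of
  the normal cancel in boundary integrals.\<close>

definition conormal :: "real^'d \<Rightarrow> real^'d" where "conormal x = e - grad \<gamma> x"

definition to_graph :: "real^'d \<Rightarrow> real^'d" where "to_graph y = y + (\<gamma> y - y \<bullet> e) *\<^sub>R e"

lemma r_pos: "0 < r" using chart by (simp add: graph_chart_def)

lemma norm_e: "norm e = 1"
  using chart norm_Basis[of e] norm_Basis[of "-e"] by (auto simp: graph_chart_def)

lemma e_e: "e \<bullet> e = 1"
  using norm_e by (simp add: dot_square_norm)

lemma \<gamma>_inv: "\<gamma> (x + s *\<^sub>R e) = \<gamma> x"
  using chart by (simp add: graph_chart_def)

lemma D_ball: "x \<in> ball x0 r \<Longrightarrow> x \<in> D \<longleftrightarrow> 0 < height x"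
  using chart by (auto simp: graph_chart_def height_def)

lemma \<gamma>_derivative: "(\<gamma> has_derivative (\<lambda>h. grad \<gamma> x \<bullet> h)) (at x)"
proof -
  have "[] \<in> multi_indices 1" by (simp add: multi_indices_def)
  then have "\<gamma> differentiable (at x)"
    using chart unfolding graph_chart_def Ck_on_def by force
  then have *: "(\<gamma> has_derivative frechet_derivative \<gamma> (at x)) (at x)"
    unfolding frechet_derivative_works .
  have "frechet_derivative \<gamma> (at x) = (\<lambda>h. grad \<gamma> x \<bullet> h)"
    unfolding grad_def by (rule ext, rule linear_eq_inner_axis[OF has_derivative_linear[OF *]])
  with * show ?thesis by simp
qed

lemma continuous_grad: "continuous_on UNIV (grad \<gamma>)"
proof -
  have "continuous_on UNIV (\<lambda>x. frechet_derivative \<gamma> (at x) (axis i 1))" for i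
  proof -
    have "[axis i 1 :: real^'d] \<in> multi_indices 1" by (simp add: multi_indices_def axis_in_Basis_iff Basis_real_def)
    then have "continuous_on UNIV (iter_partial [axis i 1] \<gamma>)"
      using chart unfolding graph_chart_def Ck_on_def by blast
    then show ?thesis by simp
  qed
  then show ?thesis unfolding grad_def[abs_def] by (intro continuous_on_vec_lambda)
qed

lemma continuous_\<gamma>: "continuous_on UNIV \<gamma>"
  using \<gamma>_derivative has_derivative_continuous by (fastforce simp: continuous_on_eq_continuous_within)

lemma grad_e: "grad \<gamma> x \<bullet> e = 0"
proof -
  have "((\<lambda>s. \<gamma> (x + s *\<^sub>R e)) has_derivative (\<lambda>s. grad \<gamma> x \<bullet> (s *\<^sub>R e))) (at 0)"
    by (rule has_derivative_compose[of "\<lambda>s. x + s *\<^sub>R e"])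
       (use \<gamma>_derivative[of x] in \<open>auto intro!: derivative_eq_intros\<close>)
  moreover have "((\<lambda>s. \<gamma> (x + s *\<^sub>R e)) has_derivative (\<lambda>s::real. 0)) (at 0)"
    by (simp add: \<gamma>_inv)
  ultimately have "(\<lambda>s. grad \<gamma> x \<bullet> (s *\<^sub>R e)) = (\<lambda>s. 0)" by (rule has_derivative_unique)
  from fun_cong[OF this, of 1] show ?thesis by simp
qed

lemma grad_inv: "grad \<gamma> (x + s *\<^sub>R e) = grad \<gamma> x"
proof -
  have "((\<lambda>y. \<gamma> (y + s *\<^sub>R e)) has_derivative (\<lambda>h. grad \<gamma> (x + s *\<^sub>R e) \<bullet> h)) (at x)"
    by (rule has_derivative_compose[of "\<lambda>y. y + s *\<^sub>R e"])
       (use \<gamma>_derivative[of "x + s *\<^sub>R e"] in \<open>auto intro!: derivative_eq_intros\<close>)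
  then have "(\<gamma> has_derivative (\<lambda>h. grad \<gamma> (x + s *\<^sub>R e) \<bullet> h)) (at x)" by (simp add: \<gamma>_inv)
  from has_derivative_unique[OF this \<gamma>_derivative]
  have "grad \<gamma> (x + s *\<^sub>R e) \<bullet> h = grad \<gamma> x \<bullet> h" for h by (rule fun_cong)
  then show ?thesis using vector_eq_rdot by blast
qed

lemma height_derivative: "(height has_derivative (\<lambda>h. conormal x \<bullet> h)) (at x)"
  unfolding height_def[abs_def] conormal_def
  by (auto intro!: derivative_eq_intros \<gamma>_derivative simp: fun_eq_iff inner_diff_left inner_diff_right inner_commute)

lemma continuous_height: "continuous_on UNIV height"
  unfolding height_def[abs_def] by (intro continuous_intros continuous_\<gamma>)

lemma continuous_conormal: "continuous_on UNIV conormal"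
  unfolding conormal_def[abs_def] by (intro continuous_intros continuous_grad)

lemma conormal_e: "conormal x \<bullet> e = 1"
  by (simp add: conormal_def inner_diff_left e_e grad_e)

lemma conormal_nonzero: "conormal x \<noteq> 0"
  using conormal_e[of x] by auto

lemma norm_conormal: "norm (conormal x) = sqrt (1 + (norm (grad \<gamma> x))\<^sup>2)"
proof -
  have "(norm (conormal x))\<^sup>2 = 1 + (norm (grad \<gamma> x))\<^sup>2"
    using grad_e[of x] by (simp add: conormal_def power2_norm_eq_inner algebra_simps e_e inner_commute)
  then show ?thesis by (metis norm_ge_zero real_sqrt_abs abs_of_nonneg)
qed

lemma height_shift: "height (x + s *\<^sub>R e) = height x + s"
  by (simp add: height_def \<gamma>_inv inner_add_left e_e)

lemma to_graph_eq: "to_graph y = y + (- height y) *\<^sub>R e"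
  by (simp add: to_graph_def height_def)

lemma height_to_graph: "height (to_graph y) = 0"
  unfolding to_graph_eq height_shift by simp

lemma conormal_to_graph: "conormal (to_graph y) = conormal y"
  by (simp add: conormal_def to_graph_def grad_inv)

lemma continuous_to_graph: "continuous_on UNIV to_graph"
  unfolding to_graph_def[abs_def] by (intro continuous_intros continuous_\<gamma>)

text \<open>The chart gives \<open>D\<close> only as a strict epigraph, so the boundary has to be
  derived: the points of the ball below the graph form an open set disjoint from \<open>D\<close>,
  and a point of the graph is the limit of points \<open>x + s *\<^sub>R e\<close> with s >
  0.\<close>

lemma frontier_iff:
  assumes x: "x \<in> ball x0 r"
  shows "x \<in> frontier D \<longleftrightarrow> height x = 0"
proof
  assume f: "x \<in> frontier D"
  then have "x \<notin> D" using open_D by (simp add: frontier_def interior_open)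
  then have "height x \<le> 0" using D_ball[OF x] by simp
  moreover have "\<not> height x < 0"
  proof
    assume neg: "height x < 0"
    let ?U = "ball x0 r \<inter> height -` {..<0}"
    have "open ?U"
      using continuous_height by (intro open_Int open_vimage) auto
    moreover have "x \<in> ?U" using x neg by simp
    ultimately have "?U \<inter> D \<noteq> {}"
      using f by (metis DiffD1 frontier_def disjoint_iff open_Int_closure_eq_empty)
    then show False using D_ball by force
  qed
  ultimately show "height x = 0" by simp
next
  assume 0: "height x = 0"
  then have "x \<notin> D" using D_ball[OF x] by simp
  moreover have "x \<in> closure D"
  proof (subst closure_approachable, intro allI impI)
    fix \<epsilon> :: real assume "0 < \<epsilon>"
    define s where "s = min \<epsilon> (r - dist x0 x) / 2"
    have s: "0 < s" "s < \<epsilon>" "s < r - dist x0 x"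
      using \<open>0 < \<epsilon>\<close> x by (auto simp: s_def min_def)
    have d: "dist (x + s *\<^sub>R e) x = s" using s norm_e by (simp add: dist_norm)
    then have "x + s *\<^sub>R e \<in> ball x0 r"
      using s dist_triangle[of x0 "x + s *\<^sub>R e" x] by (simp add: dist_commute)
    then have "x + s *\<^sub>R e \<in> D" using D_ball height_shift 0 s by simp
    then show "\<exists>y\<in>D. dist y x < \<epsilon>" using d s by metis
  qed
  ultimately show "x \<in> frontier D" using open_D by (simp add: frontier_def interior_open)
qed

text \<open>\<open>conormal x \<bullet> v\<close> is the derivative of the height along
  \<open>v\<close>, so its sign tells on which side of the graph a short step ends.\<close>

lemma height_side:
  assumes x: "x \<in> ball x0 r" "height x = 0"
  shows "0 < conormal x \<bullet> v \<Longrightarrow> \<forall>\<^sub>F s in at_right 0. x + s *\<^sub>R v \<in> D"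
    and "conormal x \<bullet> v < 0 \<Longrightarrow> \<forall>\<^sub>F s in at_right 0. x + s *\<^sub>R v \<notin> D"
proof -
  have "((\<lambda>s. x + s *\<^sub>R v) \<longlongrightarrow> x + 0 *\<^sub>R v) (at_right 0)" by (intro tendsto_intros)
  then have ball: "\<forall>\<^sub>F s in at_right 0. x + s *\<^sub>R v \<in> ball x0 r"
    using x by (intro topological_tendstoD[OF _ open_ball]) auto
  have "((\<lambda>s. height (x + s *\<^sub>R v)) has_derivative (\<lambda>s. conormal x \<bullet> (s *\<^sub>R v))) (at 0)"
    by (rule has_derivative_compose[of "\<lambda>s. x + s *\<^sub>R v"])
       (use height_derivative[of x] in \<open>auto intro!: derivative_eq_intros\<close>)
  then have der: "((\<lambda>s. height (x + s *\<^sub>R v)) has_real_derivative (conormal x \<bullet> v)) (at 0)"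
    by (simp add: has_field_derivative_def mult_commute_abs)
  {
    assume "0 < conormal x \<bullet> v"
    from DERIV_pos_inc_right[OF der this] obtain d where d: "0 < d"
      "\<And>s. 0 < s \<Longrightarrow> s < d \<Longrightarrow> 0 < height (x + s *\<^sub>R v)" using x by auto
    have "\<forall>\<^sub>F s in at_right 0. 0 < height (x + s *\<^sub>R v)"
      unfolding eventually_at_right_field using d by auto
    with ball show "\<forall>\<^sub>F s in at_right 0. x + s *\<^sub>R v \<in> D"
      by eventually_elim (simp add: D_ball)
  }
  {
    assume "conormal x \<bullet> v < 0"
    from DERIV_neg_dec_right[OF der this] obtain d where d: "0 < d"
      "\<And>s. 0 < s \<Longrightarrow> s < d \<Longrightarrow> height (x + s *\<^sub>R v) < 0" using x by auto
    have "\<forall>\<^sub>F s in at_right 0. height (x + s *\<^sub>R v) < 0"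
      unfolding eventually_at_right_field using d by auto
    with ball show "\<forall>\<^sub>F s in at_right 0. x + s *\<^sub>R v \<notin> D"
      by eventually_elim (simp add: D_ball)
  }
qed

text \<open>Tangency is the differentiability of \<open>height\<close> read along the boundary:
  there the height is zero, so \<open>conormal x \<bullet> (y - x)\<close> is of smaller order than
  |y - x|.\<close>

lemma is_outward_normal_conormal:
  assumes x: "x \<in> ball x0 r" "height x = 0"
  shows "is_outward_normal D x (- (conormal x /\<^sub>R norm (conormal x)))"
proof -
  let ?\<nu> = "- (conormal x /\<^sub>R norm (conormal x))"
  have n0: "norm (conormal x) > 0" using conormal_nonzero by simp
  have 1: "norm ?\<nu> = 1" using n0 by simp
  have "(height has_derivative (\<lambda>h. conormal x \<bullet> h)) (at x within frontier D)"
    using height_derivative has_derivative_at_withinI by blast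
  then have lim: "((\<lambda>y. (1 / norm (y - x)) *\<^sub>R (height y - (height x + conormal x \<bullet> (y - x)))) \<longlongrightarrow> 0)
      (at x within frontier D)"
    unfolding has_derivative_within by blast
  have ev: "\<forall>\<^sub>F y in at x within frontier D. height y = 0"
  proof -
    have "\<forall>\<^sub>F y in at x within frontier D. y \<in> ball x0 r"
      using topological_tendstoD[OF tendsto_ident_at open_ball x(1)] .
    moreover have "\<forall>\<^sub>F y in at x within frontier D. y \<in> frontier D"
      by (simp add: eventually_at_filter)
    ultimately show ?thesis by eventually_elim (simp add: frontier_iff)
  qed
  have 2: "((\<lambda>y. ((y - x) \<bullet> ?\<nu>) / norm (y - x)) \<longlongrightarrow> 0) (at x within frontier D)"
  proof (rule Lim_transform_eventually)
    show "((\<lambda>y. inverse (norm (conormal x)) *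
        ((1 / norm (y - x)) *\<^sub>R (height y - (height x + conormal x \<bullet> (y - x))))) \<longlongrightarrow> 0) (at x within frontier D)"
      using tendsto_mult_left[OF lim, of "inverse (norm (conormal x))"] by simp
    show "\<forall>\<^sub>F y in at x within frontier D. inverse (norm (conormal x)) *
        ((1 / norm (y - x)) *\<^sub>R (height y - (height x + conormal x \<bullet> (y - x)))) =
        ((y - x) \<bullet> ?\<nu>) / norm (y - x)"
      using ev by eventually_elim (simp add: x inner_commute divide_inverse)
  qed
  have "conormal x \<bullet> ?\<nu> < 0" using conormal_nonzero by (simp add: dot_square_norm power2_eq_square)
  then have 3: "\<forall>\<^sub>F s in at_right 0. x + s *\<^sub>R ?\<nu> \<notin> D" "\<forall>\<^sub>F s in at_right 0. x + s *\<^sub>R (- ?\<nu>) \<in> D"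
    using height_side(2)[OF x, of ?\<nu>] height_side(1)[OF x, of "- ?\<nu>"] by (simp_all only: inner_minus_right neg_0_less_iff_less)
  show ?thesis
    unfolding is_outward_normal_def
    using 1 2 eventually_conj[OF 3(2) 3(1)] by simp
qed

text \<open>\<open>outward_normal\<close> is a definite description, so its value is known only
  after uniqueness. Curves in the boundary show that \<open>\<nu>\<close> annihilates every
  \<open>v\<close> orthogonal to the conormal, hence is a multiple of it; the length and the side
  conditions then fix the factor.\<close>

lemma outward_normal_unique:
  assumes x: "x \<in> ball x0 r" "height x = 0" and \<nu>: "is_outward_normal D x \<nu>"
  shows "\<nu> = - (conormal x /\<^sub>R norm (conormal x))"
proof -
  have tangent: "v \<bullet> \<nu> = 0" if v: "conormal x \<bullet> v = 0" for v
  proof (cases "v = 0")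
    case False
    \<comment> \<open>The straight line in direction \<open>v\<close> pushed back onto the graph
      along \<open>e\<close>. The correction is of smaller order than s because \<open>v\<close> is
      orthogonal to the conormal, so the curve still leaves \<open>x\<close> in direction
      \<open>v\<close>.\<close>
    define c where "c s = to_graph (x + s *\<^sub>R v)" for s :: real
    have "((\<lambda>s. height (x + s *\<^sub>R v)) has_derivative (\<lambda>s. conormal x \<bullet> (s *\<^sub>R v))) (at 0)"
      by (rule has_derivative_compose[of "\<lambda>s. x + s *\<^sub>R v"])
         (use height_derivative[of x] in \<open>auto intro!: derivative_eq_intros\<close>)
    then have der: "((\<lambda>s. height (x + s *\<^sub>R v)) has_real_derivative 0) (at 0)"
      using v by (simp add: has_field_derivative_def mult_commute_abs[of 0, symmetric])
    then have "((\<lambda>s. height (x + s *\<^sub>R v) / s) \<longlongrightarrow> 0) (at 0)"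
      using x by (simp add: DERIV_def)
    then have h0: "((\<lambda>s. height (x + s *\<^sub>R v) / s) \<longlongrightarrow> 0) (at_right 0)"
      by (rule filterlim_mono) (auto simp: at_le)
    have cx: "c s - x = s *\<^sub>R (v - (height (x + s *\<^sub>R v) / s) *\<^sub>R e)" if "s > 0" for s
      using that by (simp add: c_def to_graph_eq algebra_simps)
    have q: "((\<lambda>s. v - (height (x + s *\<^sub>R v) / s) *\<^sub>R e) \<longlongrightarrow> v) (at_right 0)"
      using tendsto_diff[OF tendsto_const tendsto_scaleR[OF h0 tendsto_const], of v e] by simp
    have contc: "isCont c 0"
      unfolding c_def using continuous_to_graph
      by (intro continuous_at_compose[unfolded o_def, of 0 "\<lambda>s. x + s *\<^sub>R v" to_graph])
         (auto intro!: continuous_intros simp: continuous_on_eq_continuous_at)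
    have c0: "c 0 = x" using x by (simp add: c_def to_graph_eq)
    have limc: "(c \<longlongrightarrow> x) (at_right 0)"
      using contc c0 by (metis continuous_at filterlim_mono at_le order_refl subset_UNIV)
    have evb: "\<forall>\<^sub>F s in at_right 0. c s \<in> ball x0 r"
      using topological_tendstoD[OF limc open_ball x(1)] .
    have evn: "\<forall>\<^sub>F s in at_right 0. v - (height (x + s *\<^sub>R v) / s) *\<^sub>R e \<noteq> 0"
      using tendsto_imp_eventually_ne[OF q False] .
    have pos: "\<forall>\<^sub>F s in at_right (0::real). 0 < s" by (simp add: eventually_at_filter)
    have "filterlim c (at x within frontier D) (at_right 0)"
      unfolding filterlim_at
    proof
      show "\<forall>\<^sub>F s in at_right 0. c s \<in> frontier D \<and> c s \<noteq> x"
        using evb evn pos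
      proof eventually_elim
        case (elim s)
        then have "c s - x \<noteq> 0" using cx[of s] by simp
        then show ?case using elim frontier_iff height_to_graph by (simp add: c_def)
      qed
    qed (rule limc)
    moreover have "((\<lambda>y. ((y - x) \<bullet> \<nu>) / norm (y - x)) \<longlongrightarrow> 0) (at x within frontier D)"
      using \<nu> by (simp add: is_outward_normal_def)
    ultimately have l1: "((\<lambda>s. ((c s - x) \<bullet> \<nu>) / norm (c s - x)) \<longlongrightarrow> 0) (at_right 0)"
      by (rule filterlim_compose[rotated])
    have l2: "((\<lambda>s. ((c s - x) \<bullet> \<nu>) / norm (c s - x)) \<longlongrightarrow> (v \<bullet> \<nu>) / norm v) (at_right 0)"
    proof (rule Lim_transform_eventually)
      let ?w = "\<lambda>s. v - (height (x + s *\<^sub>R v) / s) *\<^sub>R e"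
      show "((\<lambda>s. (?w s \<bullet> \<nu>) / norm (?w s)) \<longlongrightarrow> (v \<bullet> \<nu>) / norm v) (at_right 0)"
        using False by (intro tendsto_divide tendsto_inner tendsto_norm q tendsto_const) auto
      show "\<forall>\<^sub>F s in at_right 0. (?w s \<bullet> \<nu>) / norm (?w s) = ((c s - x) \<bullet> \<nu>) / norm (c s - x)"
        using pos by eventually_elim (simp add: cx)
    qed
    have "(v \<bullet> \<nu>) / norm v = 0"
      by (rule tendsto_unique[OF _ l2 l1]) simp
    then show ?thesis using False by simp
  qed simp
  let ?m = "conormal x"
  have m: "?m \<bullet> ?m > 0" using conormal_nonzero by simp
  define a where "a = (?m \<bullet> \<nu>) / (?m \<bullet> ?m)"
  have "?m \<bullet> (\<nu> - a *\<^sub>R ?m) = 0" using m by (simp add: a_def inner_diff_right)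
  from tangent[OF this] this have "(\<nu> - a *\<^sub>R ?m) \<bullet> (\<nu> - a *\<^sub>R ?m) = 0"
    by (simp add: inner_diff_right inner_commute)
  then have \<nu>m: "\<nu> = a *\<^sub>R ?m" by simp
  have "norm \<nu> = 1" using \<nu> by (simp add: is_outward_normal_def)
  then have a1: "\<bar>a\<bar> * norm ?m = 1" using \<nu>m by simp
  \<comment> \<open>A positive multiple of the conormal points into \<open>D\<close>, against the
    third clause of \<open>is_outward_normal\<close>.\<close>
  have "\<not> a > 0"
  proof
    assume "a > 0"
    then have "\<forall>\<^sub>F s in at_right 0. x + s *\<^sub>R \<nu> \<in> D"
      using height_side(1)[OF x, of \<nu>] \<nu>m m by simp
    moreover have "\<forall>\<^sub>F s in at_right 0. x - s *\<^sub>R \<nu> \<in> D \<and> x + s *\<^sub>R \<nu> \<notin> D"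
      using \<nu> by (simp add: is_outward_normal_def)
    ultimately have "\<forall>\<^sub>F s in at_right (0::real). False" by eventually_elim simp
    then show False by simp
  qed
  then have "- a * norm ?m = 1" using a1 by (simp add: abs_if split: if_splits)
  then have "a = - inverse (norm ?m)" using conormal_nonzero[of x] by (simp add: field_simps)
  then show ?thesis using \<nu>m by simp
qed

lemma outward_normal_eq:
  assumes "x \<in> ball x0 r" "x \<in> frontier D"
  shows "outward_normal D x = - (conormal x /\<^sub>R norm (conormal x))"
proof -
  have "height x = 0" using frontier_iff assms by simp
  then show ?thesis
    unfolding outward_normal_def
    using is_outward_normal_conormal outward_normal_unique assms(1) by (intro the_equality) auto
qed

end

lemma continuous_outward_normal:
  assumes "open D" "C1_boundary D"
  shows "continuous_on (frontier D) (outward_normal D)"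
  unfolding continuous_on_eq_continuous_within
proof
  fix x assume x: "x \<in> frontier D"
  then obtain r e \<gamma> where "graph_chart D x r e \<gamma>" using assms unfolding C1_boundary_def by blast
  then interpret boundary_chart D x r e \<gamma> using assms by unfold_locales
  let ?N = "\<lambda>x. - (conormal x /\<^sub>R norm (conormal x))"
  have "continuous_on UNIV ?N"
    using conormal_nonzero by (intro continuous_intros continuous_conormal) auto
  then have "continuous (at x within frontier D) ?N"
    by (meson continuous_on_eq_continuous_within continuous_within_subset UNIV_I subset_UNIV)
  then show "continuous (at x within frontier D) (outward_normal D)"
    by (rule continuous_transform_within[OF _ r_pos x])
       (simp add: outward_normal_eq dist_commute)
qed

subsection \<open>The surface measure in a chart\<close>

context boundary_chart
begin

lemma norm_le_to_graph:
  assumes "0 < y \<bullet> e" "y \<bullet> e < 1"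
  shows "norm y \<le> 2 * norm (to_graph y) + 1"
  unfolding to_graph_def by (rule norm_le_shifted[OF norm_e assms])

lemma emeasure_surface:
  assumes \<sigma>: "is_surface_measure D \<sigma>" and A: "A \<in> sets borel" "A \<subseteq> frontier D \<inter> ball x0 r"
  shows "emeasure \<sigma> A =
    (\<integral>\<^sup>+ y. indicator {0<..<1} (y \<bullet> e) * indicator A (to_graph y) * ennreal (norm (conormal y)) \<partial>lborel)"
proof -
  have "emeasure \<sigma> A = (\<integral>\<^sup>+ y. indicator {y. 0 < y \<bullet> e \<and> y \<bullet> e < 1 \<and> y + (\<gamma> y - y \<bullet> e) *\<^sub>R e \<in> A} y *
                    ennreal (sqrt (1 + (norm (grad \<gamma> y))\<^sup>2)) \<partial>lborel)"
    using \<sigma> chart A unfolding is_surface_measure_def by blast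
  also have "\<dots> = (\<integral>\<^sup>+ y. indicator {0<..<1} (y \<bullet> e) * indicator A (to_graph y) * ennreal (norm (conormal y)) \<partial>lborel)"
    by (intro nn_integral_cong) (auto simp: indicator_def to_graph_def norm_conormal)
  finally show ?thesis .
qed

text \<open>Only a bounded part of the cylinder lies over the ball, and the continuous area density
  is bounded there.\<close>

lemma emeasure_surface_finite:
  assumes \<sigma>: "is_surface_measure D \<sigma>"
  shows "emeasure \<sigma> (frontier D \<inter> ball x0 r) < \<infinity>"
proof -
  define R where "R = norm x0 + r"
  have R: "norm x \<le> R" if "x \<in> ball x0 r" for x
    using that norm_triangle_ineq2[of x x0] by (simp add: R_def dist_norm norm_minus_commute)
  have "continuous_on (cball 0 (2 * R + 1)) conormal" using continuous_conormal by (rule continuous_on_subset) simp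
  with compact_cball obtain C where C: "\<And>y. y \<in> cball 0 (2 * R + 1) \<Longrightarrow> norm (conormal y) \<le> C"
    by (rule compact_continuous_bound) blast
  have "emeasure \<sigma> (frontier D \<inter> ball x0 r) =
      (\<integral>\<^sup>+ y. indicator {0<..<1} (y \<bullet> e) * indicator (frontier D \<inter> ball x0 r) (to_graph y) *
        ennreal (norm (conormal y)) \<partial>lborel)"
    by (rule emeasure_surface[OF \<sigma>]) auto
  also have "\<dots> \<le> (\<integral>\<^sup>+ y. ennreal C * indicator (cball (0::real^'d) (2 * R + 1)) y \<partial>lborel)"
  proof (rule nn_integral_mono)
    fix y
    show "indicator {0<..<1} (y \<bullet> e) * indicator (frontier D \<inter> ball x0 r) (to_graph y) *
        ennreal (norm (conormal y)) \<le> ennreal C * indicator (cball 0 (2 * R + 1)) y"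
    proof (cases "y \<bullet> e \<in> {0<..<1} \<and> to_graph y \<in> frontier D \<inter> ball x0 r")
      case True
      then have "norm y \<le> 2 * R + 1" using norm_le_to_graph[of y] R[of "to_graph y"] by auto
      then have "y \<in> cball 0 (2 * R + 1)" by simp
      then show ?thesis using True C[of y] by (auto simp: ennreal_leI)
    qed (auto simp: indicator_def)
  qed
  also have "\<dots> = ennreal C * emeasure lborel (cball (0::real^'d) (2 * R + 1))"
    by (rule nn_integral_cmult_indicator) simp
  also have "\<dots> < \<infinity>"
    using emeasure_lborel_cball_finite[of "0::real^'d" "2 * R + 1"] by (simp add: ennreal_mult_less_top)
  finally show ?thesis .
qed

text \<open>The surface measure is prescribed on sets only. Restricted to the chart it equals the
  image under \<open>to_graph\<close> of Lebesgue measure with density \<open>w\<close>; equality on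
  Borel sets then transfers to integrals.\<close>

lemma surface_integral:
  fixes q :: "real^'d \<Rightarrow> real"
  assumes \<sigma>: "is_surface_measure D \<sigma>" and q[measurable]: "q \<in> borel_measurable borel"
    and supp: "\<And>x. x \<notin> frontier D \<inter> ball x0 r \<Longrightarrow> q x = 0"
  shows "(\<integral>x. q x \<partial>\<sigma>) = (\<integral>y. indicator {0<..<1} (y \<bullet> e) * (q (to_graph y) * norm (conormal y)) \<partial>lborel)"
proof -
  let ?B = "frontier D \<inter> ball x0 r"
  have sets_\<sigma>[measurable_cong]: "sets \<sigma> = sets borel" using \<sigma> by (simp add: is_surface_measure_def)
  have [measurable]: "frontier D \<in> sets borel" "?B \<in> sets borel" by auto
  have [measurable]: "to_graph \<in> borel_measurable borel"
    by (rule borel_measurable_continuous_onI[OF continuous_to_graph])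
  have [measurable]: "conormal \<in> borel_measurable borel"
    by (rule borel_measurable_continuous_onI[OF continuous_conormal])
  define w where "w y = indicator {0<..<1} (y \<bullet> e) * indicator ?B (to_graph y) * norm (conormal y)" for y
  have [measurable]: "w \<in> borel_measurable borel" unfolding w_def[abs_def] by measurable
  have w0: "0 \<le> w y" for y by (simp add: w_def)
  define M where "M = density \<sigma> (\<lambda>x. ennreal (indicator ?B x))"
  define N where "N = distr (density lborel (\<lambda>y. ennreal (w y))) borel to_graph"
  have "M = N"
  proof (rule measure_eqI)
    show "sets M = sets N" by (simp add: M_def N_def sets_\<sigma>)
    fix A assume "A \<in> sets M"
    then have [measurable]: "A \<in> sets borel" by (simp add: M_def sets_\<sigma>)
    have "emeasure M A = (\<integral>\<^sup>+x. ennreal (indicator ?B x) * indicator A x \<partial>\<sigma>)"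
      unfolding M_def by (rule emeasure_density) measurable
    also have "\<dots> = (\<integral>\<^sup>+x. indicator (A \<inter> ?B) x \<partial>\<sigma>)"
      by (intro nn_integral_cong) (auto simp: indicator_def)
    also have "\<dots> = emeasure \<sigma> (A \<inter> ?B)"
      by (rule nn_integral_indicator) measurable
    also have "\<dots> = (\<integral>\<^sup>+ y. indicator {0<..<1} (y \<bullet> e) * indicator (A \<inter> ?B) (to_graph y) *
        ennreal (norm (conormal y)) \<partial>lborel)"
      by (rule emeasure_surface[OF \<sigma>]) auto
    also have "\<dots> = (\<integral>\<^sup>+ y. ennreal (w y) * indicator (to_graph -` A) y \<partial>lborel)"
      by (intro nn_integral_cong) (auto simp: w_def indicator_def)
    also have "\<dots> = emeasure (density lborel (\<lambda>y. ennreal (w y))) (to_graph -` A)"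
      using measurable_sets[OF \<open>to_graph \<in> borel_measurable borel\<close> \<open>A \<in> sets borel\<close>]
      by (intro emeasure_density[symmetric]) auto
    also have "\<dots> = emeasure N A"
      unfolding N_def by (subst emeasure_distr) auto
    finally show "emeasure M A = emeasure N A" .
  qed
  have "(\<integral>x. q x \<partial>\<sigma>) = (\<integral>x. indicator ?B x *\<^sub>R q x \<partial>\<sigma>)"
  proof (rule Bochner_Integration.integral_cong[OF refl])
    show "q x = indicator ?B x *\<^sub>R q x" for x using supp[of x] by (cases "x \<in> ?B") auto
  qed
  also have "\<dots> = (\<integral>x. q x \<partial>M)"
    unfolding M_def by (rule integral_density[symmetric]) (measurable, auto)
  also have "\<dots> = (\<integral>x. q x \<partial>N)" using \<open>M = N\<close> by simp
  also have "\<dots> = (\<integral>y. q (to_graph y) \<partial>density lborel (\<lambda>y. ennreal (w y)))"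
    unfolding N_def by (rule integral_distr) measurable
  also have "\<dots> = (\<integral>y. w y *\<^sub>R q (to_graph y) \<partial>lborel)"
    by (rule integral_density) (measurable, auto simp: w0)
  also have "\<dots> = (\<integral>y. indicator {0<..<1} (y \<bullet> e) * (q (to_graph y) * norm (conormal y)) \<partial>lborel)"
    using supp by (intro Bochner_Integration.integral_cong[OF refl]) (auto simp: w_def indicator_def)
  finally show ?thesis .
qed

end

lemma finite_surface:
  assumes "open D" "bounded D" "C1_boundary D" and \<sigma>: "is_surface_measure D \<sigma>"
  shows "emeasure \<sigma> (frontier D) < \<infinity>"
proof -
  have "\<forall>x\<in>frontier D. \<exists>r. 0 < r \<and> emeasure \<sigma> (frontier D \<inter> ball x r) < \<infinity>"
  proof
    fix x assume "x \<in> frontier D"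
    then obtain r e \<gamma> where "graph_chart D x r e \<gamma>" using assms unfolding C1_boundary_def by blast
    then interpret boundary_chart D x r e \<gamma> using assms by unfold_locales
    show "\<exists>r. 0 < r \<and> emeasure \<sigma> (frontier D \<inter> ball x r) < \<infinity>"
      using r_pos emeasure_surface_finite[OF \<sigma>] by blast
  qed
  then obtain r where r: "\<And>x. x \<in> frontier D \<Longrightarrow> 0 < r x \<and> emeasure \<sigma> (frontier D \<inter> ball x (r x)) < \<infinity>"
    by metis
  have "compact (frontier D)" using assms by (intro compact_frontier_bounded)
  moreover have "\<And>x. x \<in> frontier D \<Longrightarrow> open (ball x (r x))" by simp
  moreover have "frontier D \<subseteq> (\<Union>x\<in>frontier D. ball x (r x))" using r by auto
  ultimately obtain C where C: "C \<subseteq> frontier D" "finite C" "frontier D \<subseteq> (\<Union>x\<in>C. ball x (r x))"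
    by (rule compactE_image)
  have sets: "sets \<sigma> = sets borel" using \<sigma> by (simp add: is_surface_measure_def)
  have "emeasure \<sigma> (frontier D) = emeasure \<sigma> (\<Union>x\<in>C. frontier D \<inter> ball x (r x))"
    using C(3) by (intro arg_cong[where f="emeasure \<sigma>"]) auto
  also have "\<dots> \<le> (\<Sum>x\<in>C. emeasure \<sigma> (frontier D \<inter> ball x (r x)))"
    using C(2) by (intro emeasure_subadditive_finite) (auto simp: sets)
  also have "\<dots> < \<infinity>"
  proof -
    have "emeasure \<sigma> (frontier D \<inter> ball x (r x)) < top" if "x \<in> C" for x
      using r[of x] C(1) that by auto
    with C(2) show ?thesis by simp
  qed
  finally show ?thesis .
qed

subsection \<open>The Gauss--Green formula for weak divergences\<close>

text \<open>The gradient is carried as an explicit field, so that the product and chain rules yield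
  closed expressions to be inserted into the weak formulation.\<close>

definition C1_with_grad :: "('a::euclidean_space \<Rightarrow> real) \<Rightarrow> ('a \<Rightarrow> 'a) \<Rightarrow> bool" where
  "C1_with_grad \<psi> g \<longleftrightarrow> (\<forall>x. (\<psi> has_derivative (\<lambda>h. g x \<bullet> h)) (at x)) \<and> continuous_on UNIV g"

lemma C1_with_grad_continuous: "C1_with_grad \<psi> g \<Longrightarrow> continuous_on UNIV \<psi>"
  unfolding C1_with_grad_def using has_derivative_continuous
  by (fastforce simp: continuous_on_eq_continuous_within)

lemma C1_with_grad_eq_0:
  assumes "C1_with_grad \<psi> g" "open U" "x \<in> U" "\<And>y. y \<in> U \<Longrightarrow> \<psi> y = 0"
  shows "g x = 0"
proof -
  have "((\<lambda>_. 0) has_derivative (\<lambda>_. 0)) (at x)" by simp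
  then have "(\<psi> has_derivative (\<lambda>_. 0)) (at x)"
    by (rule has_derivative_transform_within_open[OF _ assms(2,3)]) (simp add: assms(4))
  moreover have "(\<psi> has_derivative (\<lambda>h. g x \<bullet> h)) (at x)"
    using assms(1) by (simp add: C1_with_grad_def)
  ultimately have "(\<lambda>h. g x \<bullet> h) = (\<lambda>_. 0)" by (rule has_derivative_unique[symmetric])
  from fun_cong[OF this, of "g x"] show ?thesis by simp
qed

lemma C1_with_grad_support:
  assumes "C1_with_grad \<psi> g" "compact K" "\<And>y. y \<notin> K \<Longrightarrow> \<psi> y = 0" "x \<notin> K"
  shows "g x = 0"
  using C1_with_grad_eq_0[of \<psi> g "- K" x] assms by (simp add: compact_imp_closed open_Compl)

lemma C1_with_grad_const: "C1_with_grad (\<lambda>_. c) (\<lambda>_. 0)"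
  by (simp add: C1_with_grad_def)

lemma C1_with_grad_mult:
  assumes "C1_with_grad \<psi> g" "C1_with_grad \<phi> h"
  shows "C1_with_grad (\<lambda>x. \<psi> x * \<phi> x) (\<lambda>x. \<psi> x *\<^sub>R h x + \<phi> x *\<^sub>R g x)"
proof -
  have "((\<lambda>x. \<psi> x * \<phi> x) has_derivative (\<lambda>k. (\<psi> x *\<^sub>R h x + \<phi> x *\<^sub>R g x) \<bullet> k)) (at x)" for x
  proof -
    have "(\<psi> has_derivative (\<lambda>k. g x \<bullet> k)) (at x)" "(\<phi> has_derivative (\<lambda>k. h x \<bullet> k)) (at x)"
      using assms by (simp_all add: C1_with_grad_def)
    from has_derivative_mult[OF this] show ?thesis
      by (rule has_derivative_eq_rhs) (simp add: fun_eq_iff inner_add_left mult.commute)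
  qed
  moreover have "continuous_on UNIV (\<lambda>x. \<psi> x *\<^sub>R h x + \<phi> x *\<^sub>R g x)"
    using assms C1_with_grad_continuous[OF assms(1)] C1_with_grad_continuous[OF assms(2)]
    by (intro continuous_intros) (auto simp: C1_with_grad_def)
  ultimately show ?thesis by (simp add: C1_with_grad_def)
qed

lemma C1_with_grad_compose:
  assumes \<psi>: "C1_with_grad \<psi> g" and f: "\<And>s. (f has_real_derivative f' s) (at s)" and f': "continuous_on UNIV f'"
  shows "C1_with_grad (\<lambda>x. f (\<psi> x)) (\<lambda>x. f' (\<psi> x) *\<^sub>R g x)"
proof -
  have "((\<lambda>x. f (\<psi> x)) has_derivative (\<lambda>k. (f' (\<psi> x) *\<^sub>R g x) \<bullet> k)) (at x)" for x
  proof -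
    have 1: "(\<psi> has_derivative (\<lambda>k. g x \<bullet> k)) (at x)"
      using \<psi> by (simp add: C1_with_grad_def)
    have 2: "(f has_derivative (\<lambda>k. f' (\<psi> x) * k)) (at (\<psi> x))"
      using f[of "\<psi> x"] by (simp add: has_field_derivative_def)
    from has_derivative_compose[OF 1 2] show ?thesis by simp
  qed
  moreover have "continuous_on UNIV (\<lambda>x. f' (\<psi> x) *\<^sub>R g x)"
    using \<psi> C1_with_grad_continuous[OF \<psi>] continuous_on_compose2[OF f', of UNIV \<psi>]
    by (intro continuous_intros) (auto simp: C1_with_grad_def)
  ultimately show ?thesis by (simp add: C1_with_grad_def)
qed

text \<open>The distributional identity div F = H. The test functions are C^1 rather than smooth
  because the cutoffs to be inserted are functions of \<open>height\<close>, which inherits the C^1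
  regularity of the boundary.\<close>

definition weak_divergence :: "'a::euclidean_space set \<Rightarrow> ('a \<Rightarrow> 'a) \<Rightarrow> ('a \<Rightarrow> real) \<Rightarrow> bool" where
  "weak_divergence D F H \<longleftrightarrow> (\<forall>\<psi> g K. C1_with_grad \<psi> g \<longrightarrow> compact K \<longrightarrow> K \<subseteq> D \<longrightarrow>
     (\<forall>x. x \<notin> K \<longrightarrow> \<psi> x = 0) \<longrightarrow> (LINT x:D|lborel. \<psi> x * H x + F x \<bullet> g x) = 0)"

text \<open>Stated for one test function at a time, not vanishing at the boundary in general, so
  that localized versions can be added up.\<close>

definition gauss_green ::
  "(real^'d) set \<Rightarrow> (real^'d) measure \<Rightarrow> (real^'d \<Rightarrow> real^'d) \<Rightarrow> (real^'d \<Rightarrow> real) \<Rightarrow>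
   (real^'d \<Rightarrow> real) \<Rightarrow> (real^'d \<Rightarrow> real^'d) \<Rightarrow> bool" where
  "gauss_green D \<sigma> F H \<psi> g \<longleftrightarrow> (LINT x:D|lborel. \<psi> x * H x + F x \<bullet> g x) =
     (LINT x:frontier D|\<sigma>. \<psi> x * (F x \<bullet> outward_normal D x))"

lemma set_integrable_continuous:
  fixes f :: "'a::euclidean_space \<Rightarrow> real"
  assumes "continuous_on (closure D) f" "bounded D" "D \<in> sets borel"
  shows "set_integrable lborel D f"
proof -
  have "set_integrable lborel (closure D) f"
    unfolding set_integrable_def using assms by (intro borel_integrable_compact) auto
  then show ?thesis by (rule set_integrable_subset) (use assms closure_subset in auto)
qed

lemma set_integrable_test:
  fixes H :: "'a::euclidean_space \<Rightarrow> real"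
  assumes D: "bounded D" "D \<in> sets borel" and H: "set_integrable lborel D H"
    and F: "continuous_on (closure D) F" and \<psi>: "C1_with_grad \<psi> g"
  shows "set_integrable lborel D (\<lambda>x. \<psi> x * H x + F x \<bullet> g x)"
proof (rule set_integral_add(1))
  have c: "continuous_on (closure D) \<psi>"
    using C1_with_grad_continuous[OF \<psi>] by (rule continuous_on_subset) simp
  moreover have "compact (closure D)" using D by simp
  ultimately obtain B where B: "\<And>x. x \<in> closure D \<Longrightarrow> \<bar>\<psi> x\<bar> \<le> B"
    using compact_continuous_bound[of "closure D" \<psi>] by auto
  have [measurable]: "\<psi> \<in> borel_measurable borel"
    by (rule borel_measurable_continuous_onI[OF C1_with_grad_continuous[OF \<psi>]])
  have Hm: "(\<lambda>x. indicator D x *\<^sub>R H x) \<in> borel_measurable lborel"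
    using H unfolding set_integrable_def by (rule borel_measurable_integrable)
  show "set_integrable lborel D (\<lambda>x. \<psi> x * H x)"
  proof (rule set_integrable_bound[where f="\<lambda>x. B * H x"])
    show "set_integrable lborel D (\<lambda>x. B * H x)" using H by simp
    have "(\<lambda>x. \<psi> x * (indicator D x *\<^sub>R H x)) \<in> borel_measurable lborel" using Hm by measurable
    then show "set_borel_measurable lborel D (\<lambda>x. \<psi> x * H x)"
      unfolding set_borel_measurable_def by (simp add: mult.left_commute)
    show "AE x in lborel. x \<in> D \<longrightarrow> norm (\<psi> x * H x) \<le> norm (B * H x)"
    proof (intro AE_I2 impI)
      fix x assume "x \<in> D"
      then have "\<bar>\<psi> x\<bar> \<le> \<bar>B\<bar>" using B[of x] closure_subset[of D] by force
      then show "norm (\<psi> x * H x) \<le> norm (B * H x)" by (simp add: abs_mult mult_right_mono)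
    qed
  qed
  show "set_integrable lborel D (\<lambda>x. F x \<bullet> g x)"
  proof (rule set_integrable_continuous[OF _ D])
    have "continuous_on (closure D) g"
      using \<psi> unfolding C1_with_grad_def by (blast intro: continuous_on_subset)
    then show "continuous_on (closure D) (\<lambda>x. F x \<bullet> g x)" by (intro continuous_intros F)
  qed
qed

section \<open>The Gauss--Green formula for test functions supported in one chart\<close>

context boundary_chart
begin

text \<open>The products of \<open>\<psi>\<close> with \<open>\<eta> n\<close> have compact support
  in \<open>D\<close> and are admissible. As n grows they tend to \<open>\<psi>\<close> on
  \<open>D\<close>, while the gradient of the cutoff lives in a collapsing layer and produces, by
  \<open>layer_limit\<close>, the integral of \<open>\<psi> x * (F x \<bullet> conormal x)\<close>
  over the graph. The two limits add up to zero.\<close>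

lemma chart_gauss_green:
  assumes \<sigma>: "is_surface_measure D \<sigma>" and D: "bounded D" "C1_boundary D"
    and F: "continuous_on UNIV F" and H: "set_integrable lborel D H" and div: "weak_divergence D F H"
    and \<psi>: "C1_with_grad \<psi> g" and K: "compact K" "K \<subseteq> ball x0 r" and supp: "\<And>x. x \<notin> K \<Longrightarrow> \<psi> x = 0"
  shows "gauss_green D \<sigma> F H \<psi> g"
proof -
  have D_borel[measurable]: "D \<in> sets borel" using open_D by simp
  define k where "k n = real (Suc n)" for n
  have k: "1 \<le> k n" for n by (simp add: k_def)
  define \<eta> where "\<eta> n x = ramp (k n * height x)" for n x
  define h where "h x = \<psi> x * (F x \<bullet> conormal x)" for x
  define Q where "Q x = \<psi> x * H x + F x \<bullet> g x" for x
  let ?Q = "\<lambda>x. indicator D x *\<^sub>R Q x" and ?\<delta> = "\<lambda>n x. k n * ramp' (k n * height x)"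
  have C1_height: "C1_with_grad height conormal"
    using height_derivative continuous_conormal by (simp add: C1_with_grad_def)
  have C1_\<eta>: "C1_with_grad (\<eta> n) (\<lambda>x. ?\<delta> n x *\<^sub>R conormal x)" for n
  proof -
    have "((\<lambda>s. ramp (k n * s)) has_real_derivative k n * ramp' (k n * s)) (at s)" for s
      by (rule DERIV_cong[OF DERIV_chain2[OF ramp_deriv DERIV_cmult[OF DERIV_ident]]]) simp
    moreover have "continuous_on UNIV (\<lambda>s. k n * ramp' (k n * s))"
      using continuous_on_compose2[OF continuous_ramp', of UNIV "\<lambda>s. k n * s"]
      by (intro continuous_intros) (auto intro!: continuous_intros)
    ultimately show ?thesis unfolding \<eta>_def by (rule C1_with_grad_compose[OF C1_height])
  qed
  have cont_\<psi>: "continuous_on UNIV \<psi>" by (rule C1_with_grad_continuous[OF \<psi>])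
  have cont_h: "continuous_on UNIV h"
    unfolding h_def[abs_def] by (intro continuous_intros cont_\<psi> F continuous_conormal)
  have supp_h: "h x = 0" if "x \<notin> K" for x using supp[OF that] by (simp add: h_def)
  have bounded_K: "bounded K" using K(1) by (rule compact_imp_bounded)
  have Q_int: "set_integrable lborel D Q"
    unfolding Q_def[abs_def]
    by (rule set_integrable_test[OF D(1) D_borel H _ \<psi>]) (use F continuous_on_subset in blast)
  have Q_meas: "?Q \<in> borel_measurable lborel"
    using Q_int unfolding set_integrable_def by (rule borel_measurable_integrable)
  \<comment> \<open>The layer term vanishes outside \<open>D\<close>, so its integral over
    \<open>D\<close> is one over the whole space, the form in which the layer limit is
    available.\<close>
  have supp_ramp': "ramp' (k n * height x) = 0" if "x \<in> K" "x \<notin> D" for n x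
  proof -
    have "height x \<le> 0" using D_ball[of x] K that by auto
    then have "k n * height x \<le> 0" using k[of n] by (simp add: mult_nonneg_nonpos)
    then show ?thesis by (intro ramp'_eq_0) auto
  qed
  have \<eta>_meas[measurable]: "\<eta> n \<in> borel_measurable borel" for n
    by (rule borel_measurable_continuous_onI[OF C1_with_grad_continuous[OF C1_\<eta>]])
  have int_\<eta>Q: "integrable lborel (\<lambda>x. \<eta> n x * ?Q x)" for n
  proof (rule Bochner_Integration.integrable_bound[OF Q_int[unfolded set_integrable_def]])
    show "(\<lambda>x. \<eta> n x * ?Q x) \<in> borel_measurable lborel" using Q_meas by measurable
    show "AE x in lborel. norm (\<eta> n x * ?Q x) \<le> norm (?Q x)"
      by (intro AE_I2) (simp add: \<eta>_def abs_mult ramp_bounds mult_left_le_one_le)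
  qed
  have int_h: "integrable lborel (\<lambda>x. h x * ?\<delta> n x)" for n
  proof -
    have c: "continuous_on UNIV (\<lambda>x. h x * ?\<delta> n x)"
      by (intro continuous_intros cont_h continuous_on_compose2[OF continuous_ramp'] continuous_height) auto
    obtain B where "\<And>x. norm (h x * ?\<delta> n x) \<le> B"
      using continuous_compact_support_bounded[OF c bounded_K] supp_h by (metis mult_zero_left)
    then show ?thesis
      using supp_h by (intro integrable_bounded_support[OF borel_measurable_continuous_onI[OF c] bounded_K]) auto
  qed
  have split: "(\<integral>x. \<eta> n x * ?Q x \<partial>lborel) + (\<integral>x. h x * ?\<delta> n x \<partial>lborel) = 0" for n
  proof -
    let ?g = "\<lambda>x. \<psi> x *\<^sub>R (?\<delta> n x *\<^sub>R conormal x) + \<eta> n x *\<^sub>R g x"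
    have C1: "C1_with_grad (\<lambda>x. \<psi> x * \<eta> n x) ?g" by (rule C1_with_grad_mult[OF \<psi> C1_\<eta>])
    \<comment> \<open>The cutoff vanishes where \<open>k n * height x < 1\<close>, so what remains
      is closed, lies in \<open>K\<close>, and has positive height.\<close>
    let ?K = "K \<inter> {x. 1 \<le> k n * height x}"
    have "closed {x. 1 \<le> k n * height x}"
      by (intro closed_Collect_le continuous_intros continuous_height)
    with K(1) have "compact ?K" by (rule compact_Int_closed)
    moreover have "?K \<subseteq> D"
    proof
      fix x assume "x \<in> ?K"
      then have "x \<in> ball x0 r" "0 < k n * height x" using K(2) by auto
      then show "x \<in> D" using D_ball[of x] k[of n] by (simp add: zero_less_mult_iff)
    qed
    moreover have "\<forall>x. x \<notin> ?K \<longrightarrow> \<psi> x * \<eta> n x = 0"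
      using supp ramp_eq_0 by (auto simp: \<eta>_def not_le)
    ultimately have "(LINT x:D|lborel. (\<psi> x * \<eta> n x) * H x + F x \<bullet> ?g x) = 0"
      using div C1 unfolding weak_divergence_def by blast
    moreover have "indicator D x *\<^sub>R ((\<psi> x * \<eta> n x) * H x + F x \<bullet> ?g x) =
        \<eta> n x * ?Q x + h x * ?\<delta> n x" for x
    proof (cases "x \<in> D")
      case True
      then show ?thesis by (simp add: Q_def h_def inner_add_right algebra_simps)
    next
      case False
      then show ?thesis using supp_ramp'[of x n] supp_h[of x] by (cases "x \<in> K") auto
    qed
    ultimately have "(\<integral>x. \<eta> n x * ?Q x + h x * ?\<delta> n x \<partial>lborel) = 0"
      by (simp only: set_lebesgue_integral_def)
    then show ?thesis using int_\<eta>Q int_h by simp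
  qed
  have lim1: "(\<lambda>n. \<integral>x. \<eta> n x * ?Q x \<partial>lborel) \<longlonglongrightarrow> (\<integral>x. ?Q x \<partial>lborel)"
  proof (rule integral_dominated_convergence[where M=lborel and w="\<lambda>x. norm (?Q x)"
        and f="?Q" and s="\<lambda>n x. \<eta> n x * ?Q x"])
    show "integrable lborel (\<lambda>x. norm (?Q x))"
      using Q_int unfolding set_integrable_def by (rule integrable_norm)
    show "AE x in lborel. norm (\<eta> n x * ?Q x) \<le> norm (?Q x)" for n
      by (intro AE_I2) (simp add: \<eta>_def abs_mult ramp_bounds mult_left_le_one_le)
    show "?Q \<in> borel_measurable lborel" by (rule Q_meas)
    show "(\<lambda>x. \<eta> n x * ?Q x) \<in> borel_measurable lborel" for n
      by (rule borel_measurable_integrable[OF int_\<eta>Q])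
    show "AE x in lborel. (\<lambda>n. \<eta> n x * ?Q x) \<longlonglongrightarrow> ?Q x"
    proof (rule AE_I2)
      fix x
      show "(\<lambda>n. \<eta> n x * ?Q x) \<longlonglongrightarrow> ?Q x"
      proof (cases "x \<in> D \<inter> K")
        case True
        \<comment> \<open>An interior point has positive height, so the cutoff equals 1 there as
          soon as \<open>k n\<close> exceeds \<open>2 / height x\<close>.\<close>
        then have pos: "0 < height x" using D_ball[of x] K(2) by auto
        have "\<forall>\<^sub>F n in sequentially. 2 / height x \<le> real n"
          using filterlim_real_sequentially by (simp add: filterlim_at_top)
        then have "\<forall>\<^sub>F n in sequentially. ?Q x = \<eta> n x * ?Q x"
        proof eventually_elim
          case (elim n)
          then have "2 \<le> k n * height x" using pos by (simp add: k_def field_simps)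
          then show ?case by (simp add: \<eta>_def ramp_eq_1)
        qed
        then show ?thesis by (rule tendsto_eventually[OF eventually_mono]) simp
      next
        case False
        have "?Q x = 0"
        proof (cases "x \<in> D")
          case True
          then have "x \<notin> K" using False by simp
          then show ?thesis using supp C1_with_grad_support[OF \<psi> K(1) supp] by (simp add: Q_def)
        qed simp
        then show ?thesis by (simp only: mult_zero_right tendsto_const)
      qed
    qed
  qed
  have lim2: "(\<lambda>n. \<integral>x. h x * ?\<delta> n x \<partial>lborel) \<longlonglongrightarrow>
      (\<integral>y. indicator {0<..<1} (y \<bullet> e) * h (to_graph y) \<partial>lborel)"
    using layer_limit[OF norm_e cont_h bounded_K supp_h continuous_\<gamma> \<gamma>_inv]
    by (simp add: k_def height_def to_graph_def)
  have "(\<integral>x. ?Q x \<partial>lborel) + (\<integral>y. indicator {0<..<1} (y \<bullet> e) * h (to_graph y) \<partial>lborel) = 0"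
    using tendsto_add[OF lim1 lim2] unfolding split by (simp add: LIMSEQ_const_iff)
  moreover have "(\<integral>x. indicator (frontier D) x *\<^sub>R (\<psi> x * (F x \<bullet> outward_normal D x)) \<partial>\<sigma>) =
      - (\<integral>y. indicator {0<..<1} (y \<bullet> e) * h (to_graph y) \<partial>lborel)"
  proof -
    let ?q = "\<lambda>x. indicator (frontier D) x *\<^sub>R (\<psi> x * (F x \<bullet> outward_normal D x))"
    have "continuous_on (frontier D) (\<lambda>x. \<psi> x * (F x \<bullet> outward_normal D x))"
      using cont_\<psi> F by (intro continuous_intros continuous_outward_normal[OF open_D D(2)])
        (auto intro: continuous_on_subset)
    then have m: "?q \<in> borel_measurable borel"
      by (intro borel_measurable_continuous_on_indicator) auto
    have "?q x = 0" if "x \<notin> frontier D \<inter> ball x0 r" for x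
      using that supp[of x] subsetD[OF K(2), of x] by (auto simp: indicator_def)
    from surface_integral[OF \<sigma> m this]
    have "(\<integral>x. ?q x \<partial>\<sigma>) = (\<integral>y. indicator {0<..<1} (y \<bullet> e) * (?q (to_graph y) * norm (conormal y)) \<partial>lborel)" .
    also have "\<dots> = (\<integral>y. - (indicator {0<..<1} (y \<bullet> e) * h (to_graph y)) \<partial>lborel)"
    proof (rule Bochner_Integration.integral_cong[OF refl])
      fix y
      \<comment> \<open>The area density cancels the normalization of the normal; the sign changes
        because the conormal points inwards.\<close>
      have "?q (to_graph y) * norm (conormal y) = - h (to_graph y)"
      proof (cases "to_graph y \<in> ball x0 r")
        case True
        then have f: "to_graph y \<in> frontier D" using frontier_iff height_to_graph by simp
        show ?thesis
          using f conormal_nonzero[of y]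
          by (simp add: outward_normal_eq[OF True f] conormal_to_graph h_def)
      next
        case False
        then have "\<psi> (to_graph y) = 0" using supp[of "to_graph y"] K(2) by blast
        then show ?thesis by (simp add: h_def)
      qed
      then show "indicator {0<..<1} (y \<bullet> e) * (?q (to_graph y) * norm (conormal y)) =
          - (indicator {0<..<1} (y \<bullet> e) * h (to_graph y))" by simp
    qed
    finally show ?thesis by simp
  qed
  ultimately show ?thesis
    by (simp add: gauss_green_def set_lebesgue_integral_def Q_def)
qed

text \<open>The squared distance is differentiable at the centre too. With the factor
  \<open>4 / r\<^sup>2\<close> the argument is 1 at distance r / 2, where the ramp starts, and 9/4
  at distance 3 r / 4, beyond its end at 2.\<close>

definition bump :: "real^'d \<Rightarrow> real" where
  "bump x = 1 - ramp (4 / r\<^sup>2 * ((x - x0) \<bullet> (x - x0)))"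

lemma bump_C1: "\<exists>G. C1_with_grad bump G"
proof -
  have 1: "C1_with_grad (\<lambda>x. 4 / r\<^sup>2 * ((x - x0) \<bullet> (x - x0))) (\<lambda>x. (8 / r\<^sup>2) *\<^sub>R (x - x0))"
    unfolding C1_with_grad_def
  proof
    show "\<forall>x. ((\<lambda>x. 4 / r\<^sup>2 * ((x - x0) \<bullet> (x - x0))) has_derivative (\<lambda>h. ((8 / r\<^sup>2) *\<^sub>R (x - x0)) \<bullet> h)) (at x)"
    proof
      fix x
      have "((\<lambda>x. (x - x0) \<bullet> (x - x0)) has_derivative (\<lambda>h. (x - x0) \<bullet> h + h \<bullet> (x - x0))) (at x)"
        by (rule has_derivative_inner) (auto intro!: derivative_eq_intros)
      from has_derivative_mult_right[OF this, of "4 / r\<^sup>2"]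
      show "((\<lambda>x. 4 / r\<^sup>2 * ((x - x0) \<bullet> (x - x0))) has_derivative (\<lambda>h. ((8 / r\<^sup>2) *\<^sub>R (x - x0)) \<bullet> h)) (at x)"
        by (rule has_derivative_eq_rhs) (simp add: fun_eq_iff inner_commute)
    qed
  qed (intro continuous_intros)
  have 2: "((\<lambda>s. 1 - ramp s) has_real_derivative - ramp' s) (at s)" for s
    using DERIV_diff[OF DERIV_const ramp_deriv] by simp
  have 3: "continuous_on UNIV (\<lambda>s. - ramp' s)" by (intro continuous_intros continuous_ramp')
  show ?thesis
    using C1_with_grad_compose[OF 1 2 3] unfolding bump_def[abs_def] by blast
qed

lemma bump_eq_1:
  assumes "x \<in> ball x0 (r / 2)"
  shows "bump x = 1"
proof -
  have "norm (x - x0) \<le> r / 2" using assms by (simp add: dist_norm norm_minus_commute)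
  then have "(norm (x - x0))\<^sup>2 \<le> (r / 2)\<^sup>2" by (rule power_mono) simp
  then have "4 / r\<^sup>2 * ((x - x0) \<bullet> (x - x0)) \<le> 1"
    using r_pos by (simp add: dot_square_norm power_divide field_simps)
  then show ?thesis by (simp add: bump_def ramp_eq_0)
qed

lemma bump_eq_0:
  assumes "x \<notin> cball x0 (3 * r / 4)"
  shows "bump x = 0"
proof -
  have "3 * r / 4 \<le> norm (x - x0)" using assms by (simp add: dist_norm norm_minus_commute)
  then have "(3 * r / 4)\<^sup>2 \<le> (norm (x - x0))\<^sup>2" using r_pos by (intro power_mono) auto
  then have "9 * r\<^sup>2 \<le> 16 * ((x - x0) \<bullet> (x - x0))"
    by (simp add: dot_square_norm power_divide power_mult_distrib)
  then have "2 * r\<^sup>2 \<le> 4 * ((x - x0) \<bullet> (x - x0))"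
    using r_pos zero_le_power2[of r] by linarith
  then have "2 \<le> 4 / r\<^sup>2 * ((x - x0) \<bullet> (x - x0))"
    using r_pos by (simp add: field_simps)
  then show ?thesis by (simp add: bump_def ramp_eq_1)
qed

end

section \<open>From charts to the whole domain\<close>

lemma set_integrable_frontier:
  fixes q :: "real^'d \<Rightarrow> real"
  assumes D: "open D" "bounded D" "C1_boundary D" and \<sigma>: "is_surface_measure D \<sigma>"
    and q: "continuous_on (frontier D) q"
  shows "set_integrable \<sigma> (frontier D) q"
proof -
  have sets: "sets \<sigma> = sets borel" using \<sigma> by (simp add: is_surface_measure_def)
  obtain B where B: "\<And>x. x \<in> frontier D \<Longrightarrow> \<bar>q x\<bar> \<le> B"
    using compact_continuous_bound[OF compact_frontier_bounded[OF D(2)] q] by auto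
  have "(\<lambda>x. indicator (frontier D) x *\<^sub>R q x) \<in> borel_measurable borel"
    using q by (intro borel_measurable_continuous_on_indicator) auto
  then have m: "(\<lambda>x. indicator (frontier D) x *\<^sub>R q x) \<in> borel_measurable \<sigma>"
    using measurable_cong_sets[OF sets refl] by blast
  show ?thesis
    unfolding set_integrable_def
  proof (rule integrableI_bounded_set[where A="frontier D" and B=B])
    show "frontier D \<in> sets \<sigma>" by (simp add: sets)
    show "emeasure \<sigma> (frontier D) < \<infinity>" by (rule finite_surface[OF D \<sigma>])
    show "AE x in \<sigma>. x \<in> frontier D \<longrightarrow> norm (indicator (frontier D) x *\<^sub>R q x) \<le> B"
      using B by (intro AE_I2) auto
  qed (use m in auto)
qed

lemma gauss_green_add:
  assumes D: "open D" "bounded D" "C1_boundary D" and \<sigma>: "is_surface_measure D \<sigma>"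
    and F: "continuous_on (closure D) F" and H: "set_integrable lborel D H"
    and \<psi>: "C1_with_grad \<psi> g" "gauss_green D \<sigma> F H \<psi> g"
    and \<phi>: "C1_with_grad \<phi> h" "gauss_green D \<sigma> F H \<phi> h"
  shows "gauss_green D \<sigma> F H (\<lambda>x. \<psi> x + \<phi> x) (\<lambda>x. g x + h x)"
proof -
  have D_borel: "D \<in> sets borel" using D by simp
  have bd: "set_integrable \<sigma> (frontier D) (\<lambda>x. f x * (F x \<bullet> outward_normal D x))"
    if "continuous_on UNIV f" for f
  proof (rule set_integrable_frontier[OF D \<sigma>])
    have "continuous_on (frontier D) F" using F by (rule continuous_on_subset) (simp add: frontier_def)
    moreover have "continuous_on (frontier D) f" using that by (rule continuous_on_subset) simp
    ultimately show "continuous_on (frontier D) (\<lambda>x. f x * (F x \<bullet> outward_normal D x))"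
      by (intro continuous_intros continuous_outward_normal D)
  qed
  have "(LINT x:D|lborel. (\<psi> x + \<phi> x) * H x + F x \<bullet> (g x + h x)) =
      (LINT x:D|lborel. (\<psi> x * H x + F x \<bullet> g x) + (\<phi> x * H x + F x \<bullet> h x))"
    by (simp add: algebra_simps inner_add_right)
  also have "\<dots> = (LINT x:D|lborel. \<psi> x * H x + F x \<bullet> g x) + (LINT x:D|lborel. \<phi> x * H x + F x \<bullet> h x)"
    by (intro set_integral_add(2) set_integrable_test[OF D(2) D_borel H F] \<psi> \<phi>)
  also have "\<dots> = (LINT x:frontier D|\<sigma>. \<psi> x * (F x \<bullet> outward_normal D x)) +
      (LINT x:frontier D|\<sigma>. \<phi> x * (F x \<bullet> outward_normal D x))"
    using \<psi> \<phi> by (simp add: gauss_green_def)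
  also have "\<dots> = (LINT x:frontier D|\<sigma>. \<psi> x * (F x \<bullet> outward_normal D x) + \<phi> x * (F x \<bullet> outward_normal D x))"
    by (intro set_integral_add(2)[symmetric] bd C1_with_grad_continuous[OF \<psi>(1)] C1_with_grad_continuous[OF \<phi>(1)])
  also have "\<dots> = (LINT x:frontier D|\<sigma>. (\<psi> x + \<phi> x) * (F x \<bullet> outward_normal D x))"
    by (simp add: distrib_right)
  finally show ?thesis by (simp add: gauss_green_def)
qed

text \<open>A test function that vanishes near the boundary becomes admissible in the weak divergence once it
  is set to zero outside \<open>D\<close>.\<close>

lemma gauss_green_interior:
  assumes D: "open D" "bounded D" and div: "weak_divergence D F H"
    and \<psi>: "C1_with_grad \<psi> g" and U: "open U" "frontier D \<subseteq> U" "\<And>x. x \<in> U \<Longrightarrow> \<psi> x = 0"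
  shows "gauss_green D \<sigma> F H \<psi> g"
proof -
  define \<psi>0 where "\<psi>0 x = (if x \<in> D then \<psi> x else 0)" for x
  define g0 where "g0 x = (if x \<in> D then g x else 0)" for x
  \<comment> \<open>\<open>D\<close> and \<open>W\<close> are open and cover the space. On
    \<open>D\<close> the modified function agrees with \<open>\<psi>\<close>, on \<open>W\<close> it
    is zero, and both descriptions are C^1.\<close>
  define W where "W = U \<union> - closure D"
  have W: "open W" unfolding W_def using U by (intro open_Un) auto
  have DW: "D \<union> W = UNIV"
    using U(2) D(1) by (auto simp: W_def frontier_def interior_open)
  have \<psi>0W: "\<psi>0 x = 0" if "x \<in> W" for x
    using that U(3) closure_subset[of D] by (auto simp: W_def \<psi>0_def)
  have gU: "g x = 0" if "x \<in> U" for x using C1_with_grad_eq_0[OF \<psi> U(1) that U(3)] .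
  have g0W: "g0 x = 0" if "x \<in> W" for x
    using that gU closure_subset[of D] by (auto simp: W_def g0_def)
  have "(\<psi>0 has_derivative (\<lambda>h. g0 x \<bullet> h)) (at x)" for x
  proof (cases "x \<in> D")
    case True
    have "(\<psi> has_derivative (\<lambda>h. g0 x \<bullet> h)) (at x)"
      using \<psi> True by (simp add: C1_with_grad_def g0_def)
    then show ?thesis
      by (rule has_derivative_transform_within_open[OF _ D(1) True]) (simp add: \<psi>0_def)
  next
    case False
    then have x: "x \<in> W" using DW by blast
    have "((\<lambda>_. 0) has_derivative (\<lambda>h. g0 x \<bullet> h)) (at x)" by (simp add: g0W[OF x])
    then show ?thesis
      by (rule has_derivative_transform_within_open[OF _ W x]) (simp add: \<psi>0W)
  qed
  moreover have "continuous_on UNIV g0"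
  proof -
    have "continuous_on D g" using \<psi> unfolding C1_with_grad_def by (blast intro: continuous_on_subset)
    then have "continuous_on D g0" by (rule continuous_on_eq) (simp add: g0_def)
    moreover have "continuous_on W g0"
      using continuous_on_const[of W 0] by (rule continuous_on_eq) (simp add: g0W)
    ultimately have "continuous_on (D \<union> W) g0" using D(1) W by (intro continuous_on_open_Un)
    then show ?thesis by (simp add: DW)
  qed
  ultimately have C1: "C1_with_grad \<psi>0 g0" by (simp add: C1_with_grad_def)
  let ?K = "closure D - U"
  have "compact ?K" using D U by (intro compact_diff) auto
  moreover have "?K \<subseteq> D" using U(2) D(1) by (auto simp: frontier_def interior_open)
  moreover have "\<forall>x. x \<notin> ?K \<longrightarrow> \<psi>0 x = 0"
    using U(3) closure_subset[of D] by (auto simp: \<psi>0_def)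
  ultimately have "(LINT x:D|lborel. \<psi>0 x * H x + F x \<bullet> g0 x) = 0"
    using div C1 unfolding weak_divergence_def by blast
  moreover have "(LINT x:D|lborel. \<psi>0 x * H x + F x \<bullet> g0 x) = (LINT x:D|lborel. \<psi> x * H x + F x \<bullet> g x)"
    unfolding set_lebesgue_integral_def
    by (intro Bochner_Integration.integral_cong[OF refl]) (auto simp: \<psi>0_def g0_def indicator_def)
  moreover have "(LINT x:frontier D|\<sigma>. \<psi> x * (F x \<bullet> outward_normal D x)) = (LINT x:frontier D|\<sigma>. 0)"
    unfolding set_lebesgue_integral_def
    using U by (intro Bochner_Integration.integral_cong[OF refl]) (auto simp: indicator_def)
  ultimately show ?thesis by (simp add: gauss_green_def)
qed

text \<open>An induction replaces the partition of unity. \<open>P S\<close> asserts the formula for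
  test functions that vanish on the half-size balls around the points of \<open>S\<close>. For a
  finite set of centres whose balls cover the boundary this is the interior case; a centre is
  released by splitting \<open>\<psi>\<close> with its \<open>bump\<close>. With no centre left, the
  test function 1 gives the theorem.\<close>

theorem divergence_theorem_weak:
  fixes D :: "(real^'d) set"
  assumes D: "open D" "bounded D" "C1_boundary D" and \<sigma>: "is_surface_measure D \<sigma>"
    and F: "continuous_on (closure D) F" and H: "set_integrable lborel D H"
    and div: "weak_divergence D F H"
  shows "(LINT x:D|lborel. H x) = (LINT x:frontier D|\<sigma>. F x \<bullet> outward_normal D x)"
proof -
  have "compact (closure D)" using D by simp
  then obtain B where B: "0 \<le> B" "\<And>x. x \<in> closure D \<Longrightarrow> norm (F x) \<le> B"
    using F by (rule compact_continuous_bound) blast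
  \<comment> \<open>A continuous extension to the whole space is chosen because the layer limit
    integrates over the whole space; only the values on the closure matter for the result.\<close>
  have "\<exists>G. continuous_on UNIV G \<and> (\<forall>x\<in>closure D. G x = F x)"
  proof (rule Tietze[OF F, of UNIV B])
    show "norm (F x) \<le> B" if "x \<in> closure D" for x by (rule B(2)[OF that])
  qed (use B(1) in auto)
  then obtain G where G: "continuous_on UNIV G" "\<And>x. x \<in> closure D \<Longrightarrow> G x = F x" by blast
  have divG: "weak_divergence D G H"
  proof -
    have "(LINT x:D|lborel. \<psi> x * H x + G x \<bullet> g x) = (LINT x:D|lborel. \<psi> x * H x + F x \<bullet> g x)" for \<psi> g
      unfolding set_lebesgue_integral_def
      using G(2) closure_subset[of D] by (intro Bochner_Integration.integral_cong[OF refl]) (auto simp: indicator_def subset_iff)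
    then show ?thesis using div unfolding weak_divergence_def by simp
  qed
  have G': "continuous_on (closure D) G" using G(1) by (rule continuous_on_subset) simp
  have "\<forall>x\<in>frontier D. \<exists>r e \<gamma>. graph_chart D x r e \<gamma>" using D(3) by (simp add: C1_boundary_def)
  then obtain r e \<gamma> where charts: "\<And>x. x \<in> frontier D \<Longrightarrow> graph_chart D x (r x) (e x) (\<gamma> x)" by metis
  have "compact (frontier D)" using D by (intro compact_frontier_bounded)
  moreover have "\<And>x. x \<in> frontier D \<Longrightarrow> open (ball x (r x / 2))" by simp
  moreover have "frontier D \<subseteq> (\<Union>x\<in>frontier D. ball x (r x / 2))"
    using charts by (auto simp: graph_chart_def)
  ultimately obtain C where C: "C \<subseteq> frontier D" "finite C" "frontier D \<subseteq> (\<Union>x\<in>C. ball x (r x / 2))"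
    by (rule compactE_image)
  define P where "P S \<longleftrightarrow> (\<forall>\<psi> g. C1_with_grad \<psi> g \<longrightarrow> (\<forall>x\<in>S. \<forall>y\<in>ball x (r x / 2). \<psi> y = 0) \<longrightarrow>
    gauss_green D \<sigma> G H \<psi> g)" for S
  have base: "P C"
    unfolding P_def
  proof (intro allI impI)
    fix \<psi> g assume \<psi>: "C1_with_grad \<psi> g" and 0: "\<forall>x\<in>C. \<forall>y\<in>ball x (r x / 2). \<psi> y = 0"
    show "gauss_green D \<sigma> G H \<psi> g"
      by (rule gauss_green_interior[OF D(1,2) divG \<psi> _ C(3)]) (use 0 in auto)
  qed
  have step: "P S" if x: "x \<in> C" and P: "P (insert x S)" for x S
    unfolding P_def
  proof (intro allI impI)
    fix \<psi> g assume \<psi>: "C1_with_grad \<psi> g" and 0: "\<forall>x\<in>S. \<forall>y\<in>ball x (r x / 2). \<psi> y = 0"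
    have "graph_chart D x (r x) (e x) (\<gamma> x)" using charts x C(1) by blast
    then interpret boundary_chart D x "r x" "e x" "\<gamma> x" using D(1) by unfold_locales
    obtain b where b: "C1_with_grad bump b" using bump_C1 by blast
    have b': "C1_with_grad (\<lambda>y. 1 - bump y) (\<lambda>y. - b y)"
      using b unfolding C1_with_grad_def by (auto intro!: derivative_eq_intros continuous_intros)
    let ?\<psi>1 = "\<lambda>y. \<psi> y * bump y" and ?g1 = "\<lambda>y. \<psi> y *\<^sub>R b y + bump y *\<^sub>R g y"
    let ?\<psi>2 = "\<lambda>y. \<psi> y * (1 - bump y)" and ?g2 = "\<lambda>y. \<psi> y *\<^sub>R - b y + (1 - bump y) *\<^sub>R g y"
    have C1: "C1_with_grad ?\<psi>1 ?g1" by (rule C1_with_grad_mult[OF \<psi> b])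
    have C2: "C1_with_grad ?\<psi>2 ?g2" by (rule C1_with_grad_mult[OF \<psi> b'])
    have "gauss_green D \<sigma> G H ?\<psi>1 ?g1"
      by (rule chart_gauss_green[OF \<sigma> D(2,3) G(1) H divG C1, of "cball x (3 * r x / 4)"])
         (use r_pos bump_eq_0 in auto)
    moreover have "gauss_green D \<sigma> G H ?\<psi>2 ?g2"
    proof -
      have "\<forall>z\<in>insert x S. \<forall>y\<in>ball z (r z / 2). ?\<psi>2 y = 0"
        using 0 bump_eq_1 by auto
      then show ?thesis using P C2 unfolding P_def by blast
    qed
    ultimately have "gauss_green D \<sigma> G H (\<lambda>y. ?\<psi>1 y + ?\<psi>2 y) (\<lambda>y. ?g1 y + ?g2 y)"
      using gauss_green_add[OF D \<sigma> G' H C1 _ C2] by blast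
    moreover have "(\<lambda>y. ?\<psi>1 y + ?\<psi>2 y) = \<psi>" "(\<lambda>y. ?g1 y + ?g2 y) = g"
      by (simp_all add: fun_eq_iff algebra_simps)
    ultimately show "gauss_green D \<sigma> G H \<psi> g" by simp
  qed
  \<comment> \<open>\<open>T\<close> is the set of centres already released; it grows from the empty
    set to \<open>C\<close>.\<close>
  have "P (C - T)" if "T \<subseteq> C" for T
    using finite_subset[OF that C(2)] that
  proof (induction T rule: finite_induct)
    case (insert x T)
    have "insert x (C - insert x T) = C - T" using insert by blast
    then have "P (insert x (C - insert x T))" using insert by simp
    then show ?case using step insert.prems by blast
  qed (simp add: base)
  from this[OF order_refl] have "P {}" by simp
  then have "gauss_green D \<sigma> G H (\<lambda>_. 1) (\<lambda>_. 0)"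
    using C1_with_grad_const[of 1] unfolding P_def by blast
  then have "(LINT x:D|lborel. H x) = (LINT x:frontier D|\<sigma>. G x \<bullet> outward_normal D x)"
    by (simp add: gauss_green_def)
  also have "\<dots> = (LINT x:frontier D|\<sigma>. F x \<bullet> outward_normal D x)"
    unfolding set_lebesgue_integral_def
    using G(2) by (intro Bochner_Integration.integral_cong[OF refl]) (auto simp: indicator_def frontier_def)
  finally show ?thesis .
qed

section \<open>Time integrals of continuous space-time fields\<close>

lemma time_slice_cont:
  assumes "continuous_on S k" "{x} \<times> A \<subseteq> S"
  shows "continuous_on A (\<lambda>t. k (x, t))"
  using assms(2) by (intro continuous_on_compose2[OF assms(1)]) (auto intro!: continuous_intros)

lemma continuous_time_integral:
  fixes k :: "'a::euclidean_space \<times> real \<Rightarrow> 'b::euclidean_space"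
  assumes "continuous_on (A \<times> {s..\<tau>}) k"
  shows "continuous_on A (\<lambda>x. LINT t:{s..\<tau>}|lborel. k (x, t))"
proof -
  have "continuous_on (A \<times> cbox s \<tau>) (\<lambda>(x, t). k (x, t))" using assms by simp
  then have "continuous_on A (\<lambda>x. integral (cbox s \<tau>) (\<lambda>t. k (x, t)))"
    by (rule integral_continuous_on_param)
  then show ?thesis
  proof (rule continuous_on_eq)
    fix x assume "x \<in> A"
    then have "continuous_on {s..\<tau>} (\<lambda>t. k (x, t))" by (intro time_slice_cont[OF assms]) auto
    then have "set_integrable lborel {s..\<tau>} (\<lambda>t. k (x, t))" by (rule borel_integrable_atLeastAtMost')
    from set_borel_integral_eq_integral(2)[OF this]
    show "integral (cbox s \<tau>) (\<lambda>t. k (x, t)) = (LINT t:{s..\<tau>}|lborel. k (x, t))" by simp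
  qed
qed

subsection \<open>Space-time fields of class \<open>C^1\<close>\<close>

lemma Ck_on_mono: "Ck_on k g U \<Longrightarrow> j \<le> k \<Longrightarrow> Ck_on j g U"
  unfolding Ck_on_def multi_indices_def by force

lemma Ck_on_derivative:
  assumes "Ck_on 1 g U" "z \<in> U"
  shows "(g has_derivative frechet_derivative g (at z)) (at z)"
proof -
  have "[] \<in> multi_indices 1" by (simp add: multi_indices_def)
  then have "g differentiable (at z)" using assms unfolding Ck_on_def by force
  then show ?thesis unfolding frechet_derivative_works .
qed

lemma Ck_on_continuous:
  assumes "Ck_on k g U"
  shows "continuous_on U g"
proof -
  have "[] \<in> multi_indices k" by (simp add: multi_indices_def)
  then show ?thesis using assms unfolding Ck_on_def by force
qed

text \<open>\<open>Ck_on\<close> supplies continuity of the partial derivatives along basis vectors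
  only; a direction \<open>k z\<close> that varies with the point is expanded in the basis.\<close>

lemma Ck_on_continuous_derivative:
  assumes g: "Ck_on 1 g U" and k: "continuous_on U k"
  shows "continuous_on U (\<lambda>z. frechet_derivative g (at z) (k z))"
proof -
  have "continuous_on U (\<lambda>z. frechet_derivative g (at z) b)" if "b \<in> Basis" for b
  proof -
    have "[b] \<in> multi_indices 1" using that by (simp add: multi_indices_def)
    then have "continuous_on U (iter_partial [b] g)" using g unfolding Ck_on_def by blast
    then show ?thesis by simp
  qed
  then have "continuous_on U (\<lambda>z. \<Sum>b\<in>Basis. (k z \<bullet> b) *\<^sub>R frechet_derivative g (at z) b)"
    by (intro continuous_intros k) auto
  then show ?thesis
  proof (rule continuous_on_eq)
    fix z assume "z \<in> U"
    then have lin: "linear (frechet_derivative g (at z))"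
      by (rule has_derivative_linear[OF Ck_on_derivative[OF g]])
    have "frechet_derivative g (at z) (k z) = frechet_derivative g (at z) (\<Sum>b\<in>Basis. (k z \<bullet> b) *\<^sub>R b)"
      by (simp add: euclidean_representation)
    also have "\<dots> = (\<Sum>b\<in>Basis. (k z \<bullet> b) *\<^sub>R frechet_derivative g (at z) b)"
      using lin by (simp add: linear_sum linear_scale)
    finally show "(\<Sum>b\<in>Basis. (k z \<bullet> b) *\<^sub>R frechet_derivative g (at z) b) = frechet_derivative g (at z) (k z)" ..
  qed
qed

lemma space_slice_derivative:
  assumes "Ck_on 1 g U" "(x, t) \<in> U"
  shows "((\<lambda>y. g (y, t)) has_derivative (\<lambda>h. frechet_derivative g (at (x, t)) (h, 0))) (at x)"
  by (rule has_derivative_compose[of "\<lambda>y. (y, t)" "\<lambda>h. (h, 0)"])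
     (use Ck_on_derivative[OF assms] in \<open>auto intro!: derivative_eq_intros\<close>)

lemma time_slice_derivative:
  assumes "Ck_on 1 g U" "(x, t) \<in> U"
  shows "((\<lambda>s. g (x, s)) has_derivative (\<lambda>h. frechet_derivative g (at (x, t)) (0, h))) (at t)"
  by (rule has_derivative_compose[of "\<lambda>s. (x, s)" "\<lambda>h. (0, h)"])
     (use Ck_on_derivative[OF assms] in \<open>auto intro!: derivative_eq_intros\<close>)

lemma space_jacobian_derivative:
  assumes "Ck_on 1 u U" "(x, t) \<in> U"
  shows "((\<lambda>y. u (y, t)) has_derivative (\<lambda>h. space_jacobian u (x, t) *v h)) (at x)"
proof -
  have "(\<lambda>y. u (y, t)) differentiable (at x)"
    using space_slice_derivative[OF assms] by (rule differentiableI)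
  then show ?thesis by (simp add: jacobian_works space_jacobian_def)
qed

text \<open>The operators are defined on slices of the field, whereas \<open>Ck_on\<close> controls
  the joint derivative in space-time. This identification is what makes the Jacobian continuous in
  both variables.\<close>

lemma space_jacobian_eq:
  assumes "Ck_on 1 u U" "z \<in> U"
  shows "space_jacobian u z *v h = frechet_derivative u (at z) (h, 0)"
proof -
  obtain x t where z: "z = (x, t)" by force
  have "(x, t) \<in> U" using assms(2) by (simp add: z)
  from has_derivative_unique[OF space_jacobian_derivative[OF assms(1) this] space_slice_derivative[OF assms(1) this]]
  show ?thesis unfolding z by (rule fun_cong)
qed

lemma time_deriv_derivative:
  assumes "Ck_on 1 u U" "(x, t) \<in> U"
  shows "((\<lambda>s. u (x, s)) has_vector_derivative time_deriv u (x, t)) (at t)"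
proof -
  have "(\<lambda>s. u (x, s)) differentiable (at t)"
    using time_slice_derivative[OF assms] by (rule differentiableI)
  then show ?thesis by (simp add: time_deriv_def vector_derivative_works[symmetric])
qed

lemma time_deriv_eq:
  assumes "Ck_on 1 u U" "z \<in> U"
  shows "time_deriv u z = frechet_derivative u (at z) (0, 1)"
proof -
  obtain x t where z: "z = (x, t)" by force
  have "(x, t) \<in> U" using assms(2) by (simp add: z)
  from has_derivative_unique[OF time_deriv_derivative[OF assms(1) this, unfolded has_vector_derivative_def]
      time_slice_derivative[OF assms(1) this]]
  have "(\<lambda>h. h *\<^sub>R time_deriv u (x, t)) = (\<lambda>h. frechet_derivative u (at (x, t)) (0, h))" .
  from fun_cong[OF this, of 1] show ?thesis by (simp add: z)
qed

lemma continuous_space_jacobian_mult: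
  assumes "Ck_on 1 u U" "continuous_on U k"
  shows "continuous_on U (\<lambda>z. space_jacobian u z *v k z)"
proof (rule continuous_on_eq)
  show "continuous_on U (\<lambda>z. frechet_derivative u (at z) (k z, 0))"
    by (rule Ck_on_continuous_derivative[OF assms(1)]) (intro continuous_intros assms(2))
qed (simp add: space_jacobian_eq[OF assms(1)])

lemma space_jacobian_component: "space_jacobian u z $ i $ j = (space_jacobian u z *v axis j 1) $ i"
  by (simp add: matrix_vector_mult_basis column_def)

lemma continuous_space_jacobian:
  assumes "Ck_on 1 u U"
  shows "continuous_on U (space_jacobian u)"
proof -
  have "continuous_on U (\<lambda>z. \<chi> i j. (space_jacobian u z *v axis j 1) $ i)"
    by (intro continuous_on_vec_lambda continuous_on_component continuous_space_jacobian_mult assms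
        continuous_on_const)
  moreover have "(\<lambda>z. \<chi> i j. (space_jacobian u z *v axis j 1) $ i) = space_jacobian u"
    by (simp add: fun_eq_iff vec_eq_iff space_jacobian_component[symmetric])
  ultimately show ?thesis by (simp only:)
qed

lemma continuous_space_div:
  assumes "Ck_on 1 u U"
  shows "continuous_on U (space_div u)"
  unfolding space_div_def[abs_def]
  by (intro continuous_intros continuous_on_component continuous_space_jacobian assms)

lemma continuous_time_deriv:
  assumes "Ck_on 1 u U"
  shows "continuous_on U (time_deriv u)"
  using Ck_on_continuous_derivative[OF assms continuous_on_const, of "(0, 1)"]
  by (rule continuous_on_eq) (simp add: time_deriv_eq[OF assms])

lemma space_grad_derivative:
  assumes "(\<lambda>y. p (y, t)) differentiable (at x)"
  shows "((\<lambda>y. p (y, t)) has_derivative (\<lambda>h. space_grad p (x, t) \<bullet> h)) (at x)"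
proof -
  have *: "((\<lambda>y. p (y, t)) has_derivative frechet_derivative (\<lambda>y. p (y, t)) (at x)) (at x)"
    using assms unfolding frechet_derivative_works .
  have "frechet_derivative (\<lambda>y. p (y, t)) (at x) = (\<lambda>h. space_grad p (x, t) \<bullet> h)"
    unfolding space_grad_def grad_def fst_conv snd_conv
    by (rule ext, rule linear_eq_inner_axis[OF has_derivative_linear[OF *]])
  with * show ?thesis by simp
qed

lemma continuous_space_grad:
  assumes "Ck_on 1 q U"
  shows "continuous_on U (space_grad q)"
proof -
  have "continuous_on U (\<lambda>z. \<chi> i. frechet_derivative q (at z) (axis i 1, 0))"
    by (intro continuous_on_vec_lambda Ck_on_continuous_derivative[OF assms] continuous_on_const)
  then show ?thesis
  proof (rule continuous_on_eq)
    fix z assume z: "z \<in> U"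
    obtain x t where xt: "z = (x, t)" by force
    have "frechet_derivative (\<lambda>y. q (y, t)) (at x) = (\<lambda>h. frechet_derivative q (at (x, t)) (h, 0))"
      using space_slice_derivative[OF assms] z unfolding xt by (intro frechet_derivative_at[symmetric])
    then show "(\<chi> i. frechet_derivative q (at z) (axis i 1, 0)) = space_grad q z"
      by (simp add: space_grad_def grad_def xt)
  qed
qed

subsection \<open>The local energy balance\<close>

lemma continuous_on_extend_0:
  fixes k :: "'a::t2_space \<Rightarrow> 'b::real_normed_vector"
  assumes D: "open D" and K: "compact K" "K \<subseteq> D" and k: "continuous_on D k"
    and supp: "\<And>x. x \<in> D \<Longrightarrow> x \<notin> K \<Longrightarrow> k x = 0"
  shows "continuous_on UNIV (\<lambda>x. if x \<in> D then k x else 0)"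
proof -
  let ?k = "\<lambda>x. if x \<in> D then k x else 0"
  have "continuous_on D ?k" using k by (rule continuous_on_eq) simp
  moreover have "continuous_on (- K) ?k"
    using continuous_on_const[of "- K" 0] by (rule continuous_on_eq) (simp add: supp)
  moreover have "open (- K)" using K(1) by (simp add: compact_imp_closed open_Compl)
  ultimately have "continuous_on (D \<union> - K) ?k" using D by (intro continuous_on_open_Un)
  moreover have "D \<union> - K = UNIV" using K(2) by auto
  ultimately show ?thesis by simp
qed

text \<open>Pressures enter through their spatial gradients alone. Continuity of the gradient is an
  assumption here; for the pressure of the solution it will be read off from the momentum
  equation.\<close>

locale velocity_pair =
  fixes D :: "(real^'d) set" and T :: real and f u v :: "(real^'d) \<times> real \<Rightarrow> real^'d"
    and p q :: "(real^'d) \<times> real \<Rightarrow> real"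
  assumes D_open: "open D" and D_bounded: "bounded D" and T_pos: "0 < T"
    and u_C1: "Ck_on 1 u (D \<times> {0<..<T})" and v_C1: "Ck_on 1 v (D \<times> {0<..<T})"
    and u_cont: "continuous_on (closure D \<times> {0..T}) u" and v_cont: "continuous_on (closure D \<times> {0..T}) v"
    and p_cont: "continuous_on (closure D \<times> {0..T}) p" and q_cont: "continuous_on (closure D \<times> {0..T}) q"
    and p_diff: "x \<in> D \<Longrightarrow> t \<in> {0<..<T} \<Longrightarrow> (\<lambda>y. p (y, t)) differentiable (at x)"
    and q_diff: "x \<in> D \<Longrightarrow> t \<in> {0<..<T} \<Longrightarrow> (\<lambda>y. q (y, t)) differentiable (at x)"
    and p_grad: "continuous_on (D \<times> {0<..<T}) (space_grad p)"
    and q_grad: "continuous_on (D \<times> {0<..<T}) (space_grad q)"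
    and momentum: "z \<in> D \<times> {0<..<T} \<Longrightarrow> time_deriv u z + convection u z + space_grad p z = f z"
    and incompressible: "z \<in> D \<times> {0<..<T} \<Longrightarrow> space_div u z = 0"
begin

abbreviation \<Omega> :: "((real^'d) \<times> real) set" where "\<Omega> \<equiv> D \<times> {0<..<T}"
abbreviation Q :: "((real^'d) \<times> real) set" where "Q \<equiv> closure D \<times> {0..T}"

definition w :: "(real^'d) \<times> real \<Rightarrow> real^'d" where "w z = v z - u z"
definition \<pi> :: "(real^'d) \<times> real \<Rightarrow> real" where "\<pi> z = q z - p z"
definition E :: "(real^'d) \<times> real \<Rightarrow> real" where "E z = (w z \<bullet> w z) / 2"
definition Et :: "(real^'d) \<times> real \<Rightarrow> real" where "Et z = w z \<bullet> (time_deriv v z - time_deriv u z)"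
definition Jw :: "(real^'d) \<times> real \<Rightarrow> real^'d^'d" where "Jw z = space_jacobian v z - space_jacobian u z"
text \<open>The energy flux: transport of the kinetic energy of the difference by \<open>v\<close>,
  plus the work of the pressure difference. Both parts are continuous up to the boundary, since no
  derivative occurs.\<close>

definition \<Phi> :: "(real^'d) \<times> real \<Rightarrow> real^'d" where "\<Phi> z = E z *\<^sub>R v z + \<pi> z *\<^sub>R w z"
definition \<Phi>' :: "(real^'d) \<times> real \<Rightarrow> real^'d \<Rightarrow> real^'d" where
  "\<Phi>' z h = E z *\<^sub>R (space_jacobian v z *v h) + (w z \<bullet> (Jw z *v h)) *\<^sub>R v z +
    (\<pi> z *\<^sub>R (Jw z *v h) + ((space_grad q z - space_grad p z) \<bullet> h) *\<^sub>R w z)"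
text \<open>The residuals and \<nabla>u are all that is left: the gradients of \<open>v\<close> and
  \<open>q\<close> enter only through the residuals.\<close>

definition \<Gamma> :: "(real^'d) \<times> real \<Rightarrow> real" where
  "\<Gamma> z = w z \<bullet> res_u f v q z - w z \<bullet> (space_jacobian u z *v w z) + res_div v z * (E z + \<pi> z)"

lemma \<Omega>_open: "open \<Omega>" using D_open by (intro open_Times) auto

lemma \<Omega>_subset: "\<Omega> \<subseteq> Q" using closure_subset[of D] by auto

lemma w_cont: "continuous_on Q w"
  unfolding w_def[abs_def] by (intro continuous_intros u_cont v_cont)

lemma \<pi>_cont: "continuous_on Q \<pi>"
  unfolding \<pi>_def[abs_def] by (intro continuous_intros p_cont q_cont)

lemma E_cont: "continuous_on Q E"
  unfolding E_def[abs_def] by (intro continuous_intros w_cont) auto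

lemma \<Phi>_cont: "continuous_on Q \<Phi>"
  unfolding \<Phi>_def[abs_def] by (intro continuous_intros E_cont v_cont \<pi>_cont w_cont)

lemmas \<Omega>_cont = w_cont[THEN continuous_on_subset, OF \<Omega>_subset] \<pi>_cont[THEN continuous_on_subset, OF \<Omega>_subset]
  E_cont[THEN continuous_on_subset, OF \<Omega>_subset] v_cont[THEN continuous_on_subset, OF \<Omega>_subset]
  \<Phi>_cont[THEN continuous_on_subset, OF \<Omega>_subset]

lemma Jw_cont: "continuous_on \<Omega> k \<Longrightarrow> continuous_on \<Omega> (\<lambda>z. Jw z *v k z)"
  unfolding Jw_def matrix_vector_mult_diff_rdistrib
  by (intro continuous_intros continuous_space_jacobian_mult[OF u_C1] continuous_space_jacobian_mult[OF v_C1])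

lemma \<Phi>'_cont: "continuous_on \<Omega> (\<lambda>z. \<Phi>' z h)"
  unfolding \<Phi>'_def
  by (intro continuous_intros \<Omega>_cont Jw_cont continuous_space_jacobian_mult[OF v_C1] p_grad q_grad)

lemma Et_cont: "continuous_on \<Omega> Et"
  unfolding Et_def[abs_def]
  by (intro continuous_intros \<Omega>_cont continuous_time_deriv u_C1 v_C1)

lemma w_derivative:
  assumes "x \<in> D" "t \<in> {0<..<T}"
  shows "((\<lambda>y. w (y, t)) has_derivative (\<lambda>h. Jw (x, t) *v h)) (at x)"
  unfolding w_def[abs_def] Jw_def matrix_vector_mult_diff_rdistrib
  by (intro has_derivative_diff space_jacobian_derivative[OF u_C1] space_jacobian_derivative[OF v_C1])
     (use assms in auto)

lemma E_derivative:
  assumes "x \<in> D" "t \<in> {0<..<T}"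
  shows "((\<lambda>y. E (y, t)) has_derivative (\<lambda>h. w (x, t) \<bullet> (Jw (x, t) *v h))) (at x)"
proof -
  have "((\<lambda>y. (w (y, t) \<bullet> w (y, t)) * (1 / 2)) has_derivative
      (\<lambda>h. (w (x, t) \<bullet> (Jw (x, t) *v h) + (Jw (x, t) *v h) \<bullet> w (x, t)) * (1 / 2))) (at x)"
    by (intro has_derivative_mult_left has_derivative_inner w_derivative assms)
  then show ?thesis by (simp add: E_def[abs_def] inner_commute)
qed

lemma \<pi>_derivative:
  assumes "x \<in> D" "t \<in> {0<..<T}"
  shows "((\<lambda>y. \<pi> (y, t)) has_derivative (\<lambda>h. (space_grad q (x, t) - space_grad p (x, t)) \<bullet> h)) (at x)"
  unfolding \<pi>_def[abs_def] inner_diff_left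
  by (intro has_derivative_diff space_grad_derivative p_diff q_diff assms)

lemma \<Phi>_derivative:
  assumes "x \<in> D" "t \<in> {0<..<T}"
  shows "((\<lambda>y. \<Phi> (y, t)) has_derivative \<Phi>' (x, t)) (at x)"
proof -
  have v: "((\<lambda>y. v (y, t)) has_derivative (\<lambda>h. space_jacobian v (x, t) *v h)) (at x)"
    using assms by (intro space_jacobian_derivative[OF v_C1]) auto
  have "((\<lambda>y. E (y, t) *\<^sub>R v (y, t) + \<pi> (y, t) *\<^sub>R w (y, t)) has_derivative \<Phi>' (x, t)) (at x)"
    unfolding \<Phi>'_def[abs_def]
    by (intro has_derivative_add has_derivative_scaleR E_derivative v \<pi>_derivative w_derivative assms)
  then show ?thesis by (simp add: \<Phi>_def[abs_def])
qed

text \<open>The convection terms are split as (\<nabla>v) v - (\<nabla>u) u = (\<open>Jw\<close>) v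
  + (\<nabla>u) w. The first part, paired with w, is the transport of \<open>E\<close> along v; the
  second remains in \<open>\<Gamma>\<close>. Since u is solenoidal, div w is the divergence residual
  of v.\<close>

lemma divergence_\<Phi>:
  assumes z: "z \<in> \<Omega>"
  shows "(\<Sum>i\<in>UNIV. \<Phi>' z (axis i 1) $ i) = \<Gamma> z - Et z"
proof -
  have J: "(A *v axis i 1) $ i = A $ i $ i" for A :: "real^'d^'d" and i
    by (simp add: matrix_vector_mult_basis column_def)
  have axis: "(\<Sum>i\<in>UNIV. (a \<bullet> (A *v axis i 1)) * b $ i) = a \<bullet> (A *v b)" for a b :: "real^'d" and A :: "real^'d^'d"
  proof -
    have "A *v b = A *v (\<Sum>i\<in>UNIV. b $ i *\<^sub>R axis i 1)"
      using basis_expansion[of b] by (simp add: scalar_mult_eq_scaleR)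
    also have "\<dots> = (\<Sum>i\<in>UNIV. b $ i *\<^sub>R (A *v axis i 1))"
      by (simp add: linear_sum[OF matrix_vector_mul_linear] linear_scale[OF matrix_vector_mul_linear])
    finally show ?thesis by (simp add: inner_sum_right mult.commute)
  qed
  have grad: "(\<Sum>i\<in>UNIV. (a \<bullet> axis i 1) * b $ i) = a \<bullet> b" for a b :: "real^'d"
    by (simp add: inner_vec_def[of a b] inner_axis)
  let ?G = "space_grad q z - space_grad p z"
  have "(\<Sum>i\<in>UNIV. \<Phi>' z (axis i 1) $ i) =
      E z * space_div v z + w z \<bullet> (Jw z *v v z) + (\<pi> z * (\<Sum>i\<in>UNIV. Jw z $ i $ i) + ?G \<bullet> w z)"
    by (simp add: \<Phi>'_def sum.distrib J axis grad space_div_def sum_distrib_left[symmetric])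
  also have "(\<Sum>i\<in>UNIV. Jw z $ i $ i) = space_div v z"
    using incompressible[OF z] by (simp add: Jw_def space_div_def sum_subtractf)
  finally have 1: "(\<Sum>i\<in>UNIV. \<Phi>' z (axis i 1) $ i) =
      space_div v z * (E z + \<pi> z) + w z \<bullet> (Jw z *v v z) + ?G \<bullet> w z"
    by (simp add: algebra_simps)
  have "res_u f v q z = (time_deriv v z - time_deriv u z) +
      (space_jacobian v z *v v z - space_jacobian u z *v u z) + ?G"
    using momentum[OF z] by (simp add: res_u_def convection_def algebra_simps)
  then have "\<Gamma> z - Et z = w z \<bullet> (space_jacobian v z *v v z - space_jacobian u z *v u z -
      space_jacobian u z *v w z) + w z \<bullet> ?G + space_div v z * (E z + \<pi> z)"
    by (simp add: \<Gamma>_def Et_def res_div_def inner_add_right inner_diff_right)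
  also have "space_jacobian v z *v v z - space_jacobian u z *v u z - space_jacobian u z *v w z = Jw z *v v z"
    by (simp add: w_def Jw_def matrix_vector_mult_diff_rdistrib matrix_vector_mult_diff_distrib)
  finally show ?thesis using 1 by (simp add: inner_commute)
qed

text \<open>At a fixed time \<open>\<psi>\<close> times the flux, extended by zero, is C^1 with
  compact support, so all its partial derivatives integrate to zero. Integration is over the compact
  \<open>K\<close>, since \<open>Et\<close> need not be integrable over \<open>D\<close>.\<close>

lemma slice_identity:
  assumes t: "t \<in> {0<..<T}" and \<psi>: "C1_with_grad \<psi> g" and K: "compact K" "K \<subseteq> D"
    and supp: "\<And>x. x \<notin> K \<Longrightarrow> \<psi> x = 0"
  shows "(\<integral>x. indicator K x *\<^sub>R (\<psi> x * (\<Gamma> (x, t) - Et (x, t)) + \<Phi> (x, t) \<bullet> g x) \<partial>lborel) = 0"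
proof -
  have g0: "g x = 0" if "x \<notin> K" for x by (rule C1_with_grad_support[OF \<psi> K(1) supp that])
  \<comment> \<open>Extension by zero: off \<open>D\<close> nothing is known of the flux, but
    \<open>\<psi>\<close> vanishes there in a neighbourhood of every point.\<close>
  define \<phi> where "\<phi> i x = (if x \<in> D then \<psi> x * \<Phi> (x, t) $ i else 0)" for i x
  define \<phi>' where "\<phi>' i x h = (if x \<in> D then \<psi> x * \<Phi>' (x, t) h $ i + (g x \<bullet> h) * \<Phi> (x, t) $ i else 0)" for i x h
  have der: "(\<phi> i has_derivative \<phi>' i x) (at x)" for i x
  proof (cases "x \<in> D")
    case True
    have 1: "(\<psi> has_derivative (\<lambda>h. g x \<bullet> h)) (at x)" using \<psi> by (simp add: C1_with_grad_def)
    have 2: "((\<lambda>y. \<Phi> (y, t) $ i) has_derivative (\<lambda>h. \<Phi>' (x, t) h $ i)) (at x)"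
      by (rule bounded_linear.has_derivative[OF bounded_linear_vec_nth \<Phi>_derivative[OF True t]])
    have "((\<lambda>y. \<psi> y * \<Phi> (y, t) $ i) has_derivative \<phi>' i x) (at x)"
      using has_derivative_mult[OF 1 2] True by (simp add: \<phi>'_def[abs_def])
    then show ?thesis
      by (rule has_derivative_transform_within_open[OF _ D_open True]) (simp add: \<phi>_def)
  next
    case False
    have "((\<lambda>_. 0) has_derivative \<phi>' i x) (at x)" using False by (simp add: \<phi>'_def[abs_def])
    then show ?thesis
      by (rule has_derivative_transform_within_open[of _ _ _ _ "- K"])
         (use False K supp in \<open>auto simp: \<phi>_def compact_imp_closed open_Compl\<close>)
  qed
  have slice: "continuous_on D (\<lambda>x. k (x, t))" if "continuous_on \<Omega> k" for k :: "(real^'d) \<times> real \<Rightarrow> 'z::topological_space"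
    using t by (intro continuous_on_compose2[OF that]) (auto intro!: continuous_intros)
  have cont: "continuous_on UNIV (\<lambda>x. \<phi>' i x (axis i 1))" for i
    unfolding \<phi>'_def
  proof (rule continuous_on_extend_0[OF D_open K])
    have "continuous_on D \<psi>" using C1_with_grad_continuous[OF \<psi>] by (rule continuous_on_subset) simp
    moreover have "continuous_on D g" using \<psi> unfolding C1_with_grad_def by (blast intro: continuous_on_subset)
    ultimately show "continuous_on D (\<lambda>x. \<psi> x * \<Phi>' (x, t) (axis i 1) $ i + (g x \<bullet> axis i 1) * \<Phi> (x, t) $ i)"
      by (intro continuous_intros continuous_on_component slice[OF \<Phi>'_cont] slice[OF \<Omega>_cont(5)])
  qed (simp add: supp g0)
  have \<phi>'0: "\<phi>' i x h = 0" if "x \<notin> K" for i x h using that by (simp add: \<phi>'_def supp g0)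
  have int: "integrable lborel (\<lambda>x. \<phi>' i x (axis i 1))" for i
  proof -
    obtain B where "\<And>x. norm (\<phi>' i x (axis i 1)) \<le> B"
      using continuous_compact_support_bounded[OF cont compact_imp_bounded[OF K(1)]] \<phi>'0 by metis
    then show ?thesis
      by (intro integrable_bounded_support[OF borel_measurable_continuous_onI[OF cont] compact_imp_bounded[OF K(1)] \<phi>'0])
  qed
  have zero: "(\<integral>x. \<phi>' i x (axis i 1) \<partial>lborel) = 0" for i
    by (rule integral_directional_derivative_eq_0[OF der cont K(1)]) (simp add: \<phi>_def supp)
  have "(\<integral>x. indicator K x *\<^sub>R (\<psi> x * (\<Gamma> (x, t) - Et (x, t)) + \<Phi> (x, t) \<bullet> g x) \<partial>lborel) =
      (\<integral>x. (\<Sum>i\<in>UNIV. \<phi>' i x (axis i 1)) \<partial>lborel)"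
  proof (rule Bochner_Integration.integral_cong[OF refl])
    fix x
    show "indicator K x *\<^sub>R (\<psi> x * (\<Gamma> (x, t) - Et (x, t)) + \<Phi> (x, t) \<bullet> g x) = (\<Sum>i\<in>UNIV. \<phi>' i x (axis i 1))"
    proof (cases "x \<in> K")
      case True
      then have "x \<in> D" using K by auto
      then have "(\<Sum>i\<in>UNIV. \<phi>' i x (axis i 1)) =
          \<psi> x * (\<Sum>i\<in>UNIV. \<Phi>' (x, t) (axis i 1) $ i) + (\<Sum>i\<in>UNIV. g x $ i * \<Phi> (x, t) $ i)"
        by (simp add: \<phi>'_def sum.distrib sum_distrib_left inner_axis)
      also have "(\<Sum>i\<in>UNIV. \<Phi>' (x, t) (axis i 1) $ i) = \<Gamma> (x, t) - Et (x, t)"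
        using \<open>x \<in> D\<close> t by (intro divergence_\<Phi>) auto
      finally show ?thesis using True by (simp add: inner_vec_def mult.commute)
    qed (simp add: \<phi>'0)
  qed
  also have "\<dots> = 0" using int zero by simp
  finally show ?thesis .
qed

text \<open>Continuity comes from the divergence identity, in whose other terms the forcing does not
  occur.\<close>

lemma \<Gamma>_cont: "continuous_on \<Omega> \<Gamma>"
proof -
  have "continuous_on \<Omega> (\<lambda>z. (\<Sum>i\<in>UNIV. \<Phi>' z (axis i 1) $ i) + Et z)"
    by (intro continuous_intros continuous_on_component \<Phi>'_cont Et_cont)
  then show ?thesis by (rule continuous_on_eq) (simp add: divergence_\<Phi>)
qed

lemma E_increment:
  assumes "x \<in> D" "0 < s" "s \<le> \<tau>" "\<tau> < T"
  shows "(LINT t:{s..\<tau>}|lborel. Et (x, t)) = E (x, \<tau>) - E (x, s)"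
  unfolding set_lebesgue_integral_def
proof (rule integral_FTC_atLeastAtMost[OF assms(3)])
  show "continuous_on {s..\<tau>} (\<lambda>t. Et (x, t))"
    by (rule time_slice_cont[OF Et_cont]) (use assms in auto)
  fix t assume t: "s \<le> t" "t \<le> \<tau>"
  have *: "((\<lambda>t. w (x, t)) has_vector_derivative (time_deriv v (x, t) - time_deriv u (x, t))) (at t)"
    unfolding w_def
    by (intro has_vector_derivative_diff time_deriv_derivative[OF u_C1] time_deriv_derivative[OF v_C1])
       (use assms t in auto)
  have "((\<lambda>t. (w (x, t) \<bullet> w (x, t)) * (1 / 2)) has_derivative
      (\<lambda>h. (w (x, t) \<bullet> (h *\<^sub>R (time_deriv v (x, t) - time_deriv u (x, t))) +
        (h *\<^sub>R (time_deriv v (x, t) - time_deriv u (x, t))) \<bullet> w (x, t)) * (1 / 2))) (at t)"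
    using * unfolding has_vector_derivative_def
    by (intro has_derivative_mult_left has_derivative_inner)
  then have "((\<lambda>t. E (x, t)) has_vector_derivative Et (x, t)) (at t)"
    by (simp add: E_def[abs_def] Et_def has_vector_derivative_def inner_commute algebra_simps)
  then show "((\<lambda>t. E (x, t)) has_vector_derivative Et (x, t)) (at t within {s..\<tau>})"
    by (rule has_vector_derivative_at_within)
qed

text \<open>On the compact set \<open>K \<times> {s..\<tau>}\<close> every term is continuous, so
  the order of integration may be exchanged. Integrating in time first turns \<open>Et\<close> into
  the increment of \<open>E\<close>; integrating in space first gives zero by
  \<open>slice_identity\<close>.\<close>

lemma weak_divergence_average:
  assumes s: "0 < s" "s \<le> \<tau>" "\<tau> < T"
  shows "weak_divergence D (\<lambda>x. LINT t:{s..\<tau>}|lborel. \<Phi> (x, t))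
    (\<lambda>x. (LINT t:{s..\<tau>}|lborel. \<Gamma> (x, t)) - (E (x, \<tau>) - E (x, s)))"
  unfolding weak_divergence_def
proof (intro allI impI)
  fix \<psi> g K
  assume \<psi>: "C1_with_grad \<psi> g" and K: "compact K" "K \<subseteq> D" and "\<forall>x. x \<notin> K \<longrightarrow> \<psi> x = 0"
  then have supp: "\<And>x. x \<notin> K \<Longrightarrow> \<psi> x = 0" by blast
  have g0: "g x = 0" if "x \<notin> K" for x by (rule C1_with_grad_support[OF \<psi> K(1) supp that])
  define R where "R z = \<psi> (fst z) * (\<Gamma> z - Et z) + \<Phi> z \<bullet> g (fst z)" for z
  let ?S = "{s..\<tau>}"
  let ?R = "\<lambda>x t. indicator (K \<times> ?S) (x, t) *\<^sub>R R (x, t)"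
  have KS: "K \<times> ?S \<subseteq> \<Omega>" using K s by auto
  have R_cont: "continuous_on (K \<times> ?S) R"
  proof -
    have "continuous_on UNIV g" using \<psi> by (simp add: C1_with_grad_def)
    then have "continuous_on (K \<times> ?S) (\<lambda>z. g (fst z))" "continuous_on (K \<times> ?S) (\<lambda>z. \<psi> (fst z))"
      using C1_with_grad_continuous[OF \<psi>]
      by (auto intro!: continuous_on_compose2[of UNIV g] continuous_on_compose2[of UNIV \<psi>] continuous_intros)
    then show ?thesis
      unfolding R_def[abs_def]
      by (intro continuous_intros continuous_on_subset[OF \<Gamma>_cont KS] continuous_on_subset[OF Et_cont KS]
          continuous_on_subset[OF \<Omega>_cont(5) KS])
  qed
  have R_int: "integrable (lborel \<Otimes>\<^sub>M lborel) (\<lambda>(x, t). ?R x t)"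
    using borel_integrable_compact[OF compact_Times[OF K(1) compact_Icc] R_cont]
    by (simp add: lborel_prod case_prod_unfold)
  have R_eq: "indicator D x *\<^sub>R (\<psi> x * ((LINT t:?S|lborel. \<Gamma> (x, t)) - (E (x, \<tau>) - E (x, s))) +
      (LINT t:?S|lborel. \<Phi> (x, t)) \<bullet> g x) = (\<integral>t. ?R x t \<partial>lborel)" for x
  proof (cases "x \<in> K")
    case True
    then have x: "x \<in> D" using K by auto
    have sub: "{x} \<times> ?S \<subseteq> \<Omega>" using x s by auto
    have i1: "set_integrable lborel ?S (\<lambda>t. \<Gamma> (x, t))"
      by (intro borel_integrable_atLeastAtMost' time_slice_cont[OF \<Gamma>_cont sub])
    have i2: "set_integrable lborel ?S (\<lambda>t. Et (x, t))"
      by (intro borel_integrable_atLeastAtMost' time_slice_cont[OF Et_cont sub])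
    have i3: "set_integrable lborel ?S (\<lambda>t. \<Phi> (x, t))"
      by (intro borel_integrable_atLeastAtMost' time_slice_cont[OF \<Omega>_cont(5) sub])
    have i4: "set_integrable lborel ?S (\<lambda>t. \<Phi> (x, t) \<bullet> g x)"
      by (intro borel_integrable_atLeastAtMost' continuous_intros time_slice_cont[OF \<Omega>_cont(5) sub])
    have inner: "(LINT t:?S|lborel. \<Phi> (x, t) \<bullet> g x) = (LINT t:?S|lborel. \<Phi> (x, t)) \<bullet> g x"
      using integral_inner_left[OF i3[unfolded set_integrable_def], of "g x"]
      by (simp add: set_lebesgue_integral_def)
    have "(\<integral>t. ?R x t \<partial>lborel) =
        (LINT t:?S|lborel. \<psi> x * (\<Gamma> (x, t) - Et (x, t)) + \<Phi> (x, t) \<bullet> g x)"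
      unfolding set_lebesgue_integral_def
      using True by (intro Bochner_Integration.integral_cong[OF refl]) (simp add: R_def indicator_times)
    also have "\<dots> = (LINT t:?S|lborel. \<psi> x * (\<Gamma> (x, t) - Et (x, t))) + (LINT t:?S|lborel. \<Phi> (x, t) \<bullet> g x)"
      by (rule set_integral_add(2)[OF _ i4]) (intro set_integrable_mult_right set_integral_diff(1) i1 i2)
    also have "(LINT t:?S|lborel. \<psi> x * (\<Gamma> (x, t) - Et (x, t))) =
        \<psi> x * ((LINT t:?S|lborel. \<Gamma> (x, t)) - (LINT t:?S|lborel. Et (x, t)))"
      by (simp add: set_integral_diff(2)[OF i1 i2])
    finally show ?thesis using x by (simp add: inner E_increment[OF x s])
  next
    case False
    then show ?thesis by (simp add: supp g0 indicator_times)
  qed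
  have "(LINT x:D|lborel. \<psi> x * ((LINT t:?S|lborel. \<Gamma> (x, t)) - (E (x, \<tau>) - E (x, s))) +
      (LINT t:?S|lborel. \<Phi> (x, t)) \<bullet> g x) =
      (\<integral>x. (\<integral>t. ?R x t \<partial>lborel) \<partial>lborel)"
    unfolding set_lebesgue_integral_def[of lborel D] R_eq ..
  also have "\<dots> = (\<integral>t. (\<integral>x. ?R x t \<partial>lborel) \<partial>lborel)"
    by (rule lborel_pair.Fubini_integral[OF R_int, symmetric])
  also have "\<dots> = (\<integral>t. 0 \<partial>(lborel :: real measure))"
  proof (rule Bochner_Integration.integral_cong[OF refl])
    fix t :: real
    show "(\<integral>x. ?R x t \<partial>lborel) = 0"
    proof (cases "t \<in> ?S")
      case True
      have "(\<integral>x. ?R x t \<partial>lborel) =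
          (\<integral>x. indicator K x *\<^sub>R (\<psi> x * (\<Gamma> (x, t) - Et (x, t)) + \<Phi> (x, t) \<bullet> g x) \<partial>lborel)"
        using True by (simp add: R_def indicator_times)
      also have "\<dots> = 0" by (rule slice_identity[OF _ \<psi> K supp]) (use True s in auto)
      finally show ?thesis .
    qed (simp add: indicator_times)
  qed
  finally show "(LINT x:D|lborel. \<psi> x * ((LINT t:?S|lborel. \<Gamma> (x, t)) - (E (x, \<tau>) - E (x, s))) +
      (LINT t:?S|lborel. \<Phi> (x, t)) \<bullet> g x) = 0" by simp
qed

section \<open>Integrals over the space-time cylinder and the energy identity\<close>

lemma set_integrable_\<Omega>:
  fixes k :: "(real^'d) \<times> real \<Rightarrow> real"
  assumes k: "continuous_on \<Omega> k" "\<And>z. z \<in> \<Omega> \<Longrightarrow> \<bar>k z\<bar> \<le> B" and A: "A \<in> sets borel" "A \<subseteq> \<Omega>"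
  shows "set_integrable lborel A k"
proof -
  have m[measurable]: "(\<lambda>z. indicator \<Omega> z *\<^sub>R k z) \<in> borel_measurable borel"
    using \<Omega>_open k by (intro borel_measurable_continuous_on_indicator) auto
  have "integrable lborel (\<lambda>z. indicator \<Omega> z *\<^sub>R k z)"
  proof (rule integrable_bounded_support[OF m])
    show "bounded \<Omega>" using D_bounded by (intro bounded_Times) auto
    show "norm (indicator \<Omega> z *\<^sub>R k z) \<le> max 0 B" for z
      using k(2)[of z] by (cases "z \<in> \<Omega>") (auto simp: le_max_iff_disj)
  qed auto
  then have "set_integrable lborel \<Omega> k" by (simp add: set_integrable_def)
  then show ?thesis by (rule set_integrable_subset) (use A in auto)
qed

lemma \<Omega>_Fubini:
  fixes k :: "(real^'d) \<times> real \<Rightarrow> real"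
  assumes k: "continuous_on \<Omega> k" "\<And>z. z \<in> \<Omega> \<Longrightarrow> \<bar>k z\<bar> \<le> B" and S: "S \<in> sets borel" "S \<subseteq> {0<..<T}"
  shows "set_integrable lborel S (\<lambda>t. LINT x:D|lborel. k (x, t))"
    and "(LINT t:S|lborel. LINT x:D|lborel. k (x, t)) = (LINT z:D \<times> S|lborel. k z)"
    and "set_integrable lborel D (\<lambda>x. LINT t:S|lborel. k (x, t))"
    and "(LINT x:D|lborel. LINT t:S|lborel. k (x, t)) = (LINT z:D \<times> S|lborel. k z)"
proof -
  let ?k = "\<lambda>x t. indicator (D \<times> S) (x, t) *\<^sub>R k (x, t)"
  have DS: "D \<times> S \<in> sets borel"
    unfolding borel_prod[symmetric] using D_open S by (intro pair_measureI) auto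
  have int: "integrable (lborel \<Otimes>\<^sub>M lborel) (\<lambda>(x, t). ?k x t)"
  proof -
    have "D \<times> S \<subseteq> \<Omega>" using S(2) by auto
    from set_integrable_\<Omega>[OF k DS this] show ?thesis
      by (simp add: set_integrable_def lborel_prod case_prod_unfold)
  qed
  have 1: "(\<lambda>t. \<integral>x. ?k x t \<partial>lborel) =
      (\<lambda>t. indicator S t *\<^sub>R (LINT x:D|lborel. k (x, t)))"
    unfolding set_lebesgue_integral_def by (auto simp: fun_eq_iff indicator_times indicator_def)
  have 2: "(\<lambda>x. \<integral>t. ?k x t \<partial>lborel) =
      (\<lambda>x. indicator D x *\<^sub>R (LINT t:S|lborel. k (x, t)))"
    unfolding set_lebesgue_integral_def by (auto simp: fun_eq_iff indicator_times indicator_def)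
  have 3: "(LINT z:D \<times> S|lborel. k z) = integral\<^sup>L (lborel \<Otimes>\<^sub>M lborel) (\<lambda>(x, t). ?k x t)"
    by (simp add: set_lebesgue_integral_def lborel_prod case_prod_unfold)
  show "set_integrable lborel S (\<lambda>t. LINT x:D|lborel. k (x, t))"
    using lborel_pair.integrable_snd[OF int] unfolding set_integrable_def 1 .
  show "set_integrable lborel D (\<lambda>x. LINT t:S|lborel. k (x, t))"
    using lborel_pair.integrable_fst[OF int] unfolding set_integrable_def 2 .
  show "(LINT t:S|lborel. LINT x:D|lborel. k (x, t)) = (LINT z:D \<times> S|lborel. k z)"
    using lborel_pair.integral_snd[OF int] unfolding 1 3 set_lebesgue_integral_def[of lborel S] .
  show "(LINT x:D|lborel. LINT t:S|lborel. k (x, t)) = (LINT z:D \<times> S|lborel. k z)"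
    using lborel_pair.integral_fst[OF int] unfolding 2 3 set_lebesgue_integral_def[of lborel D] .
qed

text \<open>The weak divergence of the averaged flux is integrable over \<open>D\<close>: increments
  of \<open>E\<close> are continuous on the closure, and the bound on \<open>\<Gamma>\<close>
  controls its time integral. This is exactly what the divergence theorem for weak divergences asks
  for.\<close>

lemma energy_identity:
  assumes D: "C1_boundary D" and \<sigma>: "is_surface_measure D \<sigma>"
    and s: "0 < s" "s \<le> \<tau>" "\<tau> < T" and \<Gamma>: "\<And>z. z \<in> \<Omega> \<Longrightarrow> \<bar>\<Gamma> z\<bar> \<le> B"
  shows "(LINT x:D|lborel. E (x, \<tau>)) - (LINT x:D|lborel. E (x, s)) =
    (LINT z:D \<times> {s..\<tau>}|lborel. \<Gamma> z) -
    (LINT x:frontier D|\<sigma>. (LINT t:{s..\<tau>}|lborel. \<Phi> (x, t)) \<bullet> outward_normal D x)"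
proof -
  have S: "{s..\<tau>} \<in> sets borel" "{s..\<tau>} \<subseteq> {0<..<T}" using s by auto
  have E: "set_integrable lborel D (\<lambda>x. E (x, t))" if "t \<in> {0..T}" for t
  proof (rule set_integrable_continuous[OF _ D_bounded])
    show "continuous_on (closure D) (\<lambda>x. E (x, t))"
      using that by (intro continuous_on_compose2[OF E_cont]) (auto intro!: continuous_intros)
  qed (use D_open in auto)
  have Es: "set_integrable lborel D (\<lambda>x. E (x, s))" and E\<tau>: "set_integrable lborel D (\<lambda>x. E (x, \<tau>))"
    using E s by auto
  have H: "set_integrable lborel D (\<lambda>x. (LINT t:{s..\<tau>}|lborel. \<Gamma> (x, t)) - (E (x, \<tau>) - E (x, s)))"
    by (intro set_integral_diff(1) Es E\<tau> \<Omega>_Fubini(3)[OF \<Gamma>_cont \<Gamma> S])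
  have "continuous_on (closure D) (\<lambda>x. LINT t:{s..\<tau>}|lborel. \<Phi> (x, t))"
    by (rule continuous_time_integral[OF continuous_on_subset[OF \<Phi>_cont]]) (use s in auto)
  from divergence_theorem_weak[OF D_open D_bounded D \<sigma> this H weak_divergence_average[OF s]]
  have "(LINT x:D|lborel. (LINT t:{s..\<tau>}|lborel. \<Gamma> (x, t)) - (E (x, \<tau>) - E (x, s))) =
      (LINT x:frontier D|\<sigma>. (LINT t:{s..\<tau>}|lborel. \<Phi> (x, t)) \<bullet> outward_normal D x)" .
  moreover have "(LINT x:D|lborel. (LINT t:{s..\<tau>}|lborel. \<Gamma> (x, t)) - (E (x, \<tau>) - E (x, s))) =
      (LINT z:D \<times> {s..\<tau>}|lborel. \<Gamma> z) - ((LINT x:D|lborel. E (x, \<tau>)) - (LINT x:D|lborel. E (x, s)))"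
    using \<Omega>_Fubini(3,4)[OF \<Gamma>_cont \<Gamma> S] Es E\<tau> by (simp add: set_integral_diff)
  ultimately show ?thesis by simp
qed

end

subsection \<open>Integral inequalities\<close>

text \<open>Cauchy--Schwarz against the constant 1: expanding the nonnegative integral of (m f -
  S)^2 gives m (m I - S^2).\<close>

lemma set_integral_square_le:
  fixes f :: "'a \<Rightarrow> real"
  assumes f: "set_integrable M A f" and f2: "set_integrable M A (\<lambda>x. (f x)\<^sup>2)"
    and A: "A \<in> sets M" "emeasure M A < \<infinity>"
  shows "(LINT x:A|M. f x)\<^sup>2 \<le> measure M A * (LINT x:A|M. (f x)\<^sup>2)"
proof -
  define m where "m = measure M A"
  define S where "S = (LINT x:A|M. f x)"
  define I where "I = (LINT x:A|M. (f x)\<^sup>2)"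
  have c: "set_integrable M A (\<lambda>_. a)" for a :: real
    unfolding set_integrable_def using A by simp
  have cval: "(LINT x:A|M. a) = m * a" for a :: real
    using A by (simp add: set_lebesgue_integral_def m_def)
  have "0 \<le> (LINT x:A|M. (m * f x - S)\<^sup>2)"
    unfolding set_lebesgue_integral_def by (intro Bochner_Integration.integral_nonneg) simp
  also have "(LINT x:A|M. (m * f x - S)\<^sup>2) = (LINT x:A|M. (m\<^sup>2 * (f x)\<^sup>2 - (2 * m * S) * f x) + S\<^sup>2)"
    by (simp add: power2_eq_square algebra_simps)
  also have "\<dots> = (LINT x:A|M. m\<^sup>2 * (f x)\<^sup>2 - (2 * m * S) * f x) + (LINT x:A|M. S\<^sup>2)"
    by (intro set_integral_add(2) set_integral_diff(1) set_integrable_mult_right f f2 c)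
  also have "(LINT x:A|M. m\<^sup>2 * (f x)\<^sup>2 - (2 * m * S) * f x) =
      (LINT x:A|M. m\<^sup>2 * (f x)\<^sup>2) - (LINT x:A|M. (2 * m * S) * f x)"
    by (intro set_integral_diff(2) set_integrable_mult_right f f2)
  also have "\<dots> = m\<^sup>2 * I - (2 * m * S) * S" by (simp only: set_integral_mult_right I_def S_def)
  finally have "0 \<le> m * (m * I - S\<^sup>2)" by (simp add: cval power2_eq_square algebra_simps)
  \<comment> \<open>One cannot divide by m = 0; but then the set is null and the integral
    vanishes.\<close>
  moreover have "S = 0" if "m = 0"
  proof -
    have "emeasure M A = 0" using that A by (simp add: m_def emeasure_eq_ennreal_measure less_top)
    then have "A \<in> null_sets M" using A by auto
    then have "AE x in M. x \<notin> A" by (rule AE_not_in)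
    then have "AE x in M. indicator A x *\<^sub>R f x = 0" by eventually_elim simp
    then show ?thesis unfolding S_def set_lebesgue_integral_def by (rule integral_eq_zero_AE)
  qed
  moreover have "0 \<le> m" by (simp add: m_def)
  ultimately have "S\<^sup>2 \<le> m * I" by (cases "m = 0") (auto simp: zero_le_mult_iff)
  then show ?thesis by (simp add: S_def I_def m_def)
qed

lemma integral_set_nonneg:
  fixes k :: "'a \<Rightarrow> real"
  shows "(\<And>x. 0 \<le> k x) \<Longrightarrow> 0 \<le> (LINT x:A|M. k x)"
  unfolding set_lebesgue_integral_def by (intro Bochner_Integration.integral_nonneg) simp

lemma set_integral_mono_set_nonneg:
  fixes f :: "'a \<Rightarrow> real"
  assumes "set_integrable M B f" "A \<in> sets M" "A \<subseteq> B" "\<And>x. x \<in> B \<Longrightarrow> 0 \<le> f x"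
  shows "(LINT x:A|M. f x) \<le> (LINT x:B|M. f x)"
  unfolding set_lebesgue_integral_def
proof (rule integral_mono)
  show "integrable M (\<lambda>x. indicator A x *\<^sub>R f x)"
    using set_integrable_subset[OF assms(1-3)] by (simp add: set_integrable_def)
  show "integrable M (\<lambda>x. indicator B x *\<^sub>R f x)" using assms(1) by (simp add: set_integrable_def)
  show "indicator A x *\<^sub>R f x \<le> indicator B x *\<^sub>R f x" for x
    using assms(3,4) by (cases "x \<in> B") (auto simp: indicator_def)
qed

lemma set_integral_open_closed:
  fixes f :: "real \<Rightarrow> real"
  assumes "set_integrable lborel {a..b} f"
  shows "(LINT t:{a<..<b}|lborel. f t) = (LINT t:{a..b}|lborel. f t)"
  unfolding set_lebesgue_integral_def
proof -
  have m: "(\<lambda>t. indicator {a..b} t *\<^sub>R f t) \<in> borel_measurable lborel"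
    using assms unfolding set_integrable_def by (rule borel_measurable_integrable)
  have "(\<lambda>t. indicator {a<..<b} t *\<^sub>R f t) = (\<lambda>t. indicator {a<..<b} t *\<^sub>R (indicator {a..b} t *\<^sub>R f t))"
    by (auto simp: fun_eq_iff indicator_def)
  moreover have "(\<lambda>t. indicator {a<..<b} t *\<^sub>R (indicator {a..b} t *\<^sub>R f t)) \<in> borel_measurable lborel"
    by (rule borel_measurable_scaleR[OF borel_measurable_indicator m]) simp
  ultimately have m': "(\<lambda>t. indicator {a<..<b} t *\<^sub>R f t) \<in> borel_measurable lborel" by simp
  have "AE t in lborel. t \<noteq> a" "AE t in lborel. t \<noteq> b" by (rule AE_lborel_singleton)+
  then have "AE t in lborel. indicator {a<..<b} t *\<^sub>R f t = indicator {a..b} t *\<^sub>R f t"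
    by eventually_elim (auto simp: indicator_def)
  then show "(\<integral>t. indicator {a<..<b} t *\<^sub>R f t \<partial>lborel) = (\<integral>t. indicator {a..b} t *\<^sub>R f t \<partial>lborel)"
    by (rule integral_cong_AE[OF m' m])
qed

text \<open>The factor \<open>T + c T\<^sup>2 e\<^bsup>cT\<^esup>\<close> bounds \<open>(e\<^bsup>cT\<^esup> - 1) / c\<close>, which is what Gronwall's argument gives.\<close>

lemma gronwall_integral:
  fixes e :: "real \<Rightarrow> real"
  assumes T: "0 < T" and c: "0 < c" and G: "0 \<le> G" and e: "continuous_on {0..T} e"
    and le: "\<And>\<tau>. 0 < \<tau> \<Longrightarrow> \<tau> < T \<Longrightarrow> e \<tau> \<le> G + c * integral {0..\<tau>} e"
  shows "integral {0..T} e \<le> (T + c * T\<^sup>2 * exp (c * T)) * G"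
proof -
  define A where "A \<tau> = integral {0..\<tau>} e" for \<tau>
  have derA: "(A has_real_derivative e \<tau>) (at \<tau> within {0..T})" if "\<tau> \<in> {0..T}" for \<tau>
    unfolding A_def using integral_has_real_derivative[OF e that] .
  \<comment> \<open>Integrating factor: the derivative of \<open>B\<close> is (e - c A - G) e^(- c
    \<tau>), which is nonpositive by hypothesis.\<close>
  define B where "B \<tau> = (A \<tau> + G / c) * exp (- c * \<tau>)" for \<tau>
  have "B T \<le> B 0"
  proof (rule DERIV_nonpos_imp_decreasing_open[of 0 T B])
    show "0 \<le> T" using T by simp
    fix \<tau> assume \<tau>: "0 < \<tau>" "\<tau> < T"
    have "(A has_real_derivative e \<tau>) (at \<tau>)"
      using derA[of \<tau>] \<tau> at_within_interior[of \<tau> "{0..T}"] by (simp add: interior_atLeastAtMost_real)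
    then have "(B has_real_derivative (e \<tau> - c * A \<tau> - G) * exp (- c * \<tau>)) (at \<tau>)"
      unfolding B_def[abs_def] using c by (auto intro!: derivative_eq_intros simp: field_simps)
    moreover have "(e \<tau> - c * A \<tau> - G) * exp (- c * \<tau>) \<le> 0"
      using le[OF \<tau>] by (intro mult_nonpos_nonneg) (auto simp: A_def)
    ultimately show "\<exists>y. (B has_real_derivative y) (at \<tau>) \<and> y \<le> 0" by blast
  next
    have "continuous_on {0..T} A"
      using derA by (meson DERIV_continuous continuous_on_eq_continuous_within)
    then show "continuous_on {0..T} B" unfolding B_def[abs_def] by (intro continuous_intros)
  qed
  then have "(A T + G / c) * exp (- c * T) \<le> G / c" by (simp add: B_def A_def)
  then have "(A T + G / c) * exp (- c * T) * exp (c * T) \<le> G / c * exp (c * T)"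
    by (rule mult_right_mono) simp
  then have "A T + G / c \<le> G / c * exp (c * T)" by (simp add: mult.assoc exp_add[symmetric])
  moreover have "G * ((exp (c * T) - 1) / c) = G / c * exp (c * T) - G / c"
    by (simp add: diff_divide_distrib right_diff_distrib)
  ultimately have "A T \<le> G * ((exp (c * T) - 1) / c)" by linarith
  moreover have bound: "(exp (c * T) - 1) / c \<le> T + c * T\<^sup>2 * exp (c * T)"
  proof -
    \<comment> \<open>The inequality e^x - 1 \<le> x e^x is used twice: the second time it replaces
      e^x on its own right-hand side by 1 + x e^x, giving x + x^2 e^x.\<close>
    let ?x = "c * T"
    have "1 - ?x \<le> exp (- ?x)" using exp_ge_add_one_self[of "- ?x"] by simp
    then have "(1 - ?x) * exp ?x \<le> exp (- ?x) * exp ?x" by (rule mult_right_mono) simp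
    then have 1: "exp ?x - 1 \<le> ?x * exp ?x" by (simp add: exp_add[symmetric] algebra_simps)
    then have "?x * exp ?x \<le> ?x * (1 + ?x * exp ?x)" using c T by (intro mult_left_mono) auto
    with 1 have "exp ?x - 1 \<le> c * (T + c * T\<^sup>2 * exp ?x)"
      by (simp add: power2_eq_square algebra_simps)
    then show ?thesis using c by (simp add: pos_divide_le_eq mult.commute)
  qed
  ultimately have "A T \<le> G * (T + c * T\<^sup>2 * exp (c * T))"
    using mult_left_mono[OF bound G] by linarith
  then show ?thesis by (simp add: A_def mult.commute)
qed

section \<open>Parameter integrals and integrals over the lateral boundary\<close>

lemma continuous_set_integral_slice:
  fixes k :: "(real^'d) \<times> real \<Rightarrow> real"
  assumes D: "D \<in> sets borel" "bounded D" and k: "continuous_on (closure D \<times> {a..b}) k"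
  shows "continuous_on {a..b} (\<lambda>t. LINT x:D|lborel. k (x, t))"
proof (rule continuous_on_sequentiallyI)
  fix r t assume r: "\<forall>n. r n \<in> {a..b}" and t: "t \<in> {a..b}" and lim: "r \<longlonglongrightarrow> t"
  have "compact (closure D \<times> {a..b})" using D by (intro compact_Times) auto
  then obtain B where B: "\<And>z. z \<in> closure D \<times> {a..b} \<Longrightarrow> norm (k z) \<le> B"
    using k by (rule compact_continuous_bound) blast
  have m: "(\<lambda>x. indicator D x *\<^sub>R k (x, s)) \<in> borel_measurable lborel" if "s \<in> {a..b}" for s
  proof -
    have "continuous_on D (\<lambda>x. k (x, s))"
      using that closure_subset[of D] by (intro continuous_on_compose2[OF k]) (auto intro!: continuous_intros)
    from borel_measurable_continuous_on_indicator[OF D(1) this] show ?thesis by simp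
  qed
  show "(\<lambda>n. LINT x:D|lborel. k (x, r n)) \<longlonglongrightarrow> (LINT x:D|lborel. k (x, t))"
    unfolding set_lebesgue_integral_def
  proof (rule integral_dominated_convergence[where M=lborel and f="\<lambda>x. indicator D x *\<^sub>R k (x, t)"
        and s="\<lambda>n x. indicator D x *\<^sub>R k (x, r n)" and w="\<lambda>x. indicator D x * B"])
    show "integrable lborel (\<lambda>x. indicator D x * B)"
      by (rule integrable_mult_left[OF integrable_indicator_bounded[OF D]])
    show "(\<lambda>x. indicator D x *\<^sub>R k (x, t)) \<in> borel_measurable lborel" using m[OF t] .
    show "(\<lambda>x. indicator D x *\<^sub>R k (x, r n)) \<in> borel_measurable lborel" for n using m r by blast
    show "AE x in lborel. (\<lambda>n. indicator D x *\<^sub>R k (x, r n)) \<longlonglongrightarrow> indicator D x *\<^sub>R k (x, t)"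
    proof (rule AE_I2)
      fix x
      show "(\<lambda>n. indicator D x *\<^sub>R k (x, r n)) \<longlonglongrightarrow> indicator D x *\<^sub>R k (x, t)"
      proof (cases "x \<in> D")
        case True
        then have "x \<in> closure D" using closure_subset by blast
        then have "continuous_on {a..b} (\<lambda>s. k (x, s))"
          by (intro continuous_on_compose2[OF k]) (auto intro!: continuous_intros)
        then have "(\<lambda>n. k (x, r n)) \<longlonglongrightarrow> k (x, t)"
          using r t lim unfolding continuous_on_sequentially o_def by blast
        then show ?thesis by (intro tendsto_scaleR tendsto_const)
      qed simp
    qed
    show "AE x in lborel. norm (indicator D x *\<^sub>R k (x, r n)) \<le> indicator D x * B" for n
    proof (rule AE_I2)
      fix x
      have "x \<in> D \<Longrightarrow> (x, r n) \<in> closure D \<times> {a..b}" using r closure_subset[of D] by auto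
      then show "norm (indicator D x *\<^sub>R k (x, r n)) \<le> indicator D x * B"
        using B[of "(x, r n)"] by (cases "x \<in> D") auto
    qed
  qed
qed

text \<open>Off the boundary nothing is known of \<open>\<sigma>\<close>, in particular no
  sigma-finiteness. Its restriction \<open>\<mu>\<close> to the boundary is a finite measure, to
  which the product theorems apply; \<open>convert\<close> carries the integrals back.\<close>

lemma surface_Fubini:
  fixes k :: "(real^'d) \<times> real \<Rightarrow> real"
  assumes D: "open D" "bounded D" "C1_boundary D" and \<sigma>: "is_surface_measure D \<sigma>"
    and k: "continuous_on (frontier D \<times> {a..b}) k"
  shows "(LINT x:frontier D|\<sigma>. LINT t:{a..b}|lborel. k (x, t)) =
    (LINT t:{a..b}|lborel. LINT x:frontier D|\<sigma>. k (x, t))"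
    and "set_integrable lborel {a..b} (\<lambda>t. LINT x:frontier D|\<sigma>. k (x, t))"
proof -
  let ?F = "frontier D" and ?S = "{a..b}"
  let ?k = "\<lambda>z. indicator (?F \<times> ?S) z *\<^sub>R k z"
  have sets[measurable_cong]: "sets \<sigma> = sets borel" using \<sigma> by (simp add: is_surface_measure_def)
  have fin: "emeasure \<sigma> ?F < \<infinity>" by (rule finite_surface[OF D \<sigma>])
  have F[measurable]: "?F \<in> sets borel" by auto
  define \<mu> where "\<mu> = density \<sigma> (\<lambda>x. ennreal (indicator ?F x))"
  have sets_\<mu>[measurable_cong]: "sets \<mu> = sets borel" by (simp add: \<mu>_def sets)
  have mass: "emeasure \<mu> A = emeasure \<sigma> (?F \<inter> A)" if "A \<in> sets borel" for A
  proof -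
    have "emeasure \<mu> A = (\<integral>\<^sup>+x. ennreal (indicator ?F x) * indicator A x \<partial>\<sigma>)"
      unfolding \<mu>_def using that by (intro emeasure_density) (auto simp: sets)
    also have "\<dots> = (\<integral>\<^sup>+x. indicator (?F \<inter> A) x \<partial>\<sigma>)"
      by (intro nn_integral_cong) (auto simp: indicator_def)
    also have "\<dots> = emeasure \<sigma> (?F \<inter> A)" using that by (intro nn_integral_indicator) (auto simp: sets)
    finally show ?thesis .
  qed
  have "space \<mu> = UNIV" using sets_eq_imp_space_eq[OF sets_\<mu>] by simp
  then have fin_\<mu>: "emeasure \<mu> (space \<mu>) < \<infinity>" using mass[of UNIV] fin by simp
  interpret finite_measure \<mu> using fin_\<mu> by (intro finite_measureI) auto
  interpret P: pair_sigma_finite \<mu> lborel ..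
  have convert: "(\<integral>x. indicator ?F x *\<^sub>R h x \<partial>\<sigma>) = (\<integral>x. indicator ?F x *\<^sub>R h x \<partial>\<mu>)"
    if "(\<lambda>x. indicator ?F x *\<^sub>R h x) \<in> borel_measurable borel" for h :: "real^'d \<Rightarrow> real"
  proof -
    have "(\<integral>x. indicator ?F x *\<^sub>R h x \<partial>\<mu>) = (\<integral>x. indicator ?F x *\<^sub>R (indicator ?F x *\<^sub>R h x) \<partial>\<sigma>)"
      unfolding \<mu>_def using that by (intro integral_density) (auto cong: measurable_cong_sets simp: sets)
    also have "\<dots> = (\<integral>x. indicator ?F x *\<^sub>R h x \<partial>\<sigma>)"
      by (intro Bochner_Integration.integral_cong[OF refl]) (auto simp: indicator_def)
    finally show ?thesis ..
  qed
  have comp: "compact (?F \<times> ?S)" using D by (intro compact_Times compact_frontier_bounded) auto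
  then obtain B where B: "\<And>z. z \<in> ?F \<times> ?S \<Longrightarrow> norm (k z) \<le> B"
    using k by (rule compact_continuous_bound) blast
  let ?f = "\<lambda>x t. indicator (?F \<times> ?S) (x, t) *\<^sub>R k (x, t)"
  have FS: "?F \<times> ?S \<in> sets (\<mu> \<Otimes>\<^sub>M lborel)" by (intro pair_measureI) (auto simp: sets_\<mu>)
  have "?k \<in> borel_measurable borel"
    using comp k by (intro borel_measurable_continuous_on_indicator borel_compact)
  then have m: "?k \<in> borel_measurable (\<mu> \<Otimes>\<^sub>M lborel)"
    unfolding borel_prod[symmetric]
    using measurable_cong_sets[OF sets_pair_measure_cong[OF sets_\<mu> sets_lborel] refl] by blast
  have int: "integrable (\<mu> \<Otimes>\<^sub>M lborel) (case_prod ?f)"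
  proof -
    have "integrable (\<mu> \<Otimes>\<^sub>M lborel) ?k"
    proof (rule integrableI_bounded_set[OF FS m])
      show "emeasure (\<mu> \<Otimes>\<^sub>M lborel) (?F \<times> ?S) < \<infinity>"
        using fin mass[OF F] by (subst lborel.emeasure_pair_measure_Times)
          (auto simp: sets_\<mu> ennreal_mult_less_top emeasure_lborel_Icc_eq)
      show "AE z in \<mu> \<Otimes>\<^sub>M lborel. z \<in> ?F \<times> ?S \<longrightarrow> norm (?k z) \<le> B"
        using B by (intro AE_I2) auto
    qed auto
    then show ?thesis by (simp add: case_prod_unfold)
  qed
  have time_m: "(\<lambda>x. indicator ?F x *\<^sub>R (LINT t:?S|lborel. k (x, t))) \<in> borel_measurable borel"
  proof -
    have "(\<lambda>x. \<integral>t. ?f x t \<partial>lborel) \<in> borel_measurable \<mu>"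
      using P.integrable_fst[OF int] by (rule borel_measurable_integrable)
    moreover have "(\<lambda>x. \<integral>t. ?f x t \<partial>lborel) = (\<lambda>x. indicator ?F x *\<^sub>R (LINT t:?S|lborel. k (x, t)))"
      unfolding set_lebesgue_integral_def by (auto simp: fun_eq_iff indicator_times indicator_def)
    ultimately show ?thesis using measurable_cong_sets[OF sets_\<mu> refl] by auto
  qed
  have space_m: "(\<lambda>x. indicator ?F x *\<^sub>R k (x, t)) \<in> borel_measurable borel" if "t \<in> ?S" for t
    using that by (intro borel_measurable_continuous_on_indicator continuous_on_compose2[OF k])
      (auto intro!: continuous_intros)
  have snd_eq: "(\<lambda>t. \<integral>x. ?f x t \<partial>\<mu>) = (\<lambda>t. indicator ?S t *\<^sub>R (LINT x:?F|\<sigma>. k (x, t)))"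
  proof
    fix t show "(\<integral>x. ?f x t \<partial>\<mu>) = indicator ?S t *\<^sub>R (LINT x:?F|\<sigma>. k (x, t))"
      using convert[OF space_m, of t]
      by (cases "t \<in> ?S") (auto simp: set_lebesgue_integral_def indicator_times)
  qed
  have "(LINT x:?F|\<sigma>. LINT t:?S|lborel. k (x, t)) = (\<integral>x. indicator ?F x *\<^sub>R (LINT t:?S|lborel. k (x, t)) \<partial>\<mu>)"
    unfolding set_lebesgue_integral_def[of \<sigma>] by (rule convert[OF time_m])
  also have "\<dots> = (\<integral>x. (\<integral>t. ?f x t \<partial>lborel) \<partial>\<mu>)"
    unfolding set_lebesgue_integral_def
    by (intro Bochner_Integration.integral_cong[OF refl]) (auto simp: indicator_times indicator_def)
  also have "\<dots> = (\<integral>t. (\<integral>x. ?f x t \<partial>\<mu>) \<partial>lborel)"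
    by (rule P.Fubini_integral[OF int, symmetric])
  finally show "(LINT x:?F|\<sigma>. LINT t:?S|lborel. k (x, t)) = (LINT t:?S|lborel. LINT x:?F|\<sigma>. k (x, t))"
    unfolding snd_eq set_lebesgue_integral_def[of lborel ?S] .
  show "set_integrable lborel ?S (\<lambda>t. LINT x:?F|\<sigma>. k (x, t))"
    using P.integrable_snd[OF int] unfolding snd_eq set_integrable_def .
qed

text \<open>Cauchy--Schwarz is applied in time for each boundary point, giving T, and then over the
  boundary, giving its area. The order of integration is exchanged at the end because
  \<open>integral_sb\<close> has time outside.\<close>

lemma surface_time_Cauchy_Schwarz:
  fixes r :: "(real^'d) \<times> real \<Rightarrow> real"
  assumes D: "open D" "bounded D" "C1_boundary D" and \<sigma>: "is_surface_measure D \<sigma>" and T: "0 \<le> T"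
    and r: "continuous_on (frontier D \<times> {0..T}) r"
  shows "(LINT x:frontier D|\<sigma>. LINT t:{0..T}|lborel. \<bar>r (x, t)\<bar>) \<le>
    sqrt (measure \<sigma> (frontier D)) * sqrt T * sqrt (integral_sb D \<sigma> T (\<lambda>z. (r z)\<^sup>2))"
proof -
  let ?F = "frontier D" and ?S = "{0..T}"
  have sets: "sets \<sigma> = sets borel" using \<sigma> by (simp add: is_surface_measure_def)
  have r2: "continuous_on (?F \<times> ?S) (\<lambda>z. (r z)\<^sup>2)" and ra: "continuous_on (?F \<times> ?S) (\<lambda>z. \<bar>r z\<bar>)"
    using r by (auto intro!: continuous_intros)
  define a where "a x = (LINT t:?S|lborel. \<bar>r (x, t)\<bar>)" for x
  have a: "continuous_on ?F a" unfolding a_def[abs_def] by (rule continuous_time_integral[OF ra])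
  have a2: "(a x)\<^sup>2 \<le> T * (LINT t:?S|lborel. (r (x, t))\<^sup>2)" if "x \<in> ?F" for x
  proof -
    have c: "continuous_on ?S (\<lambda>t. r (x, t))"
      using that by (intro continuous_on_compose2[OF r]) (auto intro!: continuous_intros)
    have "(a x)\<^sup>2 \<le> measure lborel ?S * (LINT t:?S|lborel. \<bar>r (x, t)\<bar>\<^sup>2)"
      unfolding a_def using c
      by (intro set_integral_square_le borel_integrable_atLeastAtMost' continuous_intros)
        (auto simp: emeasure_lborel_Icc_eq)
    then show ?thesis using T by simp
  qed
  have a_int: "set_integrable \<sigma> ?F a" by (rule set_integrable_frontier[OF D \<sigma> a])
  have a2_int: "set_integrable \<sigma> ?F (\<lambda>x. (a x)\<^sup>2)"
    by (rule set_integrable_frontier[OF D \<sigma>]) (intro continuous_intros a)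
  have r2_int: "set_integrable \<sigma> ?F (\<lambda>x. T * (LINT t:?S|lborel. (r (x, t))\<^sup>2))"
    by (rule set_integrable_frontier[OF D \<sigma>]) (intro continuous_intros continuous_time_integral[OF r2])
  have "(LINT x:?F|\<sigma>. a x)\<^sup>2 \<le> measure \<sigma> ?F * (LINT x:?F|\<sigma>. (a x)\<^sup>2)"
    by (rule set_integral_square_le[OF a_int a2_int _ finite_surface[OF D \<sigma>]]) (simp add: sets)
  also have "\<dots> \<le> measure \<sigma> ?F * (LINT x:?F|\<sigma>. T * (LINT t:?S|lborel. (r (x, t))\<^sup>2))"
    by (intro mult_left_mono set_integral_mono a2_int r2_int a2) auto
  also have "(LINT x:?F|\<sigma>. T * (LINT t:?S|lborel. (r (x, t))\<^sup>2)) =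
      T * (LINT t:?S|lborel. LINT x:?F|\<sigma>. (r (x, t))\<^sup>2)"
    using surface_Fubini(1)[OF D \<sigma> r2] by simp
  also have "(LINT t:?S|lborel. LINT x:?F|\<sigma>. (r (x, t))\<^sup>2) = integral_sb D \<sigma> T (\<lambda>z. (r z)\<^sup>2)"
    unfolding integral_sb_def using surface_Fubini(2)[OF D \<sigma> r2]
    by (intro set_integral_open_closed[symmetric]) simp
  finally have "(LINT x:?F|\<sigma>. a x)\<^sup>2 \<le>
      (sqrt (measure \<sigma> ?F) * sqrt T * sqrt (integral_sb D \<sigma> T (\<lambda>z. (r z)\<^sup>2)))\<^sup>2"
    using T by (simp add: power_mult_distrib integral_sb_def set_lebesgue_integral_def)
  then show ?thesis
    unfolding a_def[symmetric]
    by (rule power2_le_imp_le) (use T in \<open>simp add: integral_sb_def set_lebesgue_integral_def\<close>)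
qed

subsection \<open>The energy inequality\<close>

text \<open>\<open>K\<^sub>0\<close> bounds the factor that multiplies the divergence residual
  inside and the normal residual on the boundary; \<open>L\<close> is the rate of growth due to
  \<nabla>u. The bounds \<open>B\<^sub>u\<close> and \<open>B\<^sub>d\<close> only make the residual
  terms integrable and do not enter the estimate.\<close>

locale velocity_bounds = velocity_pair D T f u v p q
  for D :: "(real^'d) set" and T :: real and f u v :: "(real^'d) \<times> real \<Rightarrow> real^'d"
    and p q :: "(real^'d) \<times> real \<Rightarrow> real" +
  fixes \<sigma> :: "(real^'d) measure" and K\<^sub>0 B\<^sub>u B\<^sub>d L :: real
  assumes boundary: "C1_boundary D" and \<sigma>: "is_surface_measure D \<sigma>"
    and no_flux: "x \<in> frontier D \<Longrightarrow> t \<in> {0<..<T} \<Longrightarrow> u (x, t) \<bullet> outward_normal D x = 0"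
    and K0: "z \<in> closure D \<times> {0..T} \<Longrightarrow> \<bar>E z\<bar> + \<bar>\<pi> z\<bar> \<le> K\<^sub>0"
    and K0_nonneg: "0 \<le> K\<^sub>0" and L_nonneg: "0 \<le> L"
    and res_u_bound: "z \<in> D \<times> {0<..<T} \<Longrightarrow> norm (res_u f v q z) \<le> B\<^sub>u"
    and res_div_bound: "z \<in> D \<times> {0<..<T} \<Longrightarrow> \<bar>res_div v z\<bar> \<le> B\<^sub>d"
    and gradient_bound: "z \<in> D \<times> {0<..<T} \<Longrightarrow> norm (space_jacobian u z *v h) \<le> L * norm h"
begin

definition e :: "real \<Rightarrow> real" where "e t = (LINT x:D|lborel. (norm (w (x, t)))\<^sup>2)"

text \<open>The coefficients are those of the balance for |w|^2, which is twice that for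
  \<open>E\<close>: Young's factor 1/2 at the momentum residual is thereby absorbed, and
  \<open>K\<^sub>0\<close> is doubled.\<close>

definition source :: real where
  "source = (LINT z:\<Omega>|lborel. (norm (res_u f v q z))\<^sup>2) + 2 * K\<^sub>0 * (LINT z:\<Omega>|lborel. \<bar>res_div v z\<bar>) +
    2 * K\<^sub>0 * (LINT x:frontier D|\<sigma>. LINT t:{0..T}|lborel. \<bar>res_sb D v (x, t)\<bar>)"

lemma E_eq: "(norm (w z))\<^sup>2 = 2 * E z"
  by (simp add: E_def power2_norm_eq_inner)

lemma e_eq: "e t = 2 * (LINT x:D|lborel. E (x, t))"
  by (simp add: e_def E_eq)

lemma e_nonneg: "0 \<le> e t"
  unfolding e_def set_lebesgue_integral_def by (intro Bochner_Integration.integral_nonneg) simp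

lemma e_cont: "continuous_on {0..T} e"
  unfolding e_def[abs_def]
  by (rule continuous_set_integral_slice[OF _ D_bounded]) (use D_open in \<open>auto intro!: continuous_intros w_cont\<close>)

lemma f_cont: "continuous_on \<Omega> f"
proof -
  have "continuous_on \<Omega> (\<lambda>z. time_deriv u z + convection u z + space_grad p z)"
    unfolding convection_def
    by (intro continuous_intros continuous_time_deriv continuous_space_jacobian_mult p_grad u_C1
        continuous_on_subset[OF u_cont \<Omega>_subset])
  then show ?thesis by (rule continuous_on_eq) (simp add: momentum)
qed

lemma res_u_cont: "continuous_on \<Omega> (res_u f v q)"
  unfolding res_u_def[abs_def] convection_def
  by (intro continuous_intros continuous_time_deriv continuous_space_jacobian_mult q_grad v_C1 f_cont \<Omega>_cont)

lemma res_div_cont: "continuous_on \<Omega> (res_div v)"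
  unfolding res_div_def[abs_def] by (rule continuous_space_div[OF v_C1])

lemma E_nonneg: "0 \<le> E z" by (simp add: E_def)

lemma E_le: "z \<in> Q \<Longrightarrow> E z \<le> K\<^sub>0"
  using K0[of z] E_nonneg[of z] by linarith

text \<open>Young's inequality splits the momentum term into halves of |w|^2 and of the squared
  residual. After doubling, this half of |w|^2 is the 1 in the rate 1 + 2 L.\<close>

lemma \<Gamma>_le:
  assumes z: "z \<in> \<Omega>"
  shows "\<bar>\<Gamma> z\<bar> \<le> (1 + 2 * L) / 2 * (norm (w z))\<^sup>2 + (norm (res_u f v q z))\<^sup>2 / 2 + K\<^sub>0 * \<bar>res_div v z\<bar>"
proof -
  have zQ: "z \<in> Q" using z \<Omega>_subset by blast
  let ?a = "norm (w z)" and ?b = "norm (res_u f v q z)"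
  have 1: "\<bar>w z \<bullet> res_u f v q z\<bar> \<le> ?a\<^sup>2 / 2 + ?b\<^sup>2 / 2"
  proof -
    have "\<bar>w z \<bullet> res_u f v q z\<bar> \<le> ?a * ?b" by (rule Cauchy_Schwarz_ineq2)
    also have "\<dots> \<le> ?a\<^sup>2 / 2 + ?b\<^sup>2 / 2" using sum_squares_bound[of ?a ?b] by simp
    finally show ?thesis .
  qed
  have 2: "\<bar>w z \<bullet> (space_jacobian u z *v w z)\<bar> \<le> L * ?a\<^sup>2"
  proof -
    have "\<bar>w z \<bullet> (space_jacobian u z *v w z)\<bar> \<le> ?a * norm (space_jacobian u z *v w z)"
      by (rule Cauchy_Schwarz_ineq2)
    also have "\<dots> \<le> ?a * (L * ?a)" by (intro mult_left_mono gradient_bound z) simp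
    finally show ?thesis by (simp add: power2_eq_square algebra_simps)
  qed
  have 3: "\<bar>res_div v z * (E z + \<pi> z)\<bar> \<le> K\<^sub>0 * \<bar>res_div v z\<bar>"
  proof -
    have "\<bar>E z + \<pi> z\<bar> \<le> K\<^sub>0" using K0[OF zQ] by linarith
    then have "\<bar>res_div v z\<bar> * \<bar>E z + \<pi> z\<bar> \<le> \<bar>res_div v z\<bar> * K\<^sub>0" by (intro mult_left_mono) auto
    then show ?thesis by (simp add: abs_mult mult.commute)
  qed
  have 4: "(1 + 2 * L) / 2 * ?a\<^sup>2 = ?a\<^sup>2 / 2 + L * ?a\<^sup>2" by (simp add: field_simps)
  show ?thesis unfolding \<Gamma>_def 4 using 1 2 3 by linarith
qed

lemma rhs_bounds:
  assumes z: "z \<in> \<Omega>"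
  shows "\<bar>(norm (w z))\<^sup>2\<bar> \<le> 2 * K\<^sub>0" "\<bar>(norm (res_u f v q z))\<^sup>2\<bar> \<le> B\<^sub>u\<^sup>2" "\<bar>\<bar>res_div v z\<bar>\<bar> \<le> B\<^sub>d"
proof -
  have "z \<in> Q" using z \<Omega>_subset by blast
  then show "\<bar>(norm (w z))\<^sup>2\<bar> \<le> 2 * K\<^sub>0" using E_le[of z] E_nonneg[of z] by (simp add: E_eq)
  show "\<bar>(norm (res_u f v q z))\<^sup>2\<bar> \<le> B\<^sub>u\<^sup>2" using res_u_bound[OF z] by (simp add: power_mono)
  show "\<bar>\<bar>res_div v z\<bar>\<bar> \<le> B\<^sub>d" using res_div_bound[OF z] by simp
qed

lemma rhs_conts:
  "continuous_on \<Omega> (\<lambda>z. (norm (w z))\<^sup>2)" "continuous_on \<Omega> (\<lambda>z. (norm (res_u f v q z))\<^sup>2)"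
  "continuous_on \<Omega> (\<lambda>z. \<bar>res_div v z\<bar>)"
  by (intro continuous_intros \<Omega>_cont res_u_cont res_div_cont)+

lemma \<Gamma>_bound:
  assumes z: "z \<in> \<Omega>"
  shows "\<bar>\<Gamma> z\<bar> \<le> (1 + 2 * L) * K\<^sub>0 + B\<^sub>u\<^sup>2 / 2 + K\<^sub>0 * B\<^sub>d"
proof -
  have "(1 + 2 * L) / 2 * (norm (w z))\<^sup>2 \<le> (1 + 2 * L) / 2 * (2 * K\<^sub>0)"
    using rhs_bounds(1)[OF z] L_nonneg by (intro mult_left_mono) auto
  moreover have "(1 + 2 * L) / 2 * (2 * K\<^sub>0) = (1 + 2 * L) * K\<^sub>0" by simp
  moreover have "K\<^sub>0 * \<bar>res_div v z\<bar> \<le> K\<^sub>0 * B\<^sub>d"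
    using res_div_bound[OF z] K0_nonneg by (intro mult_left_mono) auto
  ultimately show ?thesis using \<Gamma>_le[OF z] rhs_bounds(2)[OF z] by (simp only: abs_power2)
qed

lemma interior_estimate:
  assumes s: "0 < s" "s \<le> \<tau>" "\<tau> < T"
  shows "2 * (LINT z:D \<times> {s..\<tau>}|lborel. \<Gamma> z) \<le> (1 + 2 * L) * (LINT t:{s..\<tau>}|lborel. e t) +
    (LINT z:\<Omega>|lborel. (norm (res_u f v q z))\<^sup>2) + 2 * K\<^sub>0 * (LINT z:\<Omega>|lborel. \<bar>res_div v z\<bar>)"
proof -
  let ?A = "D \<times> {s..\<tau>}"
  let ?a = "\<lambda>z. (norm (w z))\<^sup>2" and ?b = "\<lambda>z. (norm (res_u f v q z))\<^sup>2" and ?c = "\<lambda>z. \<bar>res_div v z\<bar>"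
  have S: "{s..\<tau>} \<in> sets borel" "{s..\<tau>} \<subseteq> {0<..<T}" using s by auto
  have A: "?A \<in> sets borel" unfolding borel_prod[symmetric] using D_open by (intro pair_measureI) auto
  have A': "?A \<subseteq> \<Omega>" using S(2) by auto
  have Om: "\<Omega> \<in> sets borel" using \<Omega>_open by simp
  note i1 = set_integrable_\<Omega>[OF rhs_conts(1) rhs_bounds(1) A A']
  note i2 = set_integrable_\<Omega>[OF rhs_conts(2) rhs_bounds(2) A A']
  note i3 = set_integrable_\<Omega>[OF rhs_conts(3) rhs_bounds(3) A A']
  have c1: "set_integrable lborel ?A (\<lambda>z. (1 + 2 * L) / 2 * ?a z)"
    by (intro set_integrable_mult_right i1)
  have c2: "set_integrable lborel ?A (\<lambda>z. 1 / 2 * ?b z)"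
    by (intro set_integrable_mult_right i2)
  have c3: "set_integrable lborel ?A (\<lambda>z. K\<^sub>0 * ?c z)"
    by (intro set_integrable_mult_right i3)
  have "(LINT z:?A|lborel. \<Gamma> z) \<le>
      (LINT z:?A|lborel. (1 + 2 * L) / 2 * ?a z + 1 / 2 * ?b z + K\<^sub>0 * ?c z)"
  proof (rule set_integral_mono)
    show "set_integrable lborel ?A \<Gamma>" by (rule set_integrable_\<Omega>[OF \<Gamma>_cont \<Gamma>_bound A A'])
    show "set_integrable lborel ?A (\<lambda>z. (1 + 2 * L) / 2 * ?a z + 1 / 2 * ?b z + K\<^sub>0 * ?c z)"
      by (intro set_integral_add(1) c1 c2 c3)
    fix z assume "z \<in> ?A"
    then have "z \<in> \<Omega>" using A' by blast
    from \<Gamma>_le[OF this]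
    show "\<Gamma> z \<le> (1 + 2 * L) / 2 * ?a z + 1 / 2 * ?b z + K\<^sub>0 * ?c z"
      by linarith
  qed
  also have "\<dots> = (LINT z:?A|lborel. (1 + 2 * L) / 2 * ?a z) +
      (LINT z:?A|lborel. 1 / 2 * ?b z) + (LINT z:?A|lborel. K\<^sub>0 * ?c z)"
    by (simp only: set_integral_add(2)[OF set_integral_add(1)[OF c1 c2] c3] set_integral_add(2)[OF c1 c2])
  also have "\<dots> = (1 + 2 * L) / 2 * (LINT z:?A|lborel. ?a z) +
      1 / 2 * (LINT z:?A|lborel. ?b z) + K\<^sub>0 * (LINT z:?A|lborel. ?c z)"
    by (simp only: set_integral_mult_right)
  also have "(LINT z:?A|lborel. ?a z) = (LINT t:{s..\<tau>}|lborel. e t)"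
    unfolding e_def by (rule \<Omega>_Fubini(2)[OF rhs_conts(1) rhs_bounds(1) S, symmetric])
  finally have main: "(LINT z:?A|lborel. \<Gamma> z) \<le> (1 + 2 * L) / 2 * (LINT t:{s..\<tau>}|lborel. e t) +
      1 / 2 * (LINT z:?A|lborel. ?b z) + K\<^sub>0 * (LINT z:?A|lborel. ?c z)" .
  have A_lborel: "?A \<in> sets lborel" using A by simp
  \<comment> \<open>The residual integrals are enlarged to the whole cylinder, so that they become
    constants independent of time; only the integral of \<open>e\<close> must keep its interval for
    Gronwall's inequality.\<close>
  have m2: "(LINT z:?A|lborel. ?b z) \<le> (LINT z:\<Omega>|lborel. ?b z)"
    by (rule set_integral_mono_set_nonneg[OF set_integrable_\<Omega>[OF rhs_conts(2) rhs_bounds(2) Om order_refl] A_lborel A']) auto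
  have "(LINT z:?A|lborel. ?c z) \<le> (LINT z:\<Omega>|lborel. ?c z)"
    by (rule set_integral_mono_set_nonneg[OF set_integrable_\<Omega>[OF rhs_conts(3) rhs_bounds(3) Om order_refl] A_lborel A']) auto
  then have m3: "K\<^sub>0 * (LINT z:?A|lborel. ?c z) \<le> K\<^sub>0 * (LINT z:\<Omega>|lborel. ?c z)"
    using K0_nonneg by (rule mult_left_mono)
  have half: "2 * ((1 + 2 * L) / 2 * a) = (1 + 2 * L) * a" for a by simp
  have "2 * (LINT z:?A|lborel. \<Gamma> z) \<le> 2 * ((1 + 2 * L) / 2 * (LINT t:{s..\<tau>}|lborel. e t)) +
      (LINT z:\<Omega>|lborel. ?b z) + 2 * (K\<^sub>0 * (LINT z:\<Omega>|lborel. ?c z))"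
    using main m2 m3 by linarith
  then show ?thesis unfolding half by (simp only: mult.assoc)
qed

lemma frontier_subset: "frontier D \<times> {0..T} \<subseteq> Q"
  by (auto simp: frontier_def)

lemma res_sb_cont: "continuous_on (frontier D \<times> {0..T}) (res_sb D v)"
  unfolding res_sb_def[abs_def]
  by (intro continuous_intros continuous_on_subset[OF v_cont frontier_subset]
      continuous_on_compose2[OF continuous_outward_normal[OF D_open boundary]]) auto

lemma \<Phi>_normal:
  assumes x: "x \<in> frontier D" and t: "t \<in> {0<..<T}"
  shows "\<bar>\<Phi> (x, t) \<bullet> outward_normal D x\<bar> \<le> K\<^sub>0 * \<bar>res_sb D v (x, t)\<bar>"
proof -
  have "\<Phi> (x, t) \<bullet> outward_normal D x = (E (x, t) + \<pi> (x, t)) * res_sb D v (x, t)"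
    using no_flux[OF x t] by (simp add: \<Phi>_def w_def res_sb_def inner_add_left inner_diff_left algebra_simps)
  moreover have "\<bar>E (x, t) + \<pi> (x, t)\<bar> \<le> K\<^sub>0"
    using K0[of "(x, t)"] x t by (auto simp: frontier_def)
  ultimately show ?thesis by (simp add: abs_mult mult_right_mono)
qed

lemma boundary_estimate:
  assumes s: "0 < s" "s \<le> \<tau>" "\<tau> < T"
  shows "\<bar>LINT x:frontier D|\<sigma>. (LINT t:{s..\<tau>}|lborel. \<Phi> (x, t)) \<bullet> outward_normal D x\<bar> \<le>
    K\<^sub>0 * (LINT x:frontier D|\<sigma>. LINT t:{0..T}|lborel. \<bar>res_sb D v (x, t)\<bar>)"
proof -
  let ?F = "frontier D" and ?S = "{s..\<tau>}"
  let ?l = "\<lambda>x. (LINT t:?S|lborel. \<Phi> (x, t)) \<bullet> outward_normal D x"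
  let ?r = "\<lambda>x. LINT t:{0..T}|lborel. \<bar>res_sb D v (x, t)\<bar>"
  note frontier_int = set_integrable_frontier[OF D_open D_bounded boundary \<sigma>]
  have l: "set_integrable \<sigma> ?F ?l"
  proof (rule frontier_int, intro continuous_intros continuous_outward_normal[OF D_open boundary])
    show "continuous_on ?F (\<lambda>x. LINT t:?S|lborel. \<Phi> (x, t))"
      by (rule continuous_time_integral[OF continuous_on_subset[OF \<Phi>_cont]]) (use s in \<open>auto simp: frontier_def\<close>)
  qed
  have abs_cont: "continuous_on (?F \<times> {0..T}) (\<lambda>z. \<bar>res_sb D v z\<bar>)" by (intro continuous_intros res_sb_cont)
  have r: "set_integrable \<sigma> ?F (\<lambda>x. K\<^sub>0 * ?r x)"
    by (intro set_integrable_mult_right frontier_int continuous_time_integral abs_cont)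
  have le: "\<bar>?l x\<bar> \<le> K\<^sub>0 * ?r x" if x: "x \<in> ?F" for x
  proof -
    have Fs: "{x} \<times> ?S \<subseteq> Q" using x s by (auto simp: frontier_def)
    have Fr: "{x} \<times> {0..T} \<subseteq> ?F \<times> {0..T}" using x by auto
    have i\<Phi>: "set_integrable lborel ?S (\<lambda>t. \<Phi> (x, t))"
      by (intro borel_integrable_atLeastAtMost' time_slice_cont[OF \<Phi>_cont Fs])
    have in': "set_integrable lborel ?S (\<lambda>t. \<Phi> (x, t) \<bullet> outward_normal D x)"
      by (intro borel_integrable_atLeastAtMost' continuous_intros time_slice_cont[OF \<Phi>_cont Fs])
    have ir: "set_integrable lborel {0..T} (\<lambda>t. K\<^sub>0 * \<bar>res_sb D v (x, t)\<bar>)"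
      by (intro borel_integrable_atLeastAtMost' continuous_intros time_slice_cont[OF res_sb_cont Fr])
    have sub: "?S \<subseteq> {0..T}" using s by auto
    have "?l x = (LINT t:?S|lborel. \<Phi> (x, t) \<bullet> outward_normal D x)"
      using integral_inner_left[OF i\<Phi>[unfolded set_integrable_def], of "outward_normal D x"]
      by (simp add: set_lebesgue_integral_def)
    then have "\<bar>?l x\<bar> \<le> (LINT t:?S|lborel. \<bar>\<Phi> (x, t) \<bullet> outward_normal D x\<bar>)"
      using set_integral_norm_bound[OF in'] by simp
    also have "\<dots> \<le> (LINT t:?S|lborel. K\<^sub>0 * \<bar>res_sb D v (x, t)\<bar>)"
    proof (rule set_integral_mono)
      show "set_integrable lborel ?S (\<lambda>t. \<bar>\<Phi> (x, t) \<bullet> outward_normal D x\<bar>)"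
        using in' by (rule set_integrable_abs)
      show "set_integrable lborel ?S (\<lambda>t. K\<^sub>0 * \<bar>res_sb D v (x, t)\<bar>)"
        by (rule set_integrable_subset[OF ir _ sub]) simp
    qed (use \<Phi>_normal[OF x] s in auto)
    also have "\<dots> \<le> (LINT t:{0..T}|lborel. K\<^sub>0 * \<bar>res_sb D v (x, t)\<bar>)"
      by (rule set_integral_mono_set_nonneg[OF ir _ sub]) (use K0_nonneg in auto)
    finally show ?thesis by simp
  qed
  have "\<bar>LINT x:?F|\<sigma>. ?l x\<bar> \<le> (LINT x:?F|\<sigma>. \<bar>?l x\<bar>)" using set_integral_norm_bound[OF l] by simp
  also have "\<dots> \<le> (LINT x:?F|\<sigma>. K\<^sub>0 * ?r x)"
    by (rule set_integral_mono[OF set_integrable_abs[OF l] r le])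
  finally show ?thesis by simp
qed

lemma energy_increment:
  assumes s: "0 < s" "s \<le> \<tau>" "\<tau> < T"
  shows "e \<tau> - e s \<le> (1 + 2 * L) * (LINT t:{s..\<tau>}|lborel. e t) + source"
proof -
  let ?B = "LINT x:frontier D|\<sigma>. (LINT t:{s..\<tau>}|lborel. \<Phi> (x, t)) \<bullet> outward_normal D x"
  have "e \<tau> - e s = 2 * (LINT z:D \<times> {s..\<tau>}|lborel. \<Gamma> z) - 2 * ?B"
    using energy_identity[OF boundary \<sigma> s \<Gamma>_bound] by (simp add: e_eq)
  moreover note interior_estimate[OF s] boundary_estimate[OF s]
  ultimately show ?thesis unfolding source_def by linarith
qed

section \<open>Gronwall's inequality and the resulting energy estimate\<close>

lemma energy_gronwall:
  assumes \<tau>: "0 < \<tau>" "\<tau> < T"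
  shows "e \<tau> \<le> (e 0 + source) + (1 + 2 * L) * integral {0..\<tau>} e"
proof -
  let ?I = "(1 + 2 * L) * integral {0..\<tau>} e + source"
  have int: "set_integrable lborel {0..\<tau>} e"
    using \<tau> by (intro borel_integrable_atLeastAtMost' continuous_on_subset[OF e_cont]) auto
  have le: "e \<tau> \<le> e s + ?I" if "s \<in> {0<..<\<tau>}" for s
  proof -
    have "(LINT t:{s..\<tau>}|lborel. e t) \<le> (LINT t:{0..\<tau>}|lborel. e t)"
      by (rule set_integral_mono_set_nonneg[OF int]) (use that e_nonneg in auto)
    also have "\<dots> = integral {0..\<tau>} e" by (rule set_borel_integral_eq_integral(2)[OF int])
    finally have "(1 + 2 * L) * (LINT t:{s..\<tau>}|lborel. e t) \<le> (1 + 2 * L) * integral {0..\<tau>} e"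
      using L_nonneg by (intro mult_left_mono) auto
    then show ?thesis using energy_increment[of s \<tau>] that \<tau> by auto
  qed
  \<comment> \<open>The balance holds only from positive times s on; continuity of \<open>e\<close>
    at 0 recovers the initial error in the limit.\<close>
  have "(e \<longlongrightarrow> e 0) (at 0 within {0..T})" using e_cont T_pos by (auto simp: continuous_on_def)
  then have "(e \<longlongrightarrow> e 0) (at_right 0)" using T_pos by (simp add: at_within_Icc_at_right)
  then have "((\<lambda>s. e s + ?I) \<longlongrightarrow> e 0 + ?I) (at_right 0)" by (intro tendsto_add tendsto_const)
  moreover have "\<forall>\<^sub>F s in at_right 0. e \<tau> \<le> e s + ?I"
    using \<tau> le by (intro eventually_at_rightI[of 0 \<tau>]) auto
  ultimately have "e \<tau> \<le> e 0 + ?I" by (rule tendsto_lowerbound) simp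
  then show ?thesis by simp
qed

lemma source_nonneg: "0 \<le> source"
  unfolding source_def using K0_nonneg
  by (intro add_nonneg_nonneg mult_nonneg_nonneg integral_set_nonneg) auto

lemma integral_int_\<Omega>:
  assumes "continuous_on \<Omega> k" "\<And>z. z \<in> \<Omega> \<Longrightarrow> \<bar>k z\<bar> \<le> B"
  shows "integral_int D T k = (LINT z:\<Omega>|lborel. k z)"
  unfolding integral_int_def using \<Omega>_Fubini(2)[OF assms, of "{0<..<T}"] by simp

lemma source_le:
  "source \<le> integral_int D T (sq (res_u f v q)) + 2 * K\<^sub>0 *
    (sqrt (measure lborel D) * sqrt T * sqrt (integral_int D T (sq (res_div v))) +
     sqrt (measure \<sigma> (frontier D)) * sqrt T * sqrt (integral_sb D \<sigma> T (sq (res_sb D v))))"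
proof -
  have Om: "\<Omega> \<in> sets borel" using \<Omega>_open by simp
  have 1: "integral_int D T (sq (res_u f v q)) = (LINT z:\<Omega>|lborel. (norm (res_u f v q z))\<^sup>2)"
    unfolding sq_def[abs_def] by (rule integral_int_\<Omega>[OF rhs_conts(2) rhs_bounds(2)])
  have c: "continuous_on \<Omega> (\<lambda>z. \<bar>res_div v z\<bar>\<^sup>2)" by (intro continuous_intros res_div_cont)
  have b: "\<bar>\<bar>res_div v z\<bar>\<^sup>2\<bar> \<le> B\<^sub>d\<^sup>2" if "z \<in> \<Omega>" for z
    using power_mono[OF res_div_bound[OF that], of 2] by simp
  have m: "emeasure lborel \<Omega> = emeasure lborel D * ennreal T"
    using D_open T_pos unfolding lborel_prod[symmetric]
    by (subst lborel.emeasure_pair_measure_Times) auto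
  have fin: "emeasure lborel D < \<infinity>" by (rule emeasure_bounded_finite[OF D_bounded])
  \<comment> \<open>The cylinder has measure |D| T, the origin of the factor T^(1/2) at the
    divergence residual.\<close>
  have m': "measure lborel \<Omega> = measure lborel D * T"
    using m T_pos by (simp add: measure_def enn2real_mult)
  have "(LINT z:\<Omega>|lborel. \<bar>res_div v z\<bar>)\<^sup>2 \<le> measure lborel \<Omega> * (LINT z:\<Omega>|lborel. \<bar>res_div v z\<bar>\<^sup>2)"
  proof (rule set_integral_square_le)
    show "set_integrable lborel \<Omega> (\<lambda>z. \<bar>res_div v z\<bar>)"
      by (rule set_integrable_\<Omega>[OF rhs_conts(3) rhs_bounds(3) Om order_refl])
    show "set_integrable lborel \<Omega> (\<lambda>z. \<bar>res_div v z\<bar>\<^sup>2)"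
      by (rule set_integrable_\<Omega>[OF c b Om order_refl])
    show "emeasure lborel \<Omega> < \<infinity>" using m fin by (simp add: ennreal_mult_less_top)
  qed (use Om in simp)
  also have "(LINT z:\<Omega>|lborel. \<bar>res_div v z\<bar>\<^sup>2) = integral_int D T (sq (res_div v))"
    using integral_int_\<Omega>[OF c b] by (simp add: sq_def[abs_def])
  finally have sq2: "(LINT z:\<Omega>|lborel. \<bar>res_div v z\<bar>)\<^sup>2 \<le> measure lborel D * T * integral_int D T (sq (res_div v))"
    unfolding m' .
  then have 2: "(LINT z:\<Omega>|lborel. \<bar>res_div v z\<bar>) \<le>
      sqrt (measure lborel D) * sqrt T * sqrt (integral_int D T (sq (res_div v)))"
    using real_le_rsqrt[OF sq2] by (simp add: real_sqrt_mult)
  have 3: "(LINT x:frontier D|\<sigma>. LINT t:{0..T}|lborel. \<bar>res_sb D v (x, t)\<bar>) \<le>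
      sqrt (measure \<sigma> (frontier D)) * sqrt T * sqrt (integral_sb D \<sigma> T (sq (res_sb D v)))"
    using surface_time_Cauchy_Schwarz[OF D_open D_bounded boundary \<sigma> _ res_sb_cont] T_pos
    by (simp add: sq_def[abs_def])
  have "2 * K\<^sub>0 * ((LINT z:\<Omega>|lborel. \<bar>res_div v z\<bar>) +
      (LINT x:frontier D|\<sigma>. LINT t:{0..T}|lborel. \<bar>res_sb D v (x, t)\<bar>)) \<le>
    2 * K\<^sub>0 * (sqrt (measure lborel D) * sqrt T * sqrt (integral_int D T (sq (res_div v))) +
     sqrt (measure \<sigma> (frontier D)) * sqrt T * sqrt (integral_sb D \<sigma> T (sq (res_sb D v))))"
    using 2 3 K0_nonneg by (intro mult_left_mono add_mono) auto
  then show ?thesis unfolding source_def 1 by (simp only: distrib_left add.assoc)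
qed

theorem energy_estimate:
  "integral_int D T (\<lambda>z. (norm (u z - v z))\<^sup>2) \<le> (T + (1 + 2 * L) * T\<^sup>2 * exp ((1 + 2 * L) * T)) *
    (integral_tb D (\<lambda>x. (norm (v (x, 0) - u (x, 0)))\<^sup>2) + source)"
proof -
  have int: "set_integrable lborel {0..T} e" by (rule borel_integrable_atLeastAtMost'[OF e_cont])
  have "integral_int D T (\<lambda>z. (norm (u z - v z))\<^sup>2) = (LINT t:{0<..<T}|lborel. e t)"
    unfolding integral_int_def e_def w_def by (simp only: norm_minus_commute)
  also have "\<dots> = integral {0..T} e"
    using set_integral_open_closed[OF int] set_borel_integral_eq_integral(2)[OF int] by simp
  also have "\<dots> \<le> (T + (1 + 2 * L) * T\<^sup>2 * exp ((1 + 2 * L) * T)) * (e 0 + source)"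
    by (rule gronwall_integral[OF T_pos _ _ e_cont energy_gronwall])
       (use L_nonneg e_nonneg[of 0] source_nonneg in auto)
  finally show ?thesis by (simp add: integral_tb_def e_def w_def)
qed

end

subsection \<open>Norms and quadrature\<close>

text \<open>The norm of a matrix in this type is the Frobenius norm, which dominates the operator
  norm by Cauchy--Schwarz in each row. Hence the dimensional constant can be taken to be 1.\<close>

lemma norm_matrix_vector_le:
  fixes A :: "real^'n^'m"
  shows "norm (A *v h) \<le> norm A * norm h"
proof -
  have "norm (A *v h) = L2_set (\<lambda>i. norm ((A *v h) $ i)) UNIV" by (simp add: norm_vec_def)
  also have "\<dots> \<le> L2_set (\<lambda>i. norm (A $ i) * norm h) UNIV"
  proof (rule L2_set_mono)
    fix i
    have "(A *v h) $ i = A $ i \<bullet> h" by (simp add: matrix_vector_mult_def inner_vec_def)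
    then show "norm ((A *v h) $ i) \<le> norm (A $ i) * norm h"
      using Cauchy_Schwarz_ineq2[of "A $ i" h] by simp
  qed simp
  also have "\<dots> = L2_set (\<lambda>i. norm (A $ i)) UNIV * norm h"
    by (rule L2_set_left_distrib[symmetric]) simp
  finally show ?thesis by (simp add: norm_vec_def)
qed

text \<open>For a continuous function the essential supremum bounds every value: the set where it is
  exceeded is open and null, hence empty.\<close>

lemma norm_le_Linf_norm:
  fixes g :: "'a::euclidean_space \<Rightarrow> 'b::real_normed_vector"
  assumes U: "open U" and g: "continuous_on U g" and z: "z \<in> U"
  shows "ereal (norm (g z)) \<le> Linf_norm U g"
proof (rule ccontr)
  let ?W = "U \<inter> (\<lambda>y. ereal (norm (g y))) -` {Linf_norm U g<..}"
  assume "\<not> ereal (norm (g z)) \<le> Linf_norm U g"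
  then have "z \<in> ?W" using z by simp
  have "open ?W"
    using U g by (intro continuous_open_preimage continuous_on_ereal continuous_on_norm) auto
  have "AE y in restrict_space lborel U. ereal (norm (g y)) \<le> Linf_norm U g"
    unfolding Linf_norm_def by (rule esssup_AE)
  then have "AE y in lborel. y \<in> U \<longrightarrow> ereal (norm (g y)) \<le> Linf_norm U g"
    using U by (subst (asm) AE_restrict_space_iff) auto
  then have "AE y in lborel. y \<notin> ?W" by eventually_elim auto
  then have "?W \<in> null_sets lborel"
    using \<open>open ?W\<close> by (subst (asm) AE_iff_null_sets[symmetric]) auto
  then have "negligible ?W" by (simp add: negligible_iff_null_sets null_sets_completionI)
  then show False using open_not_negligible \<open>open ?W\<close> \<open>z \<in> ?W\<close> by blast
qed

lemma norm_le_sup_norm: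
  assumes "compact S" "continuous_on S g" "z \<in> S"
  shows "norm (g z) \<le> sup_norm S g"
proof -
  have "compact ((\<lambda>z. norm (g z)) ` S)" using assms by (intro compact_continuous_image continuous_intros)
  then have "bdd_above ((\<lambda>z. norm (g z)) ` S)" by (intro bounded_imp_bdd_above compact_imp_bounded)
  then show ?thesis unfolding sup_norm_def using assms(3) by (rule cSUP_upper2) simp
qed

lemma Ck_upto_bounded:
  fixes g :: "'a::euclidean_space \<Rightarrow> real"
  assumes "Ck_upto k g U S"
  obtains B where "0 \<le> B" "\<And>z. z \<in> U \<Longrightarrow> \<bar>g z\<bar> \<le> B"
proof -
  have "[] \<in> multi_indices k" by (simp add: multi_indices_def)
  then have "bounded (g ` U)" using assms unfolding Ck_upto_def by force
  then obtain B where "\<forall>z\<in>U. \<bar>g z\<bar> \<le> B" unfolding bounded_iff by auto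
  then show ?thesis using that[of "max 0 B"] by (simp add: le_max_iff_disj)
qed

lemma training_error_square:
  assumes "\<And>n. n < N \<Longrightarrow> 0 < w n"
  shows "(training_error N z w R)\<^sup>2 = (\<Sum>n<N. w n * sq R (z n))"
  unfolding training_error_def sq_def
  using assms by (intro real_sqrt_pow2 sum_nonneg mult_nonneg_nonneg) (auto simp: less_imp_le)

text \<open>The second claim follows from the quadrature bound itself, whose left-hand side is an
  absolute value; it makes the square root of the error meaningful.\<close>

lemma quadrature_error:
  assumes q: "quadrature_bound cls nrm I N z w C \<alpha>" and cls: "cls (sq R)"
    and w: "\<And>n. n < N \<Longrightarrow> 0 < w n"
  shows "I (sq R) \<le> (training_error N z w R)\<^sup>2 + C (nrm (sq R)) * real N powr (- \<alpha>)"
    and "0 \<le> C (nrm (sq R)) * real N powr (- \<alpha>)"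
proof -
  have "(training_error N z w R)\<^sup>2 = (\<Sum>n<N. w n * sq R (z n))"
    by (rule training_error_square) (rule w)
  then have "\<bar>I (sq R) - (training_error N z w R)\<^sup>2\<bar> \<le> C (nrm (sq R)) * real N powr (- \<alpha>)"
    using q cls unfolding quadrature_bound_def by simp
  then show "I (sq R) \<le> (training_error N z w R)\<^sup>2 + C (nrm (sq R)) * real N powr (- \<alpha>)"
    "0 \<le> C (nrm (sq R)) * real N powr (- \<alpha>)" by linarith+
qed

text \<open>For residuals that enter linearly: subadditivity of the square root separates the
  training error from the quadrature error and halves the exponent of the rate.\<close>

lemma quadrature_error_sqrt:
  assumes q: "quadrature_bound cls nrm I N z w C \<alpha>" and cls: "cls (sq R)"
    and w: "\<And>n. n < N \<Longrightarrow> 0 < w n"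
  shows "sqrt (I (sq R)) \<le> training_error N z w R + sqrt (C (nrm (sq R))) * real N powr (- (\<alpha> / 2))"
proof -
  let ?b = "C (nrm (sq R)) * real N powr (- \<alpha>)"
  have t: "0 \<le> training_error N z w R"
    unfolding training_error_def
    using w by (intro real_sqrt_ge_zero sum_nonneg mult_nonneg_nonneg) (auto simp: less_imp_le)
  have "sqrt (I (sq R)) \<le> sqrt ((training_error N z w R)\<^sup>2 + ?b)"
    by (intro real_sqrt_le_mono quadrature_error(1)[OF q cls w])
  also have "\<dots> \<le> sqrt ((training_error N z w R)\<^sup>2) + sqrt ?b"
    by (intro sqrt_add_le_add_sqrt quadrature_error(2)[OF q cls w]) auto
  also have "sqrt ?b = sqrt (C (nrm (sq R))) * real N powr (- (\<alpha> / 2))"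
  proof -
    have "sqrt (real N powr (- \<alpha>)) = real N powr (- (\<alpha> / 2))"
      by (simp add: powr_half_sqrt[symmetric] powr_powr)
    then show ?thesis by (simp add: real_sqrt_mult)
  qed
  finally show ?thesis using t by simp
qed

subsection \<open>The error bound\<close>

lemma euler_error_bound:
  fixes D :: "(real^'d) set" and u v :: "(real^'d) \<times> real \<Rightarrow> real^'d" and p q :: "(real^'d) \<times> real \<Rightarrow> real"
  assumes D: "open D" "bounded D" "C1_boundary D" "D \<noteq> {}" and \<sigma>: "is_surface_measure D \<sigma>" and T: "0 < T"
    and sol: "classical_euler_solution D T f ubar u p" and f: "continuous_on (D \<times> {0<..<T}) f"
    and Linf: "Linf_norm (D \<times> {0<..<T}) (space_jacobian u) < \<infinity>"
    and v: "Ck_on 1 v (D \<times> {0<..<T})" "continuous_on (closure D \<times> {0..T}) v"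
    and q: "Ck_on 1 q (D \<times> {0<..<T})" "continuous_on (closure D \<times> {0..T}) q"
    and Ru: "Ck_upto m (sq (res_u f v q)) (D \<times> {0<..<T}) S"
    and Rd: "Ck_upto m (sq (res_div v)) (D \<times> {0<..<T}) S"
    and K: "K = (sup_norm (closure D \<times> {0..T}) u + sup_norm (closure D \<times> {0..T}) v)\<^sup>2 / 2 +
      sup_norm (closure D \<times> {0..T}) p + sup_norm (closure D \<times> {0..T}) q"
    and c: "c = 1 + 2 * real_of_ereal (Linf_norm (D \<times> {0<..<T}) (space_jacobian u))"
  shows "0 \<le> K" and "1 \<le> c"
    and "(generalization_error D T u v)\<^sup>2 \<le> (T + c * T\<^sup>2 * exp (c * T)) *
      (integral_tb D (sq (res_tb ubar v)) + integral_int D T (sq (res_u f v q)) + 2 * K *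
        (sqrt (measure lborel D) * sqrt T * sqrt (integral_int D T (sq (res_div v))) +
         sqrt (measure \<sigma> (frontier D)) * sqrt T * sqrt (integral_sb D \<sigma> T (sq (res_sb D v)))))" (is ?bound)
proof -
  let ?\<Omega> = "D \<times> {0<..<T}" and ?Q = "closure D \<times> {0..T}"
  have Om: "open ?\<Omega>" using D by (intro open_Times) auto
  have Qc: "compact ?Q" using D by (intro compact_Times) auto
  have u: "Ck_on 1 u ?\<Omega>" "continuous_on ?Q u" and p: "continuous_on ?Q p"
    and momentum: "\<And>z. z \<in> ?\<Omega> \<Longrightarrow> time_deriv u z + convection u z + space_grad p z = f z"
    and pd: "\<And>x t. x \<in> D \<Longrightarrow> t \<in> {0<..<T} \<Longrightarrow> (\<lambda>y. p (y, t)) differentiable (at x)"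
    and incompressible: "\<And>z. z \<in> ?\<Omega> \<Longrightarrow> space_div u z = 0"
    and no_flux: "\<And>x t. x \<in> frontier D \<Longrightarrow> t \<in> {0<..<T} \<Longrightarrow> u (x, t) \<bullet> outward_normal D x = 0"
    and initial: "\<And>x. x \<in> D \<Longrightarrow> u (x, 0) = ubar x"
    using sol unfolding classical_euler_solution_def by blast+
  \<comment> \<open>Solved for the pressure gradient, the momentum equation leaves only continuous
    terms.\<close>
  have p_grad: "continuous_on ?\<Omega> (space_grad p)"
  proof -
    have "continuous_on ?\<Omega> (\<lambda>z. f z - time_deriv u z - convection u z)"
      unfolding convection_def
      by (intro continuous_intros f continuous_time_deriv continuous_space_jacobian_mult u Ck_on_continuous[OF u(1)])
    then show ?thesis
    proof (rule continuous_on_eq)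
      show "f z - time_deriv u z - convection u z = space_grad p z" if "z \<in> ?\<Omega>" for z
        using momentum[OF that] by (simp add: algebra_simps)
    qed
  qed
  have qd: "(\<lambda>y. q (y, t)) differentiable (at x)" if "x \<in> D" "t \<in> {0<..<T}" for x t
    using space_slice_derivative[OF q(1), of x t] that by (auto intro: differentiableI)
  interpret velocity_pair D T f u v p q
    by unfold_locales (fact D T u v p q(2) pd qd p_grad continuous_space_grad[OF q(1)] momentum incompressible)+
  define L where "L = real_of_ereal (Linf_norm ?\<Omega> (space_jacobian u))"
  obtain x0 where "x0 \<in> D" using D(4) by blast
  then have z0: "(x0, T / 2) \<in> ?\<Omega>" using T by simp
  have J: "ereal (norm (space_jacobian u z)) \<le> Linf_norm ?\<Omega> (space_jacobian u)" if "z \<in> ?\<Omega>" for z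
    by (rule norm_le_Linf_norm[OF Om continuous_space_jacobian[OF u(1)] that])
  \<comment> \<open>A point of the cylinder bounds the norm from below; with finiteness from above
    the extended real is an honest real, so the conversion in \<open>c\<close> does not fall back to
    its default value.\<close>
  have "0 \<le> Linf_norm ?\<Omega> (space_jacobian u)"
    using J[OF z0] by (rule order_trans[rotated]) simp
  then have L: "Linf_norm ?\<Omega> (space_jacobian u) = ereal L" "0 \<le> L"
    using Linf by (auto simp: L_def ereal_real' real_of_ereal_pos)
  have grad: "norm (space_jacobian u z *v h) \<le> L * norm h" if "z \<in> ?\<Omega>" for z h
  proof -
    have "norm (space_jacobian u z) \<le> L" using J[OF that] by (simp add: L)
    then show ?thesis
      using norm_matrix_vector_le[of "space_jacobian u z" h] mult_right_mono[of _ L "norm h"] by (meson norm_ge_zero order_trans)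
  qed
  have bound: "\<bar>E z\<bar> + \<bar>\<pi> z\<bar> \<le> K" if z: "z \<in> ?Q" for z
  proof -
    note le = norm_le_sup_norm[OF Qc _ z]
    have "norm (w z) \<le> norm (v z) + norm (u z)" unfolding w_def by (rule norm_triangle_ineq4)
    also have "\<dots> \<le> sup_norm ?Q u + sup_norm ?Q v" using le[OF u(2)] le[OF v(2)] by linarith
    finally have "(norm (w z))\<^sup>2 \<le> (sup_norm ?Q u + sup_norm ?Q v)\<^sup>2" by (rule power_mono) simp
    then have "\<bar>E z\<bar> \<le> (sup_norm ?Q u + sup_norm ?Q v)\<^sup>2 / 2"
      by (simp add: E_def power2_norm_eq_inner)
    moreover have "\<bar>\<pi> z\<bar> \<le> sup_norm ?Q p + sup_norm ?Q q"
      using le[OF p] le[OF q(2)] by (simp add: \<pi>_def)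
    ultimately show ?thesis unfolding K by linarith
  qed
  have "(x0, T / 2) \<in> ?Q" using z0 \<Omega>_subset by blast
  from bound[OF this] show K0: "0 \<le> K" by linarith
  show "1 \<le> c" using L(2) by (simp add: c L_def)
  \<comment> \<open>Only the squared residuals are assumed to be of class C^m with bounded
    derivatives; order zero already bounds the residuals.\<close>
  obtain B1 where B1: "0 \<le> B1" "\<And>z. z \<in> ?\<Omega> \<Longrightarrow> \<bar>sq (res_u f v q) z\<bar> \<le> B1"
    using Ck_upto_bounded[OF Ru] by blast
  obtain B2 where B2: "0 \<le> B2" "\<And>z. z \<in> ?\<Omega> \<Longrightarrow> \<bar>sq (res_div v) z\<bar> \<le> B2"
    using Ck_upto_bounded[OF Rd] by blast
  have R1: "norm (res_u f v q z) \<le> sqrt B1" if "z \<in> ?\<Omega>" for z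
    using B1(2)[OF that] by (intro real_le_rsqrt) (simp add: sq_def)
  have R2: "\<bar>res_div v z\<bar> \<le> sqrt B2" if "z \<in> ?\<Omega>" for z
    using B2(2)[OF that] by (intro real_le_rsqrt) (simp add: sq_def)
  interpret velocity_bounds D T f u v p q \<sigma> K "sqrt B1" "sqrt B2" L
    by unfold_locales (fact D \<sigma> no_flux bound K0 L(2) R1 R2 grad)+
  have gen: "(generalization_error D T u v)\<^sup>2 = integral_int D T (\<lambda>z. (norm (u z - v z))\<^sup>2)"
    unfolding generalization_error_def
    by (intro real_sqrt_pow2) (simp add: integral_int_def set_lebesgue_integral_def)
  have tb: "integral_tb D (\<lambda>x. (norm (v (x, 0) - u (x, 0)))\<^sup>2) = integral_tb D (sq (res_tb ubar v))"
    unfolding integral_tb_def set_lebesgue_integral_def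
    by (intro Bochner_Integration.integral_cong[OF refl]) (auto simp: indicator_def sq_def res_tb_def initial)
  have cL: "c = 1 + 2 * L" by (simp add: c L_def)
  have "(generalization_error D T u v)\<^sup>2 \<le> (T + c * T\<^sup>2 * exp (c * T)) *
      (integral_tb D (sq (res_tb ubar v)) + source)"
    using energy_estimate unfolding gen tb cL .
  also have "\<dots> \<le> (T + c * T\<^sup>2 * exp (c * T)) *
      (integral_tb D (sq (res_tb ubar v)) + (integral_int D T (sq (res_u f v q)) + 2 * K *
        (sqrt (measure lborel D) * sqrt T * sqrt (integral_int D T (sq (res_div v))) +
         sqrt (measure \<sigma> (frontier D)) * sqrt T * sqrt (integral_sb D \<sigma> T (sq (res_sb D v))))))"
    using T L(2) by (intro mult_left_mono add_left_mono source_le) (simp add: cL)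
  finally show ?bound
    by (simp only: add.assoc)
qed

text \<open>Enlarging the separate factors \<open>a\<close> and \<open>b\<close> to
  \<open>a + b\<close> allows a single constant in front of the sum of the divergence and boundary
  contributions, for training and quadrature errors alike.\<close>

lemma combine_bounds:
  fixes K a b :: real
  assumes "0 \<le> K" "0 \<le> a" "0 \<le> b" "0 \<le> T" "0 \<le> F"
    and tb: "Itb \<le> Etb\<^sup>2 + Qtb" and iu: "Iu \<le> Eu\<^sup>2 + Qu"
    and d: "0 \<le> Idiv" "sqrt Idiv \<le> Ed + Qd" and s: "0 \<le> Isb" "sqrt Isb \<le> Es + Qs"
  shows "F * (Itb + Iu + 2 * K * (a * sqrt T * sqrt Idiv + b * sqrt T * sqrt Isb)) \<le>
    F * (Etb\<^sup>2 + Eu\<^sup>2 + (2 * K * (a + b)) * sqrt T * (Ed + Es)) +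
    F * (Qtb + Qu + (2 * K * (a + b)) * sqrt T * (Qd + Qs))"
proof -
  have "a * sqrt T * sqrt Idiv \<le> (a + b) * sqrt T * (Ed + Qd)"
    using assms by (intro mult_mono mult_right_mono mult_nonneg_nonneg) auto
  moreover have "b * sqrt T * sqrt Isb \<le> (a + b) * sqrt T * (Es + Qs)"
    using assms by (intro mult_mono mult_right_mono mult_nonneg_nonneg) auto
  ultimately have "a * sqrt T * sqrt Idiv + b * sqrt T * sqrt Isb \<le>
      (a + b) * sqrt T * (Ed + Qd) + (a + b) * sqrt T * (Es + Qs)" by (rule add_mono)
  then have "2 * K * (a * sqrt T * sqrt Idiv + b * sqrt T * sqrt Isb) \<le>
      2 * K * ((a + b) * sqrt T * (Ed + Qd) + (a + b) * sqrt T * (Es + Qs))"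
    using \<open>0 \<le> K\<close> by (intro mult_left_mono) auto
  also have "\<dots> = (2 * K * (a + b)) * sqrt T * (Ed + Es) + (2 * K * (a + b)) * sqrt T * (Qd + Qs)"
    by (simp add: algebra_simps)
  finally have "Itb + Iu + 2 * K * (a * sqrt T * sqrt Idiv + b * sqrt T * sqrt Isb) \<le>
      (Etb\<^sup>2 + Eu\<^sup>2 + (2 * K * (a + b)) * sqrt T * (Ed + Es)) +
      (Qtb + Qu + (2 * K * (a + b)) * sqrt T * (Qd + Qs))"
    using tb iu by linarith
  then have "F * (Itb + Iu + 2 * K * (a * sqrt T * sqrt Idiv + b * sqrt T * sqrt Isb)) \<le>
      F * ((Etb\<^sup>2 + Eu\<^sup>2 + (2 * K * (a + b)) * sqrt T * (Ed + Es)) +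
      (Qtb + Qu + (2 * K * (a + b)) * sqrt T * (Qd + Qs)))"
    using \<open>0 \<le> F\<close> by (rule mult_left_mono)
  then show ?thesis by (simp only: distrib_left)
qed

theorem theorem5p1:
  assumes dim: "CARD('d::finite) \<in> {2, 3}"
  shows "\<exists>C\<^sub>d>0. \<forall>(D :: (real^'d) set) \<sigma>.
    open D \<and> bounded D \<and> connected D \<and> C1_boundary D \<and> is_surface_measure D \<sigma> \<longrightarrow>
    (\<exists>C0 :: real \<Rightarrow> real \<Rightarrow> real \<Rightarrow> real \<Rightarrow> real.
      \<forall>(T :: real) f ubar u p (k :: nat) \<rho> ws \<Theta> \<theta>s (lam :: real) (lamreg :: real) Jreg
        (\<epsilon> :: real) (\<delta> :: real)
        (Ntb :: nat) xtb wtb (Ctb :: real \<Rightarrow> real) (\<alpha>tb :: real)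
        (Nsb :: nat) zsb wsb (Csb :: real \<Rightarrow> real) (\<alpha>sb :: real)
        (Nint :: nat) zint wint (Cint :: real \<Rightarrow> real) (\<alpha>int :: real).
      (let us = nn_velocity \<rho> ws \<theta>s :: (real^'d) \<times> real \<Rightarrow> real^'d;
           ps = nn_pressure \<rho> ws \<theta>s :: (real^'d) \<times> real \<Rightarrow> real;
           Q = closure D \<times> {0..T};
           Ru2 = sq (res_u f us ps);
           Rdiv2 = sq (res_div us);
           Rsb2 = sq (res_sb D us);
           Rtb2 = sq (res_tb ubar us);
           Etb = training_error Ntb xtb wtb (res_tb ubar us);
           Esb = training_error Nsb zsb wsb (res_sb D us);
           Eu = training_error Nint zint wint (res_u f us ps);
           Ediv = training_error Nint zint wint (res_div us);
           C0' = C0 (sup_norm Q u) (sup_norm Q us) (sup_norm Q p) (sup_norm Q ps);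
           Cinf = 1 + 2 * C\<^sub>d * real_of_ereal (Linf_norm (D \<times> {0<..<T}) (space_jacobian u));
           Cqtb = Ctb (Ck_norm k Rtb2 D);
           Cqu = Cint (Ck_norm (k - 1) Ru2 (D \<times> {0<..<T}));
           Cqdiv = Cint (Ck_norm (k - 1) Rdiv2 (D \<times> {0<..<T}));
           Cqsb = Csb (Ck_restr_norm k Rsb2 (frontier D \<times> {0..T}))
       in
         0 < T \<and>
         Ck_on 1 f (D \<times> {0<..<T}) \<and>
         classical_euler_solution D T f ubar u p \<and>
         Linf_norm (D \<times> {0<..<T}) (space_jacobian u) < \<infinity> \<and>
         \<comment> \<open>quadrature rules\<close>
         0 < Ntb \<and> (\<forall>n<Ntb. xtb n \<in> D \<and> 0 < wtb n) \<and> 0 < \<alpha>tb \<and>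
         0 < Nsb \<and> (\<forall>n<Nsb. zsb n \<in> frontier D \<times> {0<..T} \<and> 0 < wsb n) \<and> 0 < \<alpha>sb \<and>
         0 < Nint \<and> (\<forall>n<Nint. zint n \<in> D \<times> {0<..<T} \<and> 0 < wint n) \<and> 0 < \<alpha>int \<and>
         quadrature_bound (\<lambda>g. Ck_upto k g D D) (\<lambda>g. Ck_norm k g D)
           (integral_tb D) Ntb xtb wtb Ctb \<alpha>tb \<and>
         quadrature_bound (\<lambda>g. Ck_restr k g (frontier D \<times> {0..T}))
           (\<lambda>g. Ck_restr_norm k g (frontier D \<times> {0..T}))
           (integral_sb D \<sigma> T) Nsb zsb wsb Csb \<alpha>sb \<and>
         quadrature_bound (\<lambda>g. Ck_upto (k - 1) g (D \<times> {0<..<T}) (D \<times> {0..T}))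
           (\<lambda>g. Ck_norm (k - 1) g (D \<times> {0<..<T}))
           (integral_int D T) Nint zint wint Cint \<alpha>int \<and>
         \<comment> \<open>the trained network\<close>
         1 \<le> k \<and>
         nn_family D T k \<rho> ws \<Theta> \<and>
         0 \<le> lamreg \<and> lamreg < 1 \<and> 0 \<le> \<epsilon> \<and> 0 < \<delta> \<and>
         approx_local_minimizer \<Theta>
           (\<lambda>\<theta>. pinn_loss D f ubar Ntb xtb wtb Nsb zsb wsb Nint zint wint lam
                   (nn_velocity \<rho> ws \<theta>) (nn_pressure \<rho> ws \<theta>) + lamreg * Jreg \<theta>) \<epsilon> \<delta> \<theta>s \<and>
         \<comment> \<open>the norms of the squared residuals are defined and finite\<close>
         Ck_upto k Rtb2 D D \<and>
         Ck_restr k Rsb2 (frontier D \<times> {0..T}) \<and>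
         Ck_upto (k - 1) Ru2 (D \<times> {0<..<T}) (D \<times> {0..T}) \<and>
         Ck_upto (k - 1) Rdiv2 (D \<times> {0<..<T}) (D \<times> {0..T})
         \<longrightarrow>
         (generalization_error D T u us)\<^sup>2 \<le>
           (T + Cinf * T\<^sup>2 * exp (Cinf * T)) *
             (Etb\<^sup>2 + Eu\<^sup>2 + C0' * sqrt T * (Ediv + Esb)) +
           (T + Cinf * T\<^sup>2 * exp (Cinf * T)) *
             (Cqtb * real Ntb powr (- \<alpha>tb) + Cqu * real Nint powr (- \<alpha>int) +
              C0' * sqrt T *
                (sqrt Cqdiv * real Nint powr (- (\<alpha>int / 2)) +
                 sqrt Cqsb * real Nsb powr (- (\<alpha>sb / 2))))))"
proof (intro exI[of _ "1::real"] conjI allI impI, goal_cases)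
  case 1
  show ?case by simp
next
  case (2 D \<sigma>)
  then have D: "open D" "bounded D" "C1_boundary D" and \<sigma>: "is_surface_measure D \<sigma>" by blast+
  \<comment> \<open>The Cauchy--Schwarz factors of the divergence and boundary residuals. They
    depend on the domain and its surface measure alone, so they may enter the function
    \<open>C0\<close>, which is chosen before the time horizon, the solution and the
    network.\<close>
  define a where "a = sqrt (measure lborel D)"
  define b where "b = sqrt (measure \<sigma> (frontier D))"
  have ab: "0 \<le> a" "0 \<le> b" by (simp_all add: a_def b_def)
  show ?case
    unfolding Let_def
  \<comment> \<open>\<open>(U + V)\<^sup>2 / 2\<close> bounds the energy density of the difference
    and \<open>P + P'\<close> the pressure difference, in terms of the four sup norms.\<close>
  proof (intro exI[of _ "\<lambda>U V P P'. 2 * ((U + V)\<^sup>2 / 2 + P + P') * (a + b)"] allI impI, goal_cases)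
    case (1 T f ubar u p k \<rho> ws \<Theta> \<theta>s lam lamreg Jreg \<epsilon> \<delta> Ntb xtb wtb Ctb \<alpha>tb Nsb zsb wsb Csb \<alpha>sb Nint zint wint Cint \<alpha>int)
    let ?us = "nn_velocity \<rho> ws \<theta>s :: (real^'d) \<times> real \<Rightarrow> real^'d"
    let ?ps = "nn_pressure \<rho> ws \<theta>s :: (real^'d) \<times> real \<Rightarrow> real"
    let ?\<Omega> = "D \<times> {0<..<T}" and ?Q = "closure D \<times> {0..T}"
    have T: "0 < T" and f: "Ck_on 1 f ?\<Omega>" and sol: "classical_euler_solution D T f ubar u p"
      and Linf: "Linf_norm ?\<Omega> (space_jacobian u) < \<infinity>"
      using 1 by - (elim conjE, assumption)+
    have Ntb: "0 < Ntb" and xtb: "\<forall>n<Ntb. xtb n \<in> D \<and> 0 < wtb n"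
      and zsb: "\<forall>n<Nsb. zsb n \<in> frontier D \<times> {0<..T} \<and> 0 < wsb n"
      and zint: "\<forall>n<Nint. zint n \<in> ?\<Omega> \<and> 0 < wint n"
      using 1 by - (elim conjE, assumption)+
    have qtb: "quadrature_bound (\<lambda>g. Ck_upto k g D D) (\<lambda>g. Ck_norm k g D)
           (integral_tb D) Ntb xtb wtb Ctb \<alpha>tb"
      and qsb: "quadrature_bound (\<lambda>g. Ck_restr k g (frontier D \<times> {0..T}))
           (\<lambda>g. Ck_restr_norm k g (frontier D \<times> {0..T}))
           (integral_sb D \<sigma> T) Nsb zsb wsb Csb \<alpha>sb"
      and qint: "quadrature_bound (\<lambda>g. Ck_upto (k - 1) g ?\<Omega> (D \<times> {0..T}))
           (\<lambda>g. Ck_norm (k - 1) g ?\<Omega>) (integral_int D T) Nint zint wint Cint \<alpha>int"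
      using 1 by - (elim conjE, assumption)+
    have k: "1 \<le> k" and nn: "nn_family D T k \<rho> ws \<Theta>"
      and tb: "Ck_upto k (sq (res_tb ubar ?us)) D D"
      and sb: "Ck_restr k (sq (res_sb D ?us)) (frontier D \<times> {0..T})"
      and ru: "Ck_upto (k - 1) (sq (res_u f ?us ?ps)) ?\<Omega> (D \<times> {0..T})"
      and rd: "Ck_upto (k - 1) (sq (res_div ?us)) ?\<Omega> (D \<times> {0..T})"
      using 1 by - (elim conjE, assumption)+
    have "\<theta>s \<in> \<Theta>" using 1 unfolding approx_local_minimizer_def by - (elim conjE, assumption)
    with nn have us: "Ck_on k ?us ?\<Omega>" "continuous_on ?Q ?us" and ps: "Ck_on k ?ps ?\<Omega>" "continuous_on ?Q ?ps"
      unfolding nn_family_def by blast+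
    \<comment> \<open>A training point for the initial residual exists and lies in the
      domain.\<close>
    have "D \<noteq> {}" using Ntb xtb by blast
    note err = euler_error_bound[OF D this \<sigma> T sol Ck_on_continuous[OF f] Linf
        Ck_on_mono[OF us(1) k] us(2) Ck_on_mono[OF ps(1) k] ps(2) ru rd refl refl]
    have nonneg: "0 \<le> integral_int D T (sq (res_div ?us))" "0 \<le> integral_sb D \<sigma> T (sq (res_sb D ?us))"
      by (simp_all add: integral_int_def integral_sb_def set_lebesgue_integral_def sq_def)
    have F: "0 \<le> T + c * T\<^sup>2 * exp (c * T)" if "1 \<le> c" for c :: real using that T by simp
    have wtb: "\<And>n. n < Ntb \<Longrightarrow> 0 < wtb n" and wsb: "\<And>n. n < Nsb \<Longrightarrow> 0 < wsb n"
      and wint: "\<And>n. n < Nint \<Longrightarrow> 0 < wint n"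
      using xtb zsb zint by blast+
    from order_trans[OF err(3)[folded a_def b_def] combine_bounds[OF err(1) ab less_imp_le[OF T] F[OF err(2)]
        quadrature_error(1)[OF qtb tb wtb] quadrature_error(1)[OF qint ru wint]
        nonneg(1) quadrature_error_sqrt[OF qint rd wint] nonneg(2) quadrature_error_sqrt[OF qsb sb wsb]]]
    show ?case by simp
  qed
qed

end
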